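(* Let $T$ be an interval exchange map with no connection such that: - for all $\tau>0$, $\|B(n_k,n_{k+1})\|=O(\|B(0,n_k)\|^\tau)$; - for all $\tau>0$, $\|B_s(m,n)\|=O(\|B(0,n)\|^\tau)$ and $\|B_\flat(m,n)^{-1}\|=O(\|B(0,n)\|^\tau)$, uniformly in $0\le m\le n$; - $\dim\Gamma_s(T)=g$. Let $\Gamma_u(T)$ be a subspace of $\Gamma_\partial(T)$ supplementing $\Gamma_s(T)$ in $\Gamma_\partial(T)$. For $\varphi\in C^1_0(\mathbf u(T))$ let $\chi=L_1(\varphi)$ be the unique element of $\Gamma_u(T)$ such that for every $\tau>0$ the special Birkhoff sums satisfy $\|S(0,n)(\varphi-\chi)\|_{C^0}=O(\|B(0,n)\|^\tau)$. Then for every $\tau>0$ there is a constant $C(\tau)$ such that for all $\varphi\in C^1_0(\mathbf u(T))$ and all integers $N\ge1$, $$\Big\|\sum_{j=0}^{N-1}(\varphi-\chi)\circ T^j\Big\|_{C^0}\le C(\tau)\,\|\varphi\|_{C^1}\,N^\tau .$$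
   Context: **Interval exchange maps.** Let $\mathcal A$ be an alphabet with $d\ge 2$ symbols. An interval exchange map (i.e.m.) $T$ on a bounded open interval $I(T)$ is given by two partitions mod $0$, $I(T)=\bigsqcup_\alpha I^t_\alpha(T)=\bigsqcup_\alpha I^b_\alpha(T)$, into open intervals indexed by $\mathcal A$ with $|I^t_\alpha(T)|=|I^b_\alpha(T)|$; $T$ maps each $I^t_\alpha(T)$ onto $I^b_\alpha(T)$ by translation. Write $I(T)=(u_0(T),u_d(T))=(v_0(T),v_d(T))$; the points $u_1(T)<\dots<u_{d-1}(T)$ separating the $I^t_\alpha$ are the singularities of $T$, the points $v_1(T)<\dots<v_{d-1}(T)$ separating the $I^b_\alpha$ are those of $T^{-1}$. The combinatorial data $\pi=(\pi_t,\pi_b)$ are the bijections $\mathcal A\to\{1,\dots,d\}$ with $I^t_\alpha=(u_{\pi_t(\alpha)-1},u_{\pi_t(\alpha)})$, $I^b_\alpha=(v_{\pi_b(\alpha)-1},v_{\pi_b(\alpha)})$. They are always assumed irreducible: $\pi_t^{-1}(\{1,\dots,k\})\neq\pi_b^{-1}(\{1,\dots,k\})$ for $1\le k<d$. A connection is a triple $(u_i,v_j,m)$, $0<i,j<d$, $m\ge0$, with $T^m(v_j)=u_i$. Let $\Omega(\pi)$ be the antisymmetric matrix with $\Omega_{\alpha\beta}=+1$ if $\pi_t(\alpha)<\pi_t(\beta),\ \pi_b(\alpha)>\pi_b(\beta)$, $-1$ if $\pi_t(\alpha)>\pi_t(\beta),\ \pi_b(\alpha)<\pi_b(\beta)$,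 and $0$ otherwise; its rank is $2g$, where $g$ is called the genus. **Rauzy–Veech algorithm.** Let $T$ have no connection, and let $\pi_t(\alpha_t)=\pi_b(\alpha_b)=d$. The elementary step replaces $T$ by its first return map $\widehat T$ to $(u_0(T),\max(u_{d-1}(T),v_{d-1}(T)))$, again an i.e.m. without connection, labeled by $\mathcal A$ as follows. If $u_{d-1}<v_{d-1}$: $\widehat I^t_\alpha=I^t_\alpha$ for $\alpha\ne\alpha_t$, and $\widehat I^t_{\alpha_t}=I^t_{\alpha_t}\cap(u_0,v_{d-1})$. If $u_{d-1}>v_{d-1}$: $\widehat I^t_\alpha=I^t_\alpha$ for $\alpha\neq\alpha_t,\alpha_b$; $\widehat I^t_{\alpha_t}=T^{-1}(I^t_{\alpha_t})$ (the right part of $I^t_{\alpha_b}$), and $\widehat I^t_{\alpha_b}$ is the remaining left part of $I^t_{\alpha_b}$. Iterating from $T(0)=T$ gives i.e.m.'s $T(n)$, $n\ge0$, on decreasing intervals $I(n)=I(T(n))$ with the same left endpoint; for $n\ge m$, $T(n)$ is the first return map of $T(m)$ to $I(n)$. **Function spaces, special Birkhoff sums, cocycle.** For an integer $r\ge0$, $C^r(\mathbf u(T))=\prod_{i=1}^dC^r([u_{i-1}(T),u_i(T)])$ with its product norm. $\Gamma(T)\simeq\mathbb R^{\mathcal A}$ is the space of functions constant on each $I^t_\alpha(T)$. For $0\le m\le n$ and $\varphi\in C^0(\mathbf u(T(m)))$, the special Birkhoff sum is $S(m,n)\varphi(x)=\sum_{0\le j<r(x)}\varphi(T(m)^j(x))$,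 where $r(x)$ is the return time of $x$ to $I(n)$ under $T(m)$ (extended continuously to each closed interval), an element of $C^0(\mathbf u(T(n)))$. $S(m,n)$ maps $\Gamma(T(m))$ to $\Gamma(T(n))$; $B(m,n)$ is its matrix there: $B_{\alpha\beta}(m,n)$ is the number of visits of $I^t_\alpha(T(n))$ to $I^t_\beta(T(m))$ under $T(m)$ before returning to $I(n)$. Put $n_0=0$ and let $n_{k+1}$ be the smallest integer such that all coefficients of $B(n_k,n_{k+1})$ are positive. Norms: $\ell_\infty$ norm on $\mathbb R^{\mathcal A}$ and $\|B\|=\max_\alpha\sum_\beta|B_{\alpha\beta}|$. The $C^0$ norm of a general Birkhoff sum is the supremum of its absolute value over the points where it is defined. **Boundary operator.** On the $2d$-element set of symbols $\{U_0=V_0,U_1,V_1,\dots,U_{d-1},V_{d-1},U_d=V_d\}$ define the permutation $\sigma_\pi$ by $\sigma_\pi(U_i)=V_j$ with $\pi_b^{-1}(j+1)=\pi_t^{-1}(i+1)$ for $0\le i<d$, and $\sigma_\pi(V_{j'})=U_{i'}$ with $\pi_t^{-1}(i')=\pi_b^{-1}(j')$ for $0<j'\le d$. Let $\Sigma$ be the set of its cycles. For $\varphi\in C^0(\mathbf u(T))$ let $\varphi(u_i-0)$, $\varphi(u_i+0)$ be its values at $u_i$ seen in $[u_{i-1},u_i]$, resp. $[u_i,u_{i+1}]$, with $\varphi(u_0-0)=\varphi(u_d+0)=0$. The boundary operator $\partial:C^0(\mathbf u(T))\to\mathbb R^\Sigma$ is $(\partial\varphi)_C=\sum_{0\le i\le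 d,\,U_i\in C}(\varphi(u_i-0)-\varphi(u_i+0))$. $C^1_0(\mathbf u(T))$ is the kernel of $\partial$ in $C^1(\mathbf u(T))$, and $\Gamma_\partial(T)$ is the kernel of $\partial$ in $\Gamma(T)$ (it equals $\operatorname{Im}\Omega(\pi)$). **Stable space and induced operators.** For $T$ with no connection, $\Gamma_s(T)=\{\chi\in\Gamma(T):\exists\sigma>0,\ \|B(0,n)\chi\|=O(\|B(0,n)\|^{-\sigma})\}$, a subspace of $\Gamma_\partial(T)$. $B(m,n)$ maps $\Gamma_s(T(m))$ onto $\Gamma_s(T(n))$; $B_s(m,n):\Gamma_s(T(m))\to\Gamma_s(T(n))$ and $B_\flat(m,n):\Gamma(T(m))/\Gamma_s(T(m))\to\Gamma(T(n))/\Gamma_s(T(n))$ denote the induced operators (with induced and quotient norms). Under the hypotheses of the claim, the element $\chi=L_1(\varphi)\in\Gamma_u(T)$ described there exists and is unique, and $L_1:C^1_0(\mathbf u(T))\to\Gamma_u(T)$ is a bounded linear operator. *)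

theory Defs
  imports
    "HOL-Analysis.Analysis"
    "HOL-Library.Landau_Symbols"
    "HOL-Combinatorics.Orbits"
begin

section \<open>Interval exchange maps\<close>

text \<open>The alphabet is a finite type. An interval exchange map is recorded by its left
  endpoint \<open>u\<^sub>0 = v\<^sub>0\<close>, the bijections \<open>\<pi>\<^sub>t, \<pi>\<^sub>b\<close> onto \<open>{1..d}\<close> and the common lengths of
  \<open>I\<^sup>t\<^sub>\<alpha>\<close> and \<open>I\<^sup>b\<^sub>\<alpha>\<close>; the two partitions mod 0 are recovered below.\<close>

record 'a iem =
  origin :: real
  pi_t :: "'a \<Rightarrow> nat"
  pi_b :: "'a \<Rightarrow> nat"
  len :: "'a \<Rightarrow> real"

definition iem :: "'a::finite iem \<Rightarrow> bool" where
  "iem T \<longleftrightarrow>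
     2 \<le> CARD('a) \<and>
     bij_betw (pi_t T) UNIV {1..CARD('a)} \<and>
     bij_betw (pi_b T) UNIV {1..CARD('a)} \<and>
     (\<forall>\<alpha>. 0 < len T \<alpha>) \<and>
     (\<forall>k. 1 \<le> k \<and> k < CARD('a) \<longrightarrow> pi_t T -` {1..k} \<noteq> pi_b T -` {1..k})"

definition u :: "'a::finite iem \<Rightarrow> nat \<Rightarrow> real" where
  "u T i = origin T + (\<Sum>\<alpha> | pi_t T \<alpha> \<le> i. len T \<alpha>)"

definition v :: "'a::finite iem \<Rightarrow> nat \<Rightarrow> real" where
  "v T j = origin T + (\<Sum>\<alpha> | pi_b T \<alpha> \<le> j. len T \<alpha>)"

definition I_full :: "'a::finite iem \<Rightarrow> real set" where
  "I_full T = {u T 0 <..< u T CARD('a)}"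

definition It :: "'a::finite iem \<Rightarrow> 'a \<Rightarrow> real set" where
  "It T \<alpha> = {u T (pi_t T \<alpha> - 1) <..< u T (pi_t T \<alpha>)}"

definition It_closed :: "'a::finite iem \<Rightarrow> 'a \<Rightarrow> real set" where
  "It_closed T \<alpha> = {u T (pi_t T \<alpha> - 1) .. u T (pi_t T \<alpha>)}"

definition iem_dom :: "'a::finite iem \<Rightarrow> real set" where
  "iem_dom T = (\<Union>\<alpha>. It T \<alpha>)"

text \<open>\<open>letter\<close> and \<open>iem_map\<close> are only meaningful on \<open>iem_dom T\<close>; iterates of \<open>iem_map T\<close> are
  only used along orbit segments that stay in \<open>iem_dom T\<close>.\<close>

definition letter :: "'a::finite iem \<Rightarrow> real \<Rightarrow> 'a" where
  "letter T x = (THE \<alpha>. x \<in> It T \<alpha>)"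

definition iem_map :: "'a::finite iem \<Rightarrow> real \<Rightarrow> real" where
  "iem_map T x =
     x + (v T (pi_b T (letter T x) - 1) - u T (pi_t T (letter T x) - 1))"

definition orbit_defined :: "'a::finite iem \<Rightarrow> nat \<Rightarrow> real \<Rightarrow> bool" where
  "orbit_defined T m x \<longleftrightarrow> (\<forall>k<m. (iem_map T ^^ k) x \<in> iem_dom T)"

definition connection :: "'a::finite iem \<Rightarrow> nat \<Rightarrow> nat \<Rightarrow> nat \<Rightarrow> bool" where
  "connection T i j m \<longleftrightarrow>
     0 < i \<and> i < CARD('a) \<and> 0 < j \<and> j < CARD('a) \<and>
     orbit_defined T m (v T j) \<and> (iem_map T ^^ m) (v T j) = u T i"

definition no_connection :: "'a::finite iem \<Rightarrow> bool" where
  "no_connection T \<longleftrightarrow> (\<nexists>i j m. connection T i j m)"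

definition Omega :: "'a::finite iem \<Rightarrow> real^'a^'a" where
  "Omega T = (\<chi> \<alpha> \<beta>.
     if pi_t T \<alpha> < pi_t T \<beta> \<and> pi_b T \<alpha> > pi_b T \<beta> then 1
     else if pi_t T \<alpha> > pi_t T \<beta> \<and> pi_b T \<alpha> < pi_b T \<beta> then - 1
     else 0)"

definition genus :: "'a::finite iem \<Rightarrow> nat" where
  "genus T = rank (Omega T) div 2"


section \<open>The Rauzy--Veech algorithm\<close>

definition return_time :: "(real \<Rightarrow> real) \<Rightarrow> real set \<Rightarrow> real \<Rightarrow> nat" where
  "return_time f J x = (LEAST r. 0 < r \<and> (f ^^ r) x \<in> J)"

definition first_return :: "(real \<Rightarrow> real) \<Rightarrow> real set \<Rightarrow> real \<Rightarrow> real" where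
  "first_return f J x = (f ^^ return_time f J x) x"

definition rauzy_labels :: "'a::finite iem \<Rightarrow> 'a iem \<Rightarrow> bool" where
  "rauzy_labels T T' \<longleftrightarrow>
     (let d = CARD('a); \<alpha>t = inv (pi_t T) d; \<alpha>b = inv (pi_b T) d in
      if u T (d - 1) < v T (d - 1) then
        (\<forall>\<alpha>. \<alpha> \<noteq> \<alpha>t \<longrightarrow> It T' \<alpha> = It T \<alpha>) \<and>
        It T' \<alpha>t = It T \<alpha>t \<inter> {u T 0 <..< v T (d - 1)}
      else
        (\<forall>\<alpha>. \<alpha> \<noteq> \<alpha>t \<and> \<alpha> \<noteq> \<alpha>b \<longrightarrow> It T' \<alpha> = It T \<alpha>) \<and>
        It T' \<alpha>t = {x \<in> iem_dom T. iem_map T x \<in> It T \<alpha>t} \<and>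
        It T' \<alpha>b = {x \<in> It T \<alpha>b. iem_map T x < u T (d - 1)})"

text \<open>An interval exchange map is determined by its top intervals and its action on them, so
  when \<open>T\<close> has no connection exactly one \<open>T'\<close> satisfies this description.\<close>

definition rauzy_step :: "'a::finite iem \<Rightarrow> 'a iem" where
  "rauzy_step T = (THE T'.
     iem T' \<and>
     I_full T' = {u T 0 <..< max (u T (CARD('a) - 1)) (v T (CARD('a) - 1))} \<and>
     (\<forall>x \<in> iem_dom T'. iem_map T' x = first_return (iem_map T) (I_full T') x) \<and>
     rauzy_labels T T')"

definition RV :: "'a::finite iem \<Rightarrow> nat \<Rightarrow> 'a iem" where
  "RV T n = (rauzy_step ^^ n) T"


section \<open>Function spaces\<close>

text \<open>Iterated derivatives are one-sided at the endpoints of \<open>S\<close>.\<close>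

definition nth_deriv_within :: "real set \<Rightarrow> nat \<Rightarrow> (real \<Rightarrow> real) \<Rightarrow> real \<Rightarrow> real" where
  "nth_deriv_within S k f = ((\<lambda>g x. vector_derivative g (at x within S)) ^^ k) f"

definition Cr_on :: "nat \<Rightarrow> real set \<Rightarrow> (real \<Rightarrow> real) \<Rightarrow> bool" where
  "Cr_on r S f \<longleftrightarrow>
     (\<forall>k<r. \<forall>x\<in>S. nth_deriv_within S k f differentiable (at x within S)) \<and>
     (\<forall>k\<le>r. continuous_on S (nth_deriv_within S k f))"

definition Cr_norm_on :: "nat \<Rightarrow> real set \<Rightarrow> (real \<Rightarrow> real) \<Rightarrow> real" where
  "Cr_norm_on r S f = Max ((\<lambda>k. SUP x\<in>S. \<bar>nth_deriv_within S k f x\<bar>) ` {..r})"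

text \<open>The factor \<open>C\<^sup>r([u\<^sub>i\<^sub>-\<^sub>1, u\<^sub>i])\<close> of the product \<open>C\<^sup>r(u(T))\<close> is indexed by the letter
  \<open>\<alpha>\<close> with \<open>\<pi>\<^sub>t(\<alpha>) = i\<close>. Values of \<open>\<phi> \<alpha>\<close> outside the closed interval are irrelevant.\<close>

definition C_space :: "nat \<Rightarrow> 'a::finite iem \<Rightarrow> ('a \<Rightarrow> real \<Rightarrow> real) set" where
  "C_space r T = {\<phi>. \<forall>\<alpha>. Cr_on r (It_closed T \<alpha>) (\<phi> \<alpha>)}"

definition C_norm :: "nat \<Rightarrow> 'a::finite iem \<Rightarrow> ('a \<Rightarrow> real \<Rightarrow> real) \<Rightarrow> real" where
  "C_norm r T \<phi> = Max (range (\<lambda>\<alpha>. Cr_norm_on r (It_closed T \<alpha>) (\<phi> \<alpha>)))"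

definition eval_at :: "'a::finite iem \<Rightarrow> ('a \<Rightarrow> real \<Rightarrow> real) \<Rightarrow> real \<Rightarrow> real" where
  "eval_at T \<phi> x = \<phi> (letter T x) x"

text \<open>\<open>\<Gamma>(T)\<close> is identified with \<open>real^'a\<close>.\<close>

definition of_Gamma :: "real^'a::finite \<Rightarrow> 'a \<Rightarrow> real \<Rightarrow> real" where
  "of_Gamma c = (\<lambda>\<alpha> x. c $ \<alpha>)"

definition minus_Gamma :: "('a::finite \<Rightarrow> real \<Rightarrow> real) \<Rightarrow> real^'a \<Rightarrow> 'a \<Rightarrow> real \<Rightarrow> real" where
  "minus_Gamma \<phi> c = (\<lambda>\<alpha> x. \<phi> \<alpha> x - of_Gamma c \<alpha> x)"


section \<open>Birkhoff sums and the Kontsevich--Zorich cocycle\<close>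

definition birkhoff_sum :: "'a::finite iem \<Rightarrow> nat \<Rightarrow> ('a \<Rightarrow> real \<Rightarrow> real) \<Rightarrow> real \<Rightarrow> real" where
  "birkhoff_sum T N \<phi> x = (\<Sum>j<N. eval_at T \<phi> ((iem_map T ^^ j) x))"

definition birkhoff_norm :: "'a::finite iem \<Rightarrow> nat \<Rightarrow> ('a \<Rightarrow> real \<Rightarrow> real) \<Rightarrow> real" where
  "birkhoff_norm T N \<phi> = (SUP x \<in> {x. orbit_defined T N x}. \<bar>birkhoff_sum T N \<phi> x\<bar>)"

definition visit_time :: "'a::finite iem \<Rightarrow> nat \<Rightarrow> nat \<Rightarrow> real \<Rightarrow> nat" where
  "visit_time T m n x = return_time (iem_map (RV T m)) (I_full (RV T n)) x"

text \<open>The limit realises the continuous extension to the closed intervals.\<close>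

definition special_birkhoff ::
  "'a::finite iem \<Rightarrow> nat \<Rightarrow> nat \<Rightarrow> ('a \<Rightarrow> real \<Rightarrow> real) \<Rightarrow> 'a \<Rightarrow> real \<Rightarrow> real" where
  "special_birkhoff T m n \<phi> = (\<lambda>\<alpha> x.
     Lim (at x within It (RV T n) \<alpha>) (\<lambda>y. birkhoff_sum (RV T m) (visit_time T m n y) \<phi> y))"

definition B :: "'a::finite iem \<Rightarrow> nat \<Rightarrow> nat \<Rightarrow> real^'a^'a" where
  "B T m n = (\<chi> \<alpha> \<beta>. real (THE b. \<forall>x \<in> It (RV T n) \<alpha>.
     b = card {j. j < visit_time T m n x \<and> (iem_map (RV T m) ^^ j) x \<in> It (RV T m) \<beta>}))"

definition mat_norm :: "real^'a::finite^'a \<Rightarrow> real" where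
  "mat_norm M = Max (range (\<lambda>\<alpha>. \<Sum>\<beta>\<in>UNIV. \<bar>M $ \<alpha> $ \<beta>\<bar>))"

primrec accel :: "'a::finite iem \<Rightarrow> nat \<Rightarrow> nat" where
  "accel T 0 = 0"
| "accel T (Suc k) = (LEAST n. accel T k \<le> n \<and> (\<forall>\<alpha> \<beta>. 0 < B T (accel T k) n $ \<alpha> $ \<beta>))"


section \<open>The boundary operator\<close>

text \<open>The identified symbols \<open>U\<^sub>0 = V\<^sub>0\<close> and \<open>U\<^sub>d = V\<^sub>d\<close> are represented by \<open>U\<close>.\<close>

datatype symbol = U nat | V nat

definition Vsym :: "nat \<Rightarrow> nat \<Rightarrow> symbol" where
  "Vsym d j = (if j = 0 \<or> j = d then U j else V j)"

definition symbols :: "nat \<Rightarrow> symbol set" where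
  "symbols d = U ` {0..d} \<union> Vsym d ` {0..d}"

text \<open>The case \<open>U d\<close> below is \<open>V\<^sub>d\<close>; elements that are not symbols are fixed.\<close>

definition sigma :: "'a::finite iem \<Rightarrow> symbol \<Rightarrow> symbol" where
  "sigma T s = (let d = CARD('a) in case s of
     U i \<Rightarrow> if i < d then Vsym d (pi_b T (inv (pi_t T) (i + 1)) - 1)
            else if i = d then U (pi_t T (inv (pi_b T) d))
            else U i
   | V j \<Rightarrow> if 0 < j \<and> j < d then U (pi_t T (inv (pi_b T) j)) else V j)"

definition cycles :: "'a::finite iem \<Rightarrow> symbol set set" where
  "cycles T = orbit (sigma T) ` symbols CARD('a)"

definition val_left :: "'a::finite iem \<Rightarrow> ('a \<Rightarrow> real \<Rightarrow> real) \<Rightarrow> nat \<Rightarrow> real" where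
  "val_left T \<phi> i = (if i = 0 then 0 else \<phi> (inv (pi_t T) i) (u T i))"

definition val_right :: "'a::finite iem \<Rightarrow> ('a \<Rightarrow> real \<Rightarrow> real) \<Rightarrow> nat \<Rightarrow> real" where
  "val_right T \<phi> i = (if i = CARD('a) then 0 else \<phi> (inv (pi_t T) (i + 1)) (u T i))"

definition boundary :: "'a::finite iem \<Rightarrow> ('a \<Rightarrow> real \<Rightarrow> real) \<Rightarrow> symbol set \<Rightarrow> real" where
  "boundary T \<phi> C = (\<Sum>i | i \<le> CARD('a) \<and> U i \<in> C. val_left T \<phi> i - val_right T \<phi> i)"

definition C1_0 :: "'a::finite iem \<Rightarrow> ('a \<Rightarrow> real \<Rightarrow> real) set" where
  "C1_0 T = {\<phi> \<in> C_space 1 T. \<forall>C \<in> cycles T. boundary T \<phi> C = 0}"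

definition Gamma_bd :: "'a::finite iem \<Rightarrow> (real^'a) set" where
  "Gamma_bd T = {c. \<forall>C \<in> cycles T. boundary T (of_Gamma c) C = 0}"


section \<open>The stable space and the induced operators\<close>

text \<open>The \<open>\<ell>\<^sub>\<infinity>\<close> norm on \<open>real^'a\<close> is \<open>infnorm\<close>.\<close>

definition Gamma_s :: "'a::finite iem \<Rightarrow> (real^'a) set" where
  "Gamma_s T = {c. \<exists>\<sigma>>0.
     (\<lambda>n. infnorm (B T 0 n *v c)) \<in> O(\<lambda>n. mat_norm (B T 0 n) powr (- \<sigma>))}"

definition Bs_norm :: "'a::finite iem \<Rightarrow> nat \<Rightarrow> nat \<Rightarrow> real" where
  "Bs_norm T m n =
     (SUP c \<in> {c \<in> Gamma_s (RV T m). infnorm c \<le> 1}. infnorm (B T m n *v c))"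

definition cong_s :: "'a::finite iem \<Rightarrow> ((real^'a) \<times> (real^'a)) set" where
  "cong_s T = {(x, y). x - y \<in> Gamma_s T}"

definition Gamma_flat :: "'a::finite iem \<Rightarrow> (real^'a) set set" where
  "Gamma_flat T = UNIV // cong_s T"

definition quot_norm :: "(real^'a::finite) set \<Rightarrow> real" where
  "quot_norm X = (INF x\<in>X. infnorm x)"

definition B_flat :: "'a::finite iem \<Rightarrow> nat \<Rightarrow> nat \<Rightarrow> (real^'a) set \<Rightarrow> (real^'a) set" where
  "B_flat T m n X = (\<Union>x\<in>X. cong_s (RV T n) `` {B T m n *v x})"

definition B_flat_inv_norm :: "'a::finite iem \<Rightarrow> nat \<Rightarrow> nat \<Rightarrow> real" where
  "B_flat_inv_norm T m n =
     (SUP Y \<in> {Y \<in> Gamma_flat (RV T n). quot_norm Y \<le> 1}.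
        quot_norm (inv_into (Gamma_flat (RV T m)) (B_flat T m n) Y))"

definition supplement :: "'b::real_vector set \<Rightarrow> 'b set \<Rightarrow> 'b set \<Rightarrow> bool" where
  "supplement W S E \<longleftrightarrow> subspace W \<and> W \<inter> S = {0} \<and> {x + y | x y. x \<in> W \<and> y \<in> S} = E"

definition L1 :: "'a::finite iem \<Rightarrow> (real^'a) set \<Rightarrow> ('a \<Rightarrow> real \<Rightarrow> real) \<Rightarrow> real^'a" where
  "L1 T \<Gamma>u \<phi> = (THE c. c \<in> \<Gamma>u \<and> (\<forall>\<tau>>0.
     (\<lambda>n. C_norm 0 (RV T n) (special_birkhoff T 0 n (minus_Gamma \<phi> c)))
       \<in> O(\<lambda>n. mat_norm (B T 0 n) powr \<tau>)))"

end

(* Idea of the proof.  Everything is done along the elementary steps of the algorithm: writing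
   N(n) for the norm of B(0,n), the first hypothesis is used only to show that n is
   O(N(n)^tau) for every tau > 0 and that N(n) is at most a power of the smallest return time.

   Since the towers over I(n) fill I(T), a special Birkhoff sum S(0,n) phi with phi of class C^1
   oscillates by a bounded amount on each interval of T(n).  The invariance of the boundary
   operator then places it at bounded distance from a vector psi_n in the image of Omega(n), and
   psi_{n+1} differs from the image of psi_n by a bounded vector.  The stable space is
   Lagrangian (isotropic because the cocycle contracts it, and of dimension g), so the inverse of
   the cocycle on the quotient of the image of Omega by the stable space is bounded by the cocycle
   on the stable space.  That cocycle is small at infinity and subpolynomial for all m <= n;
   interpolating between both bounds makes the pulled back classes of psi_n converge, which
   defines chi, and the remaining stable component is summed step by step.

   Finally an orbit segment of length L splits, at each step, into at most two extremal terms and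
   a segment of the next interval exchange map, and the process stops once the smallest return
   time exceeds L. *)
theory Submission
  imports Defs
begin

section \<open>Letterwise description of an interval exchange map\<close>


text \<open>The obstacle: decay on the stable space is known only from time 0. Vectors of
  \<open>Gamma_s T\<close> shrink like a negative power of N(n), possibly a small one, while between
  times m and n only growth slower than every power is assumed. Pulling a stable vector back from
  time m to time 0 costs a factor N(m), because on the image of \<open>Omega\<close> the inverse of
  the cocycle is conjugate through \<open>Omega\<close> to its transpose. The geometric mean of the
  two bounds, with a small weight \<theta>, keeps some decay in N(n) and loses only the power
  \<theta> of N(m). The decay makes the series converge, since n is below every power of N(n) and
  negative powers of N(n) are therefore summable; the loss is harmless because \<theta> is
  arbitrary. Elementary steps, rather than accelerated times, keep the error made at each stage
  bounded: a letter of the new map passes through at most two letters of the old one. The number of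
  steps costs nothing, being itself below every power of N(n).\<close>

definition letters_bij :: "('a::finite \<Rightarrow> nat) \<Rightarrow> bool" where
  "letters_bij p \<longleftrightarrow> bij_betw p UNIV {1..CARD('a)}"

text \<open>With the lengths as weights this locates the left end of an interval; with an arbitrary
  vector as weights, the difference between the two rows is the matrix \<open>Omega\<close>. One
  computation of its change under a step thus serves the geometry and the symplectic structure
  alike.\<close>

definition psum :: "('a::finite \<Rightarrow> nat) \<Rightarrow> ('a \<Rightarrow> real) \<Rightarrow> 'a \<Rightarrow> real" where
  "psum p w \<alpha> = (\<Sum>\<beta> | p \<beta> < p \<alpha>. w \<beta>)"

definition lt :: "'a::finite iem \<Rightarrow> 'a \<Rightarrow> real" where
  "lt T \<alpha> = origin T + psum (pi_t T) (len T) \<alpha>"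

definition lb :: "'a::finite iem \<Rightarrow> 'a \<Rightarrow> real" where
  "lb T \<alpha> = origin T + psum (pi_b T) (len T) \<alpha>"

definition disp :: "'a::finite iem \<Rightarrow> 'a \<Rightarrow> real" where
  "disp T \<alpha> = lb T \<alpha> - lt T \<alpha>"

definition last_t :: "'a::finite iem \<Rightarrow> 'a" where
  "last_t T = inv (pi_t T) CARD('a)"

definition last_b :: "'a::finite iem \<Rightarrow> 'a" where
  "last_b T = inv (pi_b T) CARD('a)"

lemma letters_bij_inj: "letters_bij p \<Longrightarrow> inj p"
  by (auto simp: letters_bij_def bij_betw_def)

lemma letters_bij_range: "letters_bij (p :: 'a::finite \<Rightarrow> nat) \<Longrightarrow> 1 \<le> p \<alpha> \<and> p \<alpha> \<le> CARD('a)"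
  by (auto simp: letters_bij_def bij_betw_def)

lemma letters_bij_eq: "letters_bij p \<Longrightarrow> p x = p y \<longleftrightarrow> x = y"
  using letters_bij_inj by (metis injD)

lemma letters_bij_inv:
  assumes "letters_bij (p :: 'a::finite \<Rightarrow> nat)" "1 \<le> i" "i \<le> CARD('a)"
  shows "p (inv p i) = i"
proof -
  have "i \<in> range p" using assms by (auto simp: letters_bij_def bij_betw_def)
  then show ?thesis by (rule f_inv_into_f)
qed

lemma letters_bij_inv_app: "letters_bij p \<Longrightarrow> inv p (p \<alpha>) = \<alpha>"
  by (simp add: letters_bij_inj)

lemma letters_bijI:
  assumes "inj p" "\<And>\<alpha>. 1 \<le> p \<alpha> \<and> p \<alpha> \<le> CARD('a)"
  shows "letters_bij (p :: 'a::finite \<Rightarrow> nat)"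
proof -
  have "range p \<subseteq> {1..CARD('a)}" using assms(2) by auto
  moreover have "card (range p) = CARD('a)" using assms(1) by (simp add: card_image)
  ultimately have "range p = {1..CARD('a)}" by (intro card_subset_eq) auto
  then show ?thesis using assms(1) by (simp add: letters_bij_def bij_betw_def)
qed

lemma letters_bij_card:
  assumes "letters_bij (p :: 'a::finite \<Rightarrow> nat)"
  shows "p \<alpha> = Suc (card {\<beta>. p \<beta> < p \<alpha>})"
proof -
  have "p ` {\<beta>. p \<beta> < p \<alpha>} = {1..<p \<alpha>}"
  proof
    show "p ` {\<beta>. p \<beta> < p \<alpha>} \<subseteq> {1..<p \<alpha>}" using letters_bij_range[OF assms] by auto
    show "{1..<p \<alpha>} \<subseteq> p ` {\<beta>. p \<beta> < p \<alpha>}"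
    proof
      fix i assume i: "i \<in> {1..<p \<alpha>}"
      then have "p (inv p i) = i" using letters_bij_inv[OF assms, of i] letters_bij_range[OF assms, of \<alpha>] by auto
      then show "i \<in> p ` {\<beta>. p \<beta> < p \<alpha>}" using i by (intro image_eqI[of _ _ "inv p i"]) auto
    qed
  qed
  moreover have "card (p ` {\<beta>. p \<beta> < p \<alpha>}) = card {\<beta>. p \<beta> < p \<alpha>}"
    by (rule card_image) (use letters_bij_inj[OF assms] in \<open>auto simp: inj_on_def\<close>)
  ultimately have "card {\<beta>. p \<beta> < p \<alpha>} = p \<alpha> - 1" by simp
  then show ?thesis using letters_bij_range[OF assms, of \<alpha>] by simp
qed

text \<open>A position is one more than the number of letters before it, so the order alone
  determines it. The combinatorial data can then be read off from the order of the
  intervals.\<close>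

lemma letters_bij_order_eq:
  assumes "letters_bij (p :: 'a::finite \<Rightarrow> nat)" "letters_bij q" "\<And>x y. p x < p y \<longleftrightarrow> q x < q y"
  shows "p = q"
  using letters_bij_card[OF assms(1)] letters_bij_card[OF assms(2)] assms(3) by (intro ext) simp

lemma psum_last:
  assumes "letters_bij (p :: 'a::finite \<Rightarrow> nat)" "p a = CARD('a)"
  shows "psum p w a + w a = sum w UNIV"
proof -
  have "p x < p a \<longleftrightarrow> x \<noteq> a" for x
    using letters_bij_range[OF assms(1), of x] letters_bij_eq[OF assms(1), of x a] assms(2) by linarith
  then have "{\<beta>. p \<beta> < p a} = UNIV - {a}" by auto
  then show ?thesis by (simp add: psum_def sum_diff1)
qed

lemma psum_less:
  assumes "p \<alpha> < p \<beta>" "\<And>x. 0 \<le> w x"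
  shows "psum p w \<alpha> + w \<alpha> \<le> psum p w \<beta>"
proof -
  have "psum p w \<alpha> + w \<alpha> = sum w (insert \<alpha> {x. p x < p \<alpha>})" by (simp add: psum_def)
  also have "\<dots> \<le> psum p w \<beta>" unfolding psum_def
    by (rule sum_mono2) (use assms in auto)
  finally show ?thesis .
qed

lemma psum_le_total: "(\<And>x. 0 \<le> w x) \<Longrightarrow> psum p w \<alpha> + w \<alpha> \<le> sum w UNIV"
proof -
  assume w: "\<And>x. 0 \<le> w x"
  have "psum p w \<alpha> + w \<alpha> = sum w (insert \<alpha> {x. p x < p \<alpha>})" by (simp add: psum_def)
  also have "\<dots> \<le> sum w UNIV" by (rule sum_mono2) (use w in auto)
  finally show ?thesis .
qed

lemma psum_nonneg: "(\<And>x. 0 \<le> w x) \<Longrightarrow> 0 \<le> psum p w \<alpha>"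
  by (simp add: psum_def sum_nonneg)

lemma iem_bij:
  assumes "iem T" shows "letters_bij (pi_t T)" "letters_bij (pi_b T)"
  using assms by (auto simp: iem_def letters_bij_def)

lemma iem_card: "iem (T :: 'a::finite iem) \<Longrightarrow> 2 \<le> CARD('a)"
  by (simp add: iem_def)

lemma iem_len: "iem T \<Longrightarrow> 0 < len T \<alpha>"
  by (simp add: iem_def)

lemma pi_last_t: "iem (T :: 'a::finite iem) \<Longrightarrow> pi_t T (last_t T) = CARD('a)"
  unfolding last_t_def by (rule letters_bij_inv) (auto simp: iem_bij)

lemma pi_last_b: "iem (T :: 'a::finite iem) \<Longrightarrow> pi_b T (last_b T) = CARD('a)"
  unfolding last_b_def by (rule letters_bij_inv) (auto simp: iem_bij)

lemma u_pred: "iem T \<Longrightarrow> u T (pi_t T \<alpha> - 1) = lt T \<alpha>"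
proof -
  assume T: "iem T"
  have "\<And>\<beta>. pi_t T \<beta> \<le> pi_t T \<alpha> - 1 \<longleftrightarrow> pi_t T \<beta> < pi_t T \<alpha>"
    using letters_bij_range[OF iem_bij(1)[OF T], of \<alpha>] by auto
  then show ?thesis by (simp add: u_def lt_def psum_def)
qed

lemma v_pred: "iem T \<Longrightarrow> v T (pi_b T \<alpha> - 1) = lb T \<alpha>"
proof -
  assume T: "iem T"
  have "\<And>\<beta>. pi_b T \<beta> \<le> pi_b T \<alpha> - 1 \<longleftrightarrow> pi_b T \<beta> < pi_b T \<alpha>"
    using letters_bij_range[OF iem_bij(2)[OF T], of \<alpha>] by auto
  then show ?thesis by (simp add: v_def lb_def psum_def)
qed

lemma sum_le_psum:
  assumes "letters_bij p"
  shows "(\<Sum>\<beta> | p \<beta> \<le> p \<alpha>. w \<beta>) = psum p w \<alpha> + w \<alpha>"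
proof -
  have "{\<beta>. p \<beta> \<le> p \<alpha>} = insert \<alpha> {\<beta>. p \<beta> < p \<alpha>}"
    using letters_bij_eq[OF assms] by (auto simp: le_less)
  then show ?thesis by (simp add: psum_def)
qed

lemma u_pi: "iem T \<Longrightarrow> u T (pi_t T \<alpha>) = lt T \<alpha> + len T \<alpha>"
  by (simp add: u_def lt_def sum_le_psum iem_bij)

lemma It_eq: "iem T \<Longrightarrow> It T \<alpha> = {lt T \<alpha> <..< lt T \<alpha> + len T \<alpha>}"
  by (simp add: It_def u_pi u_pred[unfolded One_nat_def])

lemma It_closed_eq: "iem T \<Longrightarrow> It_closed T \<alpha> = {lt T \<alpha> .. lt T \<alpha> + len T \<alpha>}"
  by (simp add: It_closed_def u_pi u_pred[unfolded One_nat_def])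

lemma u_0: "iem T \<Longrightarrow> u T 0 = origin T"
proof -
  assume T: "iem T"
  have "pi_t T \<alpha> \<noteq> 0" for \<alpha>
    using letters_bij_range[OF iem_bij(1)[OF T], of \<alpha>] by linarith
  then have *: "{\<alpha>. pi_t T \<alpha> \<le> 0} = {}" by blast
  show ?thesis unfolding u_def * by simp
qed

lemma u_card: "iem (T :: 'a::finite iem) \<Longrightarrow> u T CARD('a) = origin T + sum (len T) UNIV"
  using letters_bij_range[OF iem_bij(1), of T] by (simp add: u_def)

lemma I_full_eq: "iem T \<Longrightarrow> I_full T = {origin T <..< origin T + sum (len T) UNIV}"
  by (simp add: I_full_def u_0 u_card)

lemma u_card_pred: "iem (T :: 'a::finite iem) \<Longrightarrow> u T (CARD('a) - 1) = lt T (last_t T)"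
  by (metis pi_last_t u_pred)

lemma v_card_pred: "iem (T :: 'a::finite iem) \<Longrightarrow> v T (CARD('a) - 1) = lb T (last_b T)"
  by (metis pi_last_b v_pred)

lemma lt_last: "iem T \<Longrightarrow> lt T (last_t T) + len T (last_t T) = origin T + sum (len T) UNIV"
  using psum_last[OF iem_bij(1) pi_last_t, of T "len T"] by (simp add: lt_def)

lemma lb_last: "iem T \<Longrightarrow> lb T (last_b T) + len T (last_b T) = origin T + sum (len T) UNIV"
  using psum_last[OF iem_bij(2) pi_last_b, of T "len T"] by (simp add: lb_def)

lemma lt_less: "iem T \<Longrightarrow> pi_t T \<alpha> < pi_t T \<beta> \<Longrightarrow> lt T \<alpha> + len T \<alpha> \<le> lt T \<beta>"
  using psum_less[of "pi_t T" \<alpha> \<beta> "len T"] iem_len[of T] by (auto simp: lt_def intro: less_imp_le)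

lemma lb_less: "iem T \<Longrightarrow> pi_b T \<alpha> < pi_b T \<beta> \<Longrightarrow> lb T \<alpha> + len T \<alpha> \<le> lb T \<beta>"
  using psum_less[of "pi_b T" \<alpha> \<beta> "len T"] iem_len[of T] by (auto simp: lb_def intro: less_imp_le)

lemma lt_bounds:
  assumes "iem T"
  shows "origin T \<le> lt T \<alpha>" "lt T \<alpha> + len T \<alpha> \<le> origin T + sum (len T) UNIV"
  using psum_nonneg[of "len T" "pi_t T" \<alpha>] psum_le_total[of "len T" "pi_t T" \<alpha>] iem_len[OF assms]
  by (auto simp: lt_def less_imp_le)

lemma lb_bounds:
  assumes "iem T"
  shows "origin T \<le> lb T \<alpha>" "lb T \<alpha> + len T \<alpha> \<le> origin T + sum (len T) UNIV"
  using psum_nonneg[of "len T" "pi_b T" \<alpha>] psum_le_total[of "len T" "pi_b T" \<alpha>] iem_len[OF assms]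
  by (auto simp: lb_def less_imp_le)

lemma pi_t_less_iff: "iem T \<Longrightarrow> pi_t T \<alpha> < pi_t T \<beta> \<longleftrightarrow> lt T \<alpha> < lt T \<beta>"
  using lt_less[of T \<alpha> \<beta>] lt_less[of T \<beta> \<alpha>] letters_bij_eq[OF iem_bij(1), of T \<alpha> \<beta>] iem_len[of T \<alpha>] iem_len[of T \<beta>]
  by (cases "pi_t T \<alpha>" "pi_t T \<beta>" rule: linorder_cases) auto

lemma pi_b_less_iff: "iem T \<Longrightarrow> pi_b T \<alpha> < pi_b T \<beta> \<longleftrightarrow> lb T \<alpha> < lb T \<beta>"
  using lb_less[of T \<alpha> \<beta>] lb_less[of T \<beta> \<alpha>] letters_bij_eq[OF iem_bij(2), of T \<alpha> \<beta>] iem_len[of T \<alpha>] iem_len[of T \<beta>]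
  by (cases "pi_b T \<alpha>" "pi_b T \<beta>" rule: linorder_cases) auto

lemma It_disjoint:
  assumes "iem T" "x \<in> It T \<alpha>" "x \<in> It T \<beta>" shows "\<alpha> = \<beta>"
  using lt_less[of T \<alpha> \<beta>] lt_less[of T \<beta> \<alpha>] letters_bij_eq[OF iem_bij(1), of T \<alpha> \<beta>] assms
  by (cases "pi_t T \<alpha>" "pi_t T \<beta>" rule: linorder_cases) (auto simp: It_eq)

lemma Ib_disjoint:
  assumes "iem T" "x \<in> {lb T \<alpha> <..< lb T \<alpha> + len T \<alpha>}" "x \<in> {lb T \<beta> <..< lb T \<beta> + len T \<beta>}"
  shows "\<alpha> = \<beta>"
  using lb_less[of T \<alpha> \<beta>] lb_less[of T \<beta> \<alpha>] letters_bij_eq[OF iem_bij(2), of T \<alpha> \<beta>] assms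
  by (cases "pi_b T \<alpha>" "pi_b T \<beta>" rule: linorder_cases) auto

lemma letter_It: "iem T \<Longrightarrow> x \<in> It T \<alpha> \<Longrightarrow> letter T x = \<alpha>"
  unfolding letter_def using It_disjoint by (intro the_equality) auto

lemma iem_map_It: "iem T \<Longrightarrow> x \<in> It T \<alpha> \<Longrightarrow> iem_map T x = x + disp T \<alpha>"
  by (simp add: iem_map_def letter_It u_pred[unfolded One_nat_def] v_pred[unfolded One_nat_def] disp_def)

lemma iem_map_Ib: "iem T \<Longrightarrow> x \<in> It T \<alpha> \<Longrightarrow> iem_map T x \<in> {lb T \<alpha> <..< lb T \<alpha> + len T \<alpha>}"
  by (simp add: iem_map_It) (simp add: It_eq disp_def)

lemma Ib_subset: "iem T \<Longrightarrow> {lb T \<alpha> <..< lb T \<alpha> + len T \<alpha>} \<subseteq> I_full T"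
  using lb_bounds[of T \<alpha>] by (auto simp: I_full_eq)

lemma iem_map_in_I: "iem T \<Longrightarrow> x \<in> It T \<alpha> \<Longrightarrow> iem_map T x \<in> I_full T"
  using iem_map_Ib Ib_subset by blast

lemma It_nonempty: "iem T \<Longrightarrow> lt T \<alpha> + len T \<alpha> / 2 \<in> It T \<alpha>"
  using iem_len[of T \<alpha>] by (simp add: It_eq)

text \<open>Serves the uniqueness half of the definite description in \<open>rauzy_step\<close>: the
  top intervals give the lengths and the top order, and one point of each gives its displacement,
  hence the bottom order.\<close>

lemma iem_eqI:
  assumes "iem T" "iem T'" "I_full T = I_full T'" "\<And>\<alpha>. It T \<alpha> = It T' \<alpha>"
    and "\<And>x. x \<in> iem_dom T \<Longrightarrow> iem_map T x = iem_map T' x"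
  shows "T = (T' :: 'a::finite iem)"
proof -
  have lt: "lt T \<alpha> = lt T' \<alpha> \<and> len T \<alpha> = len T' \<alpha>" for \<alpha>
    using assms(4)[of \<alpha>] iem_len[OF assms(1), of \<alpha>] iem_len[OF assms(2), of \<alpha>]
    by (auto simp: It_eq assms(1,2) greaterThanLessThan_eq_iff)
  have pos: "0 < sum (len T) UNIV" "0 < sum (len T') UNIV"
    using iem_len[OF assms(1)] iem_len[OF assms(2)] by (auto intro!: sum_pos)
  have "origin T = origin T'"
    using assms(3) pos by (simp add: I_full_eq assms(1,2) greaterThanLessThan_eq_iff)
  moreover have "pi_t T = pi_t T'"
    by (rule letters_bij_order_eq) (use assms lt in \<open>auto simp: iem_bij pi_t_less_iff\<close>)
  moreover have "lb T \<alpha> = lb T' \<alpha>" for \<alpha>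
  proof -
    let ?x = "lt T \<alpha> + len T \<alpha> / 2"
    have x: "?x \<in> It T \<alpha>" using It_nonempty assms(1) by blast
    then have "iem_map T ?x = iem_map T' ?x" using assms(5) by (auto simp: iem_dom_def)
    then have "disp T \<alpha> = disp T' \<alpha>" using x assms(4)
      by (simp add: iem_map_It[OF assms(1) x] iem_map_It[OF assms(2), of ?x \<alpha>])
    then show ?thesis using lt by (simp add: disp_def)
  qed
  then have "pi_b T = pi_b T'"
    by (intro letters_bij_order_eq) (use assms in \<open>auto simp: iem_bij pi_b_less_iff\<close>)
  moreover have "len T = len T'" using lt by auto
  ultimately show ?thesis by (intro iem.equality) auto
qed

lemma letters_bij_vimage_last:
  assumes "letters_bij (p :: 'a::finite \<Rightarrow> nat)" "p a = CARD('a)"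
  shows "p -` {1..CARD('a) - 1} = UNIV - {a}"
proof -
  have c: "\<not> CARD('a) \<le> CARD('a) - 1" using zero_less_card_finite[where 'a='a] by linarith
  have *: "1 \<le> p x \<and> p x \<le> CARD('a) - 1 \<longleftrightarrow> x \<noteq> a" for x
  proof (cases "x = a")
    case True
    then show ?thesis using c assms(2) by metis
  next
    case False
    then have "p x \<noteq> CARD('a)" using letters_bij_eq[OF assms(1), of x a] assms(2) by simp
    then show ?thesis using False letters_bij_range[OF assms(1), of x] by auto
  qed
  show ?thesis
    by (simp only: set_eq_iff vimage_eq atLeastAtMost_iff * Diff_iff UNIV_I singleton_iff simp_thms)
qed

text \<open>Irreducibility at k = d - 1: with a common last letter, the first d - 1 letters of both
  rows would form the same set.\<close>

lemma last_neq:
  assumes T: "iem (T :: 'a::finite iem)" shows "last_t T \<noteq> last_b T"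
proof
  assume eq: "last_t T = last_b T"
  have "pi_t T -` {1..CARD('a) - 1} = pi_b T -` {1..CARD('a) - 1}"
    using letters_bij_vimage_last[OF iem_bij(1)[OF T] pi_last_t[OF T]]
      letters_bij_vimage_last[OF iem_bij(2)[OF T] pi_last_b[OF T]] eq by simp
  moreover have "1 \<le> CARD('a) - 1" "CARD('a) - 1 < CARD('a)" using iem_card[OF T] by auto
  ultimately show False using T unfolding iem_def by blast
qed

section \<open>The elementary step in explicit form\<close>


text \<open>The change of one row in an elementary step. It permutes the positions only when
  \<open>l\<close> stands last: the letters beyond \<open>w\<close> then shift by one into the place
  that \<open>l\<close> leaves.\<close>

definition move_after :: "('a \<Rightarrow> nat) \<Rightarrow> 'a \<Rightarrow> 'a \<Rightarrow> 'a \<Rightarrow> nat" where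
  "move_after p l w = (\<lambda>\<alpha>. if \<alpha> = l then Suc (p w) else if p \<alpha> \<le> p w then p \<alpha> else Suc (p \<alpha>))"

definition top_wins :: "'a::finite iem \<Rightarrow> bool" where
  "top_wins T \<longleftrightarrow> lt T (last_t T) < lb T (last_b T)"

definition winner :: "'a::finite iem \<Rightarrow> 'a" where
  "winner T = (if top_wins T then last_t T else last_b T)"

definition loser :: "'a::finite iem \<Rightarrow> 'a" where
  "loser T = (if top_wins T then last_b T else last_t T)"

text \<open>An explicit candidate for \<open>rauzy_step\<close>. Only the row in which the loser
  stands last changes, and only the winner changes its length; when the two last lengths agree the
  result is degenerate, which \<open>generic_ends\<close> excludes.\<close>

definition step :: "'a::finite iem \<Rightarrow> 'a iem" where
  "step T = \<lparr>origin = origin T,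
     pi_t = (if top_wins T then pi_t T else move_after (pi_t T) (loser T) (winner T)),
     pi_b = (if top_wins T then move_after (pi_b T) (loser T) (winner T) else pi_b T),
     len = (len T)(winner T := len T (winner T) - len T (loser T))\<rparr>"

section \<open>Partial sums of weights under a step\<close>

lemma move_after_less_iff:
  assumes "\<alpha> \<noteq> l" "\<beta> \<noteq> l"
  shows "move_after p l w \<beta> < move_after p l w \<alpha> \<longleftrightarrow> p \<beta> < p \<alpha>"
  using assms by (auto simp: move_after_def)

lemma move_after_less_self_iff:
  assumes "\<alpha> \<noteq> l"
  shows "move_after p l w \<alpha> < move_after p l w l \<longleftrightarrow> p \<alpha> \<le> p w"
    "move_after p l w l < move_after p l w \<alpha> \<longleftrightarrow> p w < p \<alpha>"
  using assms by (auto simp: move_after_def)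

lemma letters_bij_last_less:
  assumes "letters_bij (p :: 'a::finite \<Rightarrow> nat)" "p l = CARD('a)" "\<alpha> \<noteq> l"
  shows "p \<alpha> < p l"
  using letters_bij_range[OF assms(1), of \<alpha>] letters_bij_eq[OF assms(1), of \<alpha> l] assms by linarith

lemma move_after_bij:
  assumes p: "letters_bij (p :: 'a::finite \<Rightarrow> nat)" "p l = CARD('a)" "w \<noteq> l"
  shows "letters_bij (move_after p l w)"
proof (rule letters_bijI)
  show "inj (move_after p l w)"
  proof (rule injI)
    fix x y assume eq: "move_after p l w x = move_after p l w y"
    have "x \<noteq> l \<Longrightarrow> y \<noteq> l \<Longrightarrow> p x = p y"
      using eq by (auto simp: move_after_def split: if_splits)
    moreover have "x = l \<Longrightarrow> y = l" "y = l \<Longrightarrow> x = l"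
      using eq by (auto simp: move_after_def split: if_splits)
    ultimately show "x = y" using letters_bij_eq[OF p(1)] by blast
  qed
  fix \<alpha>
  show "1 \<le> move_after p l w \<alpha> \<and> move_after p l w \<alpha> \<le> CARD('a)"
    using letters_bij_range[OF p(1), of \<alpha>] letters_bij_last_less[OF p(1,2), of \<alpha>]
      letters_bij_last_less[OF p] p(2)
    by (auto simp: move_after_def)
qed

text \<open>After the move \<open>l\<close> stands immediately behind \<open>w\<close>, so for any
  other letter the two are on the same side; the weight of \<open>l\<close> can be credited to
  \<open>w\<close>.\<close>

lemma psum_move_after:
  assumes p: "letters_bij (p :: 'a::finite \<Rightarrow> nat)" "p l = CARD('a)" "w \<noteq> l" "\<alpha> \<noteq> l"
  shows "psum (move_after p l w) (x :: 'a \<Rightarrow> real) \<alpha> = psum p (x(w := x w + x l)) \<alpha>"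
proof -
  let ?m = "move_after p l w" and ?y = "x(w := x w + x l)"
  let ?A = "{\<beta>. p \<beta> < p \<alpha>}"
  have l: "l \<notin> ?A" using letters_bij_last_less[OF p(1,2,4)] by simp
  have set: "{\<beta>. ?m \<beta> < ?m \<alpha>} = ?A \<union> (if w \<in> ?A then {l} else {})"
    using move_after_less_iff[OF p(4), of _ p w] move_after_less_self_iff[OF p(4), of p w] l
    by (intro set_eqI, rename_tac \<beta>, case_tac "\<beta> = l") auto
  have "psum ?m x \<alpha> = sum x ?A + (if w \<in> ?A then x l else 0)"
    unfolding psum_def set using l by auto
  also have "\<dots> = sum ?y ?A"
  proof (cases "w \<in> ?A")
    case True
    then have "?A = insert w (?A - {w})" by auto
    then have "sum ?y ?A = ?y w + sum ?y (?A - {w})" "sum x ?A = x w + sum x (?A - {w})"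
      by (metis finite_code sum.insert_remove insert_Diff_single finite)+
    moreover have "sum ?y (?A - {w}) = sum x (?A - {w})" by (rule sum.cong) auto
    ultimately show ?thesis using True by simp
  next
    case False
    then show ?thesis by (auto intro!: sum.cong)
  qed
  finally show ?thesis by (simp add: psum_def)
qed

lemma psum_move_after_self:
  assumes p: "letters_bij (p :: 'a::finite \<Rightarrow> nat)" "p l = CARD('a)" "w \<noteq> l"
  shows "psum (move_after p l w) (x :: 'a \<Rightarrow> real) l = psum p x w + x w"
proof -
  have "{\<beta>. move_after p l w \<beta> < move_after p l w l} = {\<beta>. p \<beta> \<le> p w}"
    using move_after_less_self_iff[of _ l p w] letters_bij_last_less[OF p]
    by (intro set_eqI, rename_tac \<beta>, case_tac "\<beta> = l") auto
  then show ?thesis using sum_le_psum[OF p(1), of x w] by (simp add: psum_def)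
qed

lemma psum_upd_last:
  assumes p: "letters_bij (p :: 'a::finite \<Rightarrow> nat)" "p w = CARD('a)"
  shows "psum p (x(w := c)) \<alpha> = psum p (x :: 'a \<Rightarrow> real) \<alpha>"
proof -
  have "\<not> p w < p \<alpha>" using letters_bij_range[OF p(1), of \<alpha>] p(2) by auto
  then show ?thesis unfolding psum_def by (intro sum.cong) auto
qed

lemma psum_upd_self: "psum p (x(w := c)) w = psum p (x :: 'a::finite \<Rightarrow> real) w"
  unfolding psum_def by (intro sum.cong) auto

lemma winner_loser: "{winner T, loser T} = {last_t T, last_b T}"
  by (auto simp: winner_def loser_def)

lemma winner_neq_loser: "iem T \<Longrightarrow> winner T \<noteq> loser T"
  using last_neq[of T] by (auto simp: winner_def loser_def)

lemma last_ends: "iem T \<Longrightarrow> lt T (last_t T) + len T (last_t T) = lb T (last_b T) + len T (last_b T)"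
  using lt_last lb_last by metis

text \<open>The single instance of the absence of connections that one step needs: m = 0, at the
  last singularities of the map and of its inverse.\<close>

definition generic_ends :: "'a::finite iem \<Rightarrow> bool" where
  "generic_ends T \<longleftrightarrow> lt T (last_t T) \<noteq> lb T (last_b T)"

lemma no_connection_generic: "iem (T :: 'a::finite iem) \<Longrightarrow> no_connection T \<Longrightarrow> generic_ends T"
proof -
  assume T: "iem T" "no_connection T"
  have "\<not> connection T (CARD('a) - 1) (CARD('a) - 1) 0" using T(2) by (auto simp: no_connection_def)
  then have "v T (CARD('a) - 1) \<noteq> u T (CARD('a) - 1)"
    using iem_card[OF T(1)] by (auto simp: connection_def orbit_defined_def)
  then show "generic_ends T" unfolding generic_ends_def
    using u_card_pred[OF T(1)] v_card_pred[OF T(1)] by metis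
qed

lemma len_loser_less: "iem T \<Longrightarrow> generic_ends T \<Longrightarrow> len T (loser T) < len T (winner T)"
  using last_ends[of T] by (auto simp: generic_ends_def loser_def winner_def top_wins_def)

lemma step_len: "len (step T) = (len T)(winner T := len T (winner T) - len T (loser T))"
  by (simp add: step_def)

lemma step_len_inv: "iem T \<Longrightarrow> len T = (len (step T))(winner T := len (step T) (winner T) + len (step T) (loser T))"
  using winner_neq_loser[of T] by (auto simp: step_len)

lemma step_origin: "origin (step T) = origin T"
  by (simp add: step_def)

lemma psum_step_t:
  assumes "iem T"
  shows "psum (pi_t (step T)) x \<alpha> =
    (if \<alpha> = last_t T \<and> \<not> top_wins T then psum (pi_t T) x (last_b T) + x (last_b T)
     else psum (pi_t T) (x(winner T := x (winner T) + x (loser T))) \<alpha>)"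
proof (cases "top_wins T")
  case True
  then show ?thesis using psum_upd_last[OF iem_bij(1) pi_last_t, OF assms assms]
    by (simp add: step_def winner_def)
next
  case False
  have neq: "last_b T \<noteq> last_t T" using last_neq[OF assms] by simp
  show ?thesis
    using False psum_move_after[OF iem_bij(1) pi_last_t neq, OF assms assms]
      psum_move_after_self[OF iem_bij(1) pi_last_t neq, OF assms assms]
    by (simp add: step_def winner_def loser_def)
qed

lemma psum_step_b:
  assumes "iem T"
  shows "psum (pi_b (step T)) x \<alpha> =
    (if \<alpha> = last_b T \<and> top_wins T then psum (pi_b T) x (last_t T) + x (last_t T)
     else psum (pi_b T) (x(winner T := x (winner T) + x (loser T))) \<alpha>)"
proof (cases "top_wins T")
  case False
  then show ?thesis using psum_upd_last[OF iem_bij(2) pi_last_b, OF assms assms]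
    by (simp add: step_def winner_def)
next
  case True
  have neq: "last_t T \<noteq> last_b T" using last_neq[OF assms] by simp
  show ?thesis
    using True psum_move_after[OF iem_bij(2) pi_last_b neq, OF assms assms]
      psum_move_after_self[OF iem_bij(2) pi_last_b neq, OF assms assms]
    by (simp add: step_def winner_def loser_def)
qed

text \<open>Arbitrary weights are allowed because three uses follow: the displacements of the step,
  the conjugation of \<open>Omega\<close>, and the transport of its kernel. The two differences add
  up at the loser because its new interval travels through that of \<open>last_b\<close> and then
  through that of \<open>last_t\<close>.\<close>

lemma psum_step_disp:
  fixes x :: "'a::finite \<Rightarrow> real"
  assumes T: "iem T"
  defines "y \<equiv> x(winner T := x (winner T) + x (loser T))"
  shows "psum (pi_b (step T)) x \<alpha> - psum (pi_t (step T)) x \<alpha> =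
    (if \<alpha> = loser T then psum (pi_b T) y (last_b T) - psum (pi_t T) y (last_b T)
        + (psum (pi_b T) y (last_t T) - psum (pi_t T) y (last_t T))
     else psum (pi_b T) y \<alpha> - psum (pi_t T) y \<alpha>)"
proof -
  note last = psum_last[OF iem_bij(1)[OF T] pi_last_t[OF T], of y]
    psum_last[OF iem_bij(2)[OF T] pi_last_b[OF T], of y]
  have neq: "last_t T \<noteq> last_b T" using last_neq[OF T] .
  show ?thesis
  proof (cases "top_wins T")
    case True
    then have wl: "winner T = last_t T" "loser T = last_b T" by (auto simp: winner_def loser_def)
    have "psum (pi_b T) y (last_t T) = psum (pi_b T) x (last_t T)"
      unfolding y_def wl by (rule psum_upd_self)
    moreover have "y (last_t T) = x (last_t T) + x (last_b T)" "y (last_b T) = x (last_b T)"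
      using neq by (auto simp: y_def wl)
    ultimately show ?thesis using last
      by (simp add: psum_step_t[OF T] psum_step_b[OF T] True wl flip: y_def)
        (simp add: y_def wl)
  next
    case False
    then have wl: "winner T = last_b T" "loser T = last_t T" by (auto simp: winner_def loser_def)
    have "psum (pi_t T) y (last_b T) = psum (pi_t T) x (last_b T)"
      unfolding y_def wl by (rule psum_upd_self)
    moreover have "y (last_b T) = x (last_t T) + x (last_b T)" "y (last_t T) = x (last_t T)"
      using neq by (auto simp: y_def wl)
    ultimately show ?thesis using last
      by (simp add: psum_step_t[OF T] psum_step_b[OF T] False wl flip: y_def)
        (simp add: y_def wl)
  qed
qed

lemma disp_step:
  assumes T: "iem T"
  shows "disp (step T) \<alpha> = (if \<alpha> = loser T then disp T (last_b T) + disp T (last_t T) else disp T \<alpha>)"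
  using psum_step_disp[OF T, of "len (step T)" \<alpha>] step_len_inv[OF T]
  by (simp add: disp_def lt_def lb_def step_origin)

lemma lt_step:
  assumes T: "iem T"
  shows "lt (step T) \<alpha> =
    (if \<alpha> = last_t T \<and> \<not> top_wins T then lt T (last_b T) + len T (last_b T) - len T (last_t T)
     else lt T \<alpha>)"
proof -
  have "\<not> top_wins T \<Longrightarrow> psum (pi_t T) (len (step T)) (last_b T) = psum (pi_t T) (len T) (last_b T)"
    unfolding step_len by (simp add: winner_def psum_upd_self)
  moreover have "\<not> top_wins T \<Longrightarrow> len (step T) (last_b T) = len T (last_b T) - len T (last_t T)"
    by (simp add: step_len winner_def loser_def)
  ultimately show ?thesis
    using psum_step_t[OF T, of "len (step T)" \<alpha>] step_len_inv[OF T]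
    by (simp add: lt_def step_origin)
qed

lemma iem_step:
  assumes T: "iem (T :: 'a::finite iem)" and g: "generic_ends T"
  shows "iem (step T)"
proof -
  have neq: "last_t T \<noteq> last_b T" "last_b T \<noteq> last_t T" using last_neq[OF T] by auto
  have bt: "letters_bij (pi_t (step T))"
    using move_after_bij[OF iem_bij(1)[OF T] pi_last_t[OF T] neq(2)] iem_bij(1)[OF T]
    by (simp add: step_def winner_def loser_def)
  have bb: "letters_bij (pi_b (step T))"
    using move_after_bij[OF iem_bij(2)[OF T] pi_last_b[OF T] neq(1)] iem_bij(2)[OF T]
    by (simp add: step_def winner_def loser_def)
  have pos: "0 < len (step T) \<alpha>" for \<alpha>
    using len_loser_less[OF T g] iem_len[OF T] by (simp add: step_len)
  \<comment> \<open>The winner is still last in its own row, so it lies beyond place k in both rows.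
    The insertion in the other row then happens beyond k and leaves its first k letters as they
    were, which contradicts irreducibility before the step.\<close>
  have "pi_t (step T) -` {1..k} \<noteq> pi_b (step T) -` {1..k}" if k: "1 \<le> k" "k < CARD('a)" for k
  proof
    assume eq: "pi_t (step T) -` {1..k} = pi_b (step T) -` {1..k}"
    have irr: "pi_t T -` {1..k} \<noteq> pi_b T -` {1..k}" using T k by (simp add: iem_def)
    show False
    proof (cases "top_wins T")
      case True
      have "last_t T \<notin> pi_t T -` {1..k}" using pi_last_t[OF T] k by simp
      then have "last_t T \<notin> pi_b (step T) -` {1..k}"
        using True unfolding eq[symmetric] by (simp add: step_def)
      then have "k < pi_b T (last_t T)"
        using True neq letters_bij_range[OF iem_bij(2)[OF T], of "last_t T"]
        by (simp add: step_def move_after_def winner_def loser_def)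
      then have "pi_b (step T) -` {1..k} = pi_b T -` {1..k}"
        using True pi_last_b[OF T] k letters_bij_range[OF iem_bij(2)[OF T], of "last_t T"]
        by (intro set_eqI) (auto simp: step_def move_after_def winner_def loser_def)
      then show False using eq irr True by (simp add: step_def)
    next
      case False
      have "last_b T \<notin> pi_b T -` {1..k}" using pi_last_b[OF T] k by simp
      then have "last_b T \<notin> pi_t (step T) -` {1..k}"
        using False unfolding eq by (simp add: step_def)
      then have "k < pi_t T (last_b T)"
        using False neq letters_bij_range[OF iem_bij(1)[OF T], of "last_b T"]
        by (simp add: step_def move_after_def winner_def loser_def)
      then have "pi_t (step T) -` {1..k} = pi_t T -` {1..k}"
        using False pi_last_t[OF T] k letters_bij_range[OF iem_bij(1)[OF T], of "last_b T"]
        by (intro set_eqI) (auto simp: step_def move_after_def winner_def loser_def)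
      then show False using eq irr False by (simp add: step_def)
    qed
  qed
  then show ?thesis using bt bb pos iem_card[OF T] by (auto simp: iem_def letters_bij_def)
qed

lemma I_full_step:
  assumes T: "iem T" and g: "generic_ends T"
  shows "I_full (step T) = {origin T <..< max (lt T (last_t T)) (lb T (last_b T))}"
proof -
  have len: "sum (len (step T)) UNIV = sum (len T) UNIV - len T (loser T)"
  proof -
    have "sum (len (step T)) UNIV = sum (\<lambda>\<alpha>. len T \<alpha> - (if \<alpha> = winner T then len T (loser T) else 0)) UNIV"
      by (intro sum.cong) (auto simp: step_len)
    then show ?thesis by (simp add: sum_subtractf)
  qed
  have "origin T + sum (len T) UNIV - len T (loser T) = max (lt T (last_t T)) (lb T (last_b T))"
    using lt_last[OF T] lb_last[OF T] by (auto simp: loser_def top_wins_def)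
  then show ?thesis using I_full_eq[OF iem_step[OF T g]] by (simp add: step_origin len algebra_simps)
qed

lemma It_step_subset:
  assumes T: "iem T" and g: "generic_ends T" and "\<alpha> \<noteq> loser T"
  shows "It (step T) \<alpha> \<subseteq> It T \<alpha>" "It_closed (step T) \<alpha> \<subseteq> It_closed T \<alpha>"
proof -
  have "lt (step T) \<alpha> = lt T \<alpha>" using assms lt_step[OF T, of \<alpha>] by (auto simp: loser_def)
  moreover have "len (step T) \<alpha> \<le> len T \<alpha>" using iem_len[OF T, of "loser T"] by (simp add: step_len less_imp_le)
  ultimately show "It (step T) \<alpha> \<subseteq> It T \<alpha>" "It_closed (step T) \<alpha> \<subseteq> It_closed T \<alpha>"
    by (auto simp: It_eq It_closed_eq T iem_step[OF T g])
qed

lemma It_step_loser: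
  assumes T: "iem T" and g: "generic_ends T"
  shows "x \<in> It (step T) (loser T) \<longleftrightarrow> x \<in> It T (last_b T) \<and> x + disp T (last_b T) \<in> It T (last_t T)"
    and "x \<in> It_closed (step T) (loser T) \<Longrightarrow>
      x \<in> It_closed T (last_b T) \<and> x + disp T (last_b T) \<in> It_closed T (last_t T)"
  using lt_step[OF T, of "loser T"] last_ends[OF T] len_loser_less[OF T g]
    winner_neq_loser[OF T] last_neq[OF T]
  by (auto simp: It_eq It_closed_eq T iem_step[OF T g] step_len loser_def winner_def disp_def
        top_wins_def split: if_splits)

section \<open>Identification of the elementary step; connections\<close>


lemma lb_step:
  assumes T: "iem T"
  shows "lb (step T) \<alpha> =
    (if \<alpha> = last_b T \<and> top_wins T then lb T (last_t T) + len T (last_t T) - len T (last_b T)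
     else lb T \<alpha>)"
proof -
  have "top_wins T \<Longrightarrow> psum (pi_b T) (len (step T)) (last_t T) = psum (pi_b T) (len T) (last_t T)"
    unfolding step_len by (simp add: winner_def psum_upd_self)
  moreover have "top_wins T \<Longrightarrow> len (step T) (last_t T) = len T (last_t T) - len T (last_b T)"
    by (simp add: step_len winner_def loser_def)
  ultimately show ?thesis
    using psum_step_b[OF T, of "len (step T)" \<alpha>] step_len_inv[OF T]
    by (simp add: lb_def step_origin)
qed

lemma step_map_other:
  assumes T: "iem T" and g: "generic_ends T" and "x \<in> It (step T) \<alpha>" "\<alpha> \<noteq> loser T"
  shows "x \<in> It T \<alpha>" "iem_map (step T) x = iem_map T x"
proof -
  show x: "x \<in> It T \<alpha>" using It_step_subset[OF T g assms(4)] assms(3) by auto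
  show "iem_map (step T) x = iem_map T x"
    using iem_map_It[OF T x] iem_map_It[OF iem_step[OF T g] assms(3)] disp_step[OF T, of \<alpha>] assms(4)
    by simp
qed

lemma step_map_loser:
  assumes T: "iem T" and g: "generic_ends T" and "x \<in> It (step T) (loser T)"
  shows "x \<in> It T (last_b T)" "iem_map T x = x + disp T (last_b T)" "iem_map T x \<in> It T (last_t T)"
    "iem_map T x \<notin> I_full (step T)" "iem_map (step T) x = iem_map T (iem_map T x)"
proof -
  show x: "x \<in> It T (last_b T)" using It_step_loser(1)[OF T g, of x] assms(3) by simp
  show Tx: "iem_map T x = x + disp T (last_b T)" by (rule iem_map_It[OF T x])
  show Tx': "iem_map T x \<in> It T (last_t T)" using It_step_loser(1)[OF T g, of x] assms(3) Tx by simp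
  show "iem_map T x \<notin> I_full (step T)"
    using Tx' iem_map_Ib[OF T x] by (auto simp: I_full_step[OF T g] It_eq[OF T])
  show "iem_map (step T) x = iem_map T (iem_map T x)"
    using iem_map_It[OF T Tx'] iem_map_It[OF iem_step[OF T g] assms(3)] disp_step[OF T, of "loser T"] Tx
    by simp
qed

text \<open>The return time is 1 except on the interval of the loser. There the first image falls
  into the removed right end, and the second one comes back.\<close>

lemma first_return_step:
  assumes T: "iem T" and g: "generic_ends T" and x: "x \<in> iem_dom (step T)"
  shows "first_return (iem_map T) (I_full (step T)) x = iem_map (step T) x"
proof -
  obtain \<alpha> where \<alpha>: "x \<in> It (step T) \<alpha>" using x by (auto simp: iem_dom_def)
  have ret: "iem_map (step T) x \<in> I_full (step T)" by (rule iem_map_in_I[OF iem_step[OF T g] \<alpha>])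
  show ?thesis
  proof (cases "\<alpha> = loser T")
    case False
    have "return_time (iem_map T) (I_full (step T)) x = 1" unfolding return_time_def
      by (rule Least_equality) (use step_map_other(2)[OF T g \<alpha> False] ret in auto)
    then show ?thesis using step_map_other(2)[OF T g \<alpha> False] by (simp add: first_return_def)
  next
    case True
    note l = step_map_loser[OF T g \<alpha>[unfolded True]]
    have "return_time (iem_map T) (I_full (step T)) x = 2" unfolding return_time_def
    proof (rule Least_equality)
      show "0 < (2::nat) \<and> (iem_map T ^^ 2) x \<in> I_full (step T)"
        using l(5) ret by (simp add: numeral_2_eq_2)
      fix r assume r: "0 < r \<and> (iem_map T ^^ r) x \<in> I_full (step T)"
      then have "r \<noteq> 1" using l(4) by auto
      then show "2 \<le> r" using r by linarith
    qed
    then show ?thesis using l(5) by (simp add: first_return_def numeral_2_eq_2)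
  qed
qed

lemma rauzy_labels_step:
  fixes T :: "'a::finite iem"
  assumes T: "iem T" and g: "generic_ends T"
  shows "rauzy_labels T (step T)"
proof (cases "top_wins T")
  case True
  have "It (step T) \<alpha> = It T \<alpha>" if "\<alpha> \<noteq> last_t T" for \<alpha>
    using that True by (simp add: It_eq T iem_step[OF T g] lt_step[OF T] step_len winner_def)
  moreover have "It (step T) (last_t T) = It T (last_t T) \<inter> {origin T <..< lb T (last_b T)}"
    using True last_ends[OF T] lt_bounds(1)[OF T, of "last_t T"]  len_loser_less[OF T g] iem_len[OF T, of "last_b T"]
    by (auto simp: It_eq T iem_step[OF T g] lt_step[OF T] step_len winner_def loser_def)
  ultimately show ?thesis using True
    by (simp add: rauzy_labels_def Let_def u_card_pred[OF T, unfolded One_nat_def]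
        v_card_pred[OF T, unfolded One_nat_def] u_0[OF T] flip: last_t_def last_b_def top_wins_def)
next
  case False
  have wl: "winner T = last_b T" "loser T = last_t T" using False by (auto simp: winner_def loser_def)
  have 1: "It (step T) \<alpha> = It T \<alpha>" if "\<alpha> \<noteq> last_t T" "\<alpha> \<noteq> last_b T" for \<alpha>
    using that wl by (simp add: It_eq T iem_step[OF T g] lt_step[OF T] step_len)
  have 2: "It (step T) (last_t T) = {x \<in> iem_dom T. iem_map T x \<in> It T (last_t T)}"
  proof (intro set_eqI iffI)
    fix x assume "x \<in> It (step T) (last_t T)"
    then show "x \<in> {x \<in> iem_dom T. iem_map T x \<in> It T (last_t T)}"
      using step_map_loser[OF T g] wl by (auto simp: iem_dom_def)
  next
    fix x assume "x \<in> {x \<in> iem_dom T. iem_map T x \<in> It T (last_t T)}"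
    then obtain \<beta> where b: "x \<in> It T \<beta>" "iem_map T x \<in> It T (last_t T)" by (auto simp: iem_dom_def)
    \<comment> \<open>When the bottom letter wins, its bottom interval covers the top interval of
      \<open>last_t\<close>; only points of \<open>last_b\<close> can land there.\<close>
    have "iem_map T x \<in> {lb T (last_b T)<..<lb T (last_b T) + len T (last_b T)}"
      using b(2) False last_ends[OF T] by (auto simp: It_eq[OF T] top_wins_def)
    then have "\<beta> = last_b T" using Ib_disjoint[OF T iem_map_Ib[OF T b(1)]] by blast
    then show "x \<in> It (step T) (last_t T)"
      using It_step_loser(1)[OF T g, of x] wl b iem_map_It[OF T b(1)] by simp
  qed
  have 3: "It (step T) (last_b T) = {x \<in> It T (last_b T). iem_map T x < lt T (last_t T)}"
  proof -
    have "It (step T) (last_b T) = {lt T (last_b T) <..< lt T (last_b T) + (len T (last_b T) - len T (last_t T))}"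
      using wl last_neq[OF T] by (simp add: It_eq iem_step[OF T g] lt_step[OF T] step_len)
    moreover have "x \<in> It T (last_b T) \<Longrightarrow> iem_map T x < lt T (last_t T) \<longleftrightarrow>
        x < lt T (last_b T) + (len T (last_b T) - len T (last_t T))" for x
      using last_ends[OF T] iem_map_It[OF T, of x "last_b T"] by (auto simp: disp_def)
    ultimately show ?thesis using iem_len[OF T, of "last_t T"] by (auto simp: It_eq[OF T])
  qed
  show ?thesis using False 1 2 3
    by (simp add: rauzy_labels_def Let_def u_card_pred[OF T, unfolded One_nat_def]
        v_card_pred[OF T, unfolded One_nat_def] u_0[OF T] flip: last_t_def last_b_def top_wins_def)
qed

lemma rauzy_labels_unique:
  fixes T :: "'a::finite iem"
  assumes "rauzy_labels T T1" "rauzy_labels T T2"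
  shows "It T1 \<alpha> = It T2 \<alpha>"
proof (cases "u T (CARD('a) - 1) < v T (CARD('a) - 1)")
  case True
  then show ?thesis using assms unfolding rauzy_labels_def Let_def
    by (cases "\<alpha> = inv (pi_t T) CARD('a)") simp_all
next
  case False
  then show ?thesis using assms unfolding rauzy_labels_def Let_def
    by (cases "\<alpha> = inv (pi_t T) CARD('a)"; cases "\<alpha> = inv (pi_b T) CARD('a)") simp_all
qed

lemma rauzy_step_eq:
  fixes T :: "'a::finite iem"
  assumes T: "iem T" and g: "generic_ends T"
  shows "rauzy_step T = step T"
  unfolding rauzy_step_def
proof (rule the_equality)
  have I: "I_full (step T) = {u T 0<..<max (u T (CARD('a) - 1)) (v T (CARD('a) - 1))}"
    using I_full_step[OF T g] by (simp only: u_card_pred[OF T] v_card_pred[OF T] u_0[OF T])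
  show *: "iem (step T) \<and>
    I_full (step T) = {u T 0<..<max (u T (CARD('a) - 1)) (v T (CARD('a) - 1))} \<and>
    (\<forall>x\<in>iem_dom (step T). iem_map (step T) x = first_return (iem_map T) (I_full (step T)) x) \<and>
    rauzy_labels T (step T)"
    using iem_step[OF T g] I first_return_step[OF T g] rauzy_labels_step[OF T g] by auto
  fix T' :: "'a iem"
  assume T': "iem T' \<and>
    I_full T' = {u T 0<..<max (u T (CARD('a) - 1)) (v T (CARD('a) - 1))} \<and>
    (\<forall>x\<in>iem_dom T'. iem_map T' x = first_return (iem_map T) (I_full T') x) \<and> rauzy_labels T T'"
  have It: "It T' \<alpha> = It (step T) \<alpha>" for \<alpha> using rauzy_labels_unique T' * by blast
  then have "iem_dom T' = iem_dom (step T)" by (simp add: iem_dom_def)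
  then show "T' = step T" using T' * It by (intro iem_eqI) auto
qed

section \<open>Orbit segments, and the absence of connections after a step\<close>

lemma orbit_defined_add:
  "orbit_defined T (m + k) x \<longleftrightarrow> orbit_defined T m x \<and> orbit_defined T k ((iem_map T ^^ m) x)"
proof -
  have "(\<forall>j<m + k. P j) \<longleftrightarrow> (\<forall>j<m. P j) \<and> (\<forall>j<k. P (j + m))" for P
  proof safe
    fix j assume 1: "\<forall>j<m. P j" "\<forall>j<k. P (j + m)" "j < m + k"
    show "P j"
    proof (cases "j < m")
      case False
      then show ?thesis using 1(2,3) by (metis add.commute add_less_imp_less_left le_add_diff_inverse not_less)
    qed (use 1 in auto)
  qed auto
  then show ?thesis by (simp add: orbit_defined_def funpow_add)
qed

lemma orbit_defined_1: "orbit_defined T (Suc 0) x \<longleftrightarrow> x \<in> iem_dom T"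
  by (simp add: orbit_defined_def)

lemma orbit_defined_Suc:
  "orbit_defined T (Suc m) x \<longleftrightarrow> x \<in> iem_dom T \<and> orbit_defined T m (iem_map T x)"
  using orbit_defined_add[of T 1 m x] by (simp add: orbit_defined_1)

lemma orbit_defined_0: "orbit_defined T 0 x"
  by (simp add: orbit_defined_def)

lemma orbit_lift:
  assumes T: "iem T" and g: "generic_ends T"
  shows "orbit_defined (step T) m x \<Longrightarrow>
    \<exists>M. orbit_defined T M x \<and> (iem_map T ^^ M) x = (iem_map (step T) ^^ m) x"
proof (induction m arbitrary: x)
  case 0
  then show ?case using orbit_defined_0 by (intro exI[of _ 0]) simp
next
  case (Suc m)
  let ?y = "iem_map (step T) x"
  obtain \<alpha> where \<alpha>: "x \<in> It (step T) \<alpha>" "orbit_defined (step T) m ?y"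
    using Suc.prems by (auto simp: orbit_defined_Suc iem_dom_def)
  obtain M where M: "orbit_defined T M ?y" "(iem_map T ^^ M) ?y = (iem_map (step T) ^^ m) ?y"
    using Suc.IH[OF \<alpha>(2)] by auto
  show ?case
  proof (cases "\<alpha> = loser T")
    case False
    show ?thesis using step_map_other[OF T g \<alpha>(1) False] M
      by (intro exI[of _ "Suc M"]) (auto simp: orbit_defined_Suc iem_dom_def funpow_swap1)
  next
    case True
    show ?thesis using step_map_loser[OF T g \<alpha>(1)[unfolded True]] M
      by (intro exI[of _ "Suc (Suc M)"]) (auto simp: orbit_defined_Suc iem_dom_def funpow_swap1)
  qed
qed

lemma origin_less_lt_iff: "iem T \<Longrightarrow> origin T < lt T \<alpha> \<longleftrightarrow> 1 < pi_t T \<alpha>"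
proof -
  assume T: "iem T"
  show ?thesis
  proof
    assume "1 < pi_t T \<alpha>"
    moreover have "pi_t T (inv (pi_t T) 1) = 1"
      by (rule letters_bij_inv) (use iem_bij[OF T] iem_card[OF T] in auto)
    ultimately have "lt T (inv (pi_t T) 1) + len T (inv (pi_t T) 1) \<le> lt T \<alpha>"
      by (intro lt_less[OF T]) simp
    then show "origin T < lt T \<alpha>"
      using lt_bounds(1)[OF T, of "inv (pi_t T) 1"] iem_len[OF T, of "inv (pi_t T) 1"] by linarith
  next
    assume less: "origin T < lt T \<alpha>"
    show "1 < pi_t T \<alpha>"
    proof (rule ccontr)
      assume "\<not> 1 < pi_t T \<alpha>"
      then have "\<not> pi_t T \<beta> < pi_t T \<alpha>" for \<beta>
        using letters_bij_range[OF iem_bij(1)[OF T], of \<beta>] by linarith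
      then have "{\<beta>. pi_t T \<beta> < pi_t T \<alpha>} = {}" by blast
      then show False using less by (simp add: lt_def psum_def)
    qed
  qed
qed

lemma origin_less_lb_iff: "iem T \<Longrightarrow> origin T < lb T \<alpha> \<longleftrightarrow> 1 < pi_b T \<alpha>"
proof -
  assume T: "iem T"
  show ?thesis
  proof
    assume "1 < pi_b T \<alpha>"
    moreover have "pi_b T (inv (pi_b T) 1) = 1"
      by (rule letters_bij_inv) (use iem_bij[OF T] iem_card[OF T] in auto)
    ultimately have "lb T (inv (pi_b T) 1) + len T (inv (pi_b T) 1) \<le> lb T \<alpha>"
      by (intro lb_less[OF T]) simp
    then show "origin T < lb T \<alpha>"
      using lb_bounds(1)[OF T, of "inv (pi_b T) 1"] iem_len[OF T, of "inv (pi_b T) 1"] by linarith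
  next
    assume less: "origin T < lb T \<alpha>"
    show "1 < pi_b T \<alpha>"
    proof (rule ccontr)
      assume "\<not> 1 < pi_b T \<alpha>"
      then have "\<not> pi_b T \<beta> < pi_b T \<alpha>" for \<beta>
        using letters_bij_range[OF iem_bij(2)[OF T], of \<beta>] by linarith
      then have "{\<beta>. pi_b T \<beta> < pi_b T \<alpha>} = {}" by blast
      then show False using less by (simp add: lb_def psum_def)
    qed
  qed
qed

text \<open>Each singularity is named by the letter on its right. The letters that begin at the
  origin have to be excluded, since their left end is not a singularity.\<close>

lemma no_connection_letters:
  fixes T :: "'a::finite iem"
  assumes T: "iem T"
  shows "no_connection T \<longleftrightarrow> (\<forall>\<alpha> \<beta> m. origin T < lt T \<alpha> \<longrightarrow> origin T < lb T \<beta> \<longrightarrow>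
    orbit_defined T m (lb T \<beta>) \<longrightarrow> (iem_map T ^^ m) (lb T \<beta>) \<noteq> lt T \<alpha>)" (is "_ \<longleftrightarrow> ?R")
proof
  assume no: "no_connection T"
  show ?R
  proof (intro allI impI notI)
    fix \<alpha> \<beta> m assume *: "origin T < lt T \<alpha>" "origin T < lb T \<beta>" "orbit_defined T m (lb T \<beta>)"
      "(iem_map T ^^ m) (lb T \<beta>) = lt T \<alpha>"
    have "connection T (pi_t T \<alpha> - 1) (pi_b T \<beta> - 1) m"
      unfolding connection_def u_pred[OF T] v_pred[OF T]
      using * letters_bij_range[OF iem_bij(1)[OF T], of \<alpha>] letters_bij_range[OF iem_bij(2)[OF T], of \<beta>]
      by (auto simp: origin_less_lt_iff[OF T] origin_less_lb_iff[OF T])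
    then show False using no by (simp add: no_connection_def)
  qed
next
  assume R: ?R
  show "no_connection T" unfolding no_connection_def
  proof (intro notI, elim exE)
    fix i j m assume c: "connection T i j m"
    let ?\<alpha> = "inv (pi_t T) (Suc i)" and ?\<beta> = "inv (pi_b T) (Suc j)"
    have p: "pi_t T ?\<alpha> = Suc i" "pi_b T ?\<beta> = Suc j"
      using c iem_bij[OF T] by (auto simp: connection_def intro!: letters_bij_inv)
    then have "lt T ?\<alpha> = u T i" "lb T ?\<beta> = v T j" using u_pred[OF T, of ?\<alpha>] v_pred[OF T, of ?\<beta>] by auto
    moreover have "origin T < lt T ?\<alpha>" "origin T < lb T ?\<beta>"
      using p c by (auto simp: origin_less_lt_iff[OF T] origin_less_lb_iff[OF T] connection_def)
    ultimately show False using R c unfolding connection_def by metis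
  qed
qed

text \<open>By \<open>orbit_lift\<close>, a connection of the step gives an orbit segment of
  \<open>T\<close> with the same ends. The only end that need not be a singularity of
  \<open>T\<close> or of its inverse is the point created by the cut; it is the image or the
  preimage under \<open>T\<close> of such a singularity, so lengthening the segment by one point
  yields a connection of \<open>T\<close>.\<close>

lemma no_connection_step:
  assumes T: "iem T" and no: "no_connection T"
  shows "no_connection (step T)"
proof -
  have g: "generic_ends T" by (rule no_connection_generic[OF T no])
  have no': "\<And>\<alpha> \<beta> m. origin T < lt T \<alpha> \<Longrightarrow> origin T < lb T \<beta> \<Longrightarrow>
    orbit_defined T m (lb T \<beta>) \<Longrightarrow> (iem_map T ^^ m) (lb T \<beta>) \<noteq> lt T \<alpha>"
    using no no_connection_letters[OF T] by blast
  have "(iem_map (step T) ^^ m) (lb (step T) \<beta>) \<noteq> lt (step T) \<alpha>"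
    if *: "origin T < lt (step T) \<alpha>" "origin T < lb (step T) \<beta>" "orbit_defined (step T) m (lb (step T) \<beta>)"
    for \<alpha> \<beta> m
  proof
    assume eq: "(iem_map (step T) ^^ m) (lb (step T) \<beta>) = lt (step T) \<alpha>"
    obtain M where M: "orbit_defined T M (lb (step T) \<beta>)" "(iem_map T ^^ M) (lb (step T) \<beta>) = lt (step T) \<alpha>"
      using orbit_lift[OF T g *(3)] eq by metis
    show False
    proof (cases "top_wins T")
      case True
      then have lt: "lt (step T) \<alpha> = lt T \<alpha>" by (simp add: lt_step[OF T])
      show False
      proof (cases "\<beta> = last_b T")
        case False
        then show False using no' * M lt by (simp add: lb_step[OF T])
      next
        case b: True
        let ?y = "lb T (last_b T)"
        have y: "?y \<in> It T (last_t T)"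
          using True last_ends[OF T] iem_len[OF T, of "last_b T"] by (auto simp: It_eq[OF T] top_wins_def)
        have "iem_map T ?y = lb (step T) \<beta>"
          using iem_map_It[OF T y] last_ends[OF T] True b by (simp add: lb_step[OF T] disp_def)
        then have "orbit_defined T (Suc M) ?y" "(iem_map T ^^ Suc M) ?y = lt T \<alpha>"
          using y M lt by (auto simp: orbit_defined_Suc iem_dom_def funpow_swap1)
        moreover have "origin T < ?y" using True lt_bounds(1)[OF T, of "last_t T"] by (simp add: top_wins_def)
        ultimately show False using no' * lt by metis
      qed
    next
      case False
      then have lb: "lb (step T) \<beta> = lb T \<beta>" by (simp add: lb_step[OF T])
      show False
      proof (cases "\<alpha> = last_t T")
        case a: False
        then show False using no' * M lb by (simp add: lt_step[OF T])
      next
        case a: True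
        let ?x = "lt (step T) \<alpha>"
        have x: "?x \<in> It T (last_b T)" "iem_map T ?x = lt T (last_t T)"
        proof -
          show x: "?x \<in> It T (last_b T)"
            using False a len_loser_less[OF T g] iem_len[OF T, of "last_t T"]
            by (auto simp: It_eq[OF T] lt_step[OF T] winner_def loser_def)
          show "iem_map T ?x = lt T (last_t T)"
            using iem_map_It[OF T x] False a last_ends[OF T] by (simp add: lt_step[OF T] disp_def)
        qed
        have "orbit_defined T (Suc M) (lb T \<beta>)" "(iem_map T ^^ Suc M) (lb T \<beta>) = lt T (last_t T)"
          using M x lb orbit_defined_add[of T M 1 "lb T \<beta>"] by (auto simp: orbit_defined_1 iem_dom_def)
        moreover have "origin T < lt T (last_t T)"
          using False g lb_bounds(1)[OF T, of "last_b T"] by (simp add: top_wins_def generic_ends_def)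
        ultimately show False using no' * lb by metis
      qed
    qed
  qed
  then show ?thesis
    using no_connection_letters[OF iem_step[OF T g]] by (simp add: step_origin)
qed

lemma RV_props:
  assumes T: "iem T" and no: "no_connection T"
  shows "iem (RV T n) \<and> no_connection (RV T n)"
proof (induction n)
  case 0
  then show ?case using assms by (simp add: RV_def)
next
  case (Suc n)
  then have "RV T (Suc n) = step (RV T n)"
    using rauzy_step_eq no_connection_generic by (auto simp: RV_def)
  then show ?case using Suc iem_step no_connection_step no_connection_generic by metis
qed

lemma RV_0: "RV T 0 = T"
  by (simp add: RV_def)

lemma RV_RV: "RV (RV T m) n = RV T (m + n)"
  by (simp add: RV_def add.commute[of m n] funpow_add)

lemma RV_iem: "iem T \<Longrightarrow> no_connection T \<Longrightarrow> iem (RV T n)"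
  and RV_no_connection: "iem T \<Longrightarrow> no_connection T \<Longrightarrow> no_connection (RV T n)"
  and RV_generic: "iem T \<Longrightarrow> no_connection T \<Longrightarrow> generic_ends (RV T n)"
  and RV_Suc: "iem T \<Longrightarrow> no_connection T \<Longrightarrow> RV T (Suc n) = step (RV T n)"
  using RV_props[of T n] no_connection_generic[of "RV T n"] rauzy_step_eq[of "RV T n"]
  by (auto simp: RV_def)

section \<open>Towers and special Birkhoff sums\<close>


text \<open>Whichever letter wins, a point of the new interval of the loser visits the top interval of
  \<open>last_b T\<close> and then that of \<open>last_t T\<close>, so one formula covers both cases.\<close>

definition gstep :: "'a::finite iem \<Rightarrow> ('a \<Rightarrow> real \<Rightarrow> real) \<Rightarrow> 'a \<Rightarrow> real \<Rightarrow> real" where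
  "gstep T \<phi> \<alpha> x =
    (if \<alpha> = loser T then \<phi> (last_b T) x + \<phi> (last_t T) (x + disp T (last_b T)) else \<phi> \<alpha> x)"

text \<open>The special Birkhoff sums computed step by step, directly on the closed intervals, with
  neither return times nor limits. \<open>special_birkhoff_eq\<close> identifies them with
  \<open>special_birkhoff\<close> where they are continuous. In the same way \<open>hgt\<close> and
  \<open>KZ\<close> below turn out to be the return times and the matrices
  \<open>B T 0 n\<close>.\<close>

primrec SB :: "'a::finite iem \<Rightarrow> nat \<Rightarrow> ('a \<Rightarrow> real \<Rightarrow> real) \<Rightarrow> 'a \<Rightarrow> real \<Rightarrow> real" where
  "SB T 0 \<phi> = \<phi>"
| "SB T (Suc n) \<phi> = gstep (RV T n) (SB T n \<phi>)"

primrec hgt :: "'a::finite iem \<Rightarrow> nat \<Rightarrow> 'a \<Rightarrow> nat" where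
  "hgt T 0 = (\<lambda>\<alpha>. 1)"
| "hgt T (Suc n) = (\<lambda>\<alpha>. hgt T n \<alpha> + (if \<alpha> = loser (RV T n) then hgt T n (winner (RV T n)) else 0))"

definition elem :: "'a::finite iem \<Rightarrow> real^'a^'a" where
  "elem T = (\<chi> \<alpha> \<beta>. if \<alpha> = \<beta> \<or> \<alpha> = loser T \<and> \<beta> = winner T then 1 else 0)"

primrec KZ :: "'a::finite iem \<Rightarrow> nat \<Rightarrow> real^'a^'a" where
  "KZ T 0 = mat 1"
| "KZ T (Suc n) = elem (RV T n) ** KZ T n"

lemma elem_vec:
  assumes "iem T"
  shows "(elem T *v c) $ \<alpha> = c $ \<alpha> + (if \<alpha> = loser T then c $ winner T else 0)"
proof -
  have "(elem T *v c) $ \<alpha> = (\<Sum>\<beta>\<in>UNIV. (if \<alpha> = \<beta> then c $ \<beta> else 0)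
      + (if \<alpha> = loser T \<and> \<beta> = winner T then c $ \<beta> else 0))"
    unfolding matrix_vector_mult_def elem_def using winner_neq_loser[OF assms]
    by (auto intro!: sum.cong)
  also have "\<dots> = c $ \<alpha> + (if \<alpha> = loser T then c $ winner T else 0)"
    by (cases "\<alpha> = loser T") (simp_all add: sum.distrib)
  finally show ?thesis .
qed

lemma gstep_loser: "gstep T \<phi> (loser T) x = \<phi> (last_b T) x + \<phi> (last_t T) (x + disp T (last_b T))"
  and gstep_other: "\<alpha> \<noteq> loser T \<Longrightarrow> gstep T \<phi> \<alpha> x = \<phi> \<alpha> x"
  by (simp_all add: gstep_def)

lemma sum_lasts: "iem T \<Longrightarrow> f (last_b T) + f (last_t T) = f (loser T) + (f (winner T) :: 'b::ab_semigroup_add)"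
  by (auto simp: loser_def winner_def add.commute)

lemma gstep_Gamma:
  assumes "iem T"
  shows "gstep T (of_Gamma c) = of_Gamma (elem T *v c)"
  by (intro ext) (auto simp: gstep_def of_Gamma_def elem_vec[OF assms] sum_lasts[OF assms, of "($) c"])

lemma gstep_minus: "gstep T (\<lambda>\<alpha> x. \<phi> \<alpha> x - \<psi> \<alpha> x) = (\<lambda>\<alpha> x. gstep T \<phi> \<alpha> x - gstep T \<psi> \<alpha> x)"
  by (intro ext) (simp add: gstep_def)

lemma SB_minus: "SB T n (\<lambda>\<alpha> x. \<phi> \<alpha> x - \<psi> \<alpha> x) = (\<lambda>\<alpha> x. SB T n \<phi> \<alpha> x - SB T n \<psi> \<alpha> x)"
  by (induction n) (simp_all add: gstep_minus)

lemma SB_Gamma: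
  assumes "iem T" "no_connection T"
  shows "SB T n (of_Gamma c) = of_Gamma (KZ T n *v c)"
  by (induction n) (simp_all add: gstep_Gamma RV_iem[OF assms] matrix_vector_mul_assoc)

lemma SB_minus_Gamma:
  assumes "iem T" "no_connection T"
  shows "SB T n (minus_Gamma \<phi> c) \<alpha> x = SB T n \<phi> \<alpha> x - (KZ T n *v c) $ \<alpha>"
  unfolding minus_Gamma_def SB_minus SB_Gamma[OF assms] by (simp add: of_Gamma_def)

lemma KZ_hgt:
  assumes "iem T" "no_connection T"
  shows "(KZ T n *v 1) $ \<alpha> = real (hgt T n \<alpha>)"
  by (induction n arbitrary: \<alpha>)
    (simp_all add: elem_vec RV_iem[OF assms] flip: matrix_vector_mul_assoc)

lemma hgt_pos: "1 \<le> hgt T n \<alpha>"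
  by (induction n) auto

lemma I_full_step_subset: "iem T \<Longrightarrow> generic_ends T \<Longrightarrow> I_full (step T) \<subseteq> I_full T"
  using lt_bounds(2)[of T "last_t T"] lb_bounds(2)[of T "last_b T"] iem_len[of T "last_t T"] iem_len[of T "last_b T"]
  by (auto simp: I_full_step I_full_eq)

lemma birkhoff_sum_add:
  "birkhoff_sum T (m + k) \<phi> x = birkhoff_sum T m \<phi> x + birkhoff_sum T k \<phi> ((iem_map T ^^ m) x)"
proof -
  have "birkhoff_sum T (m + k) \<phi> x = birkhoff_sum T m \<phi> x + (\<Sum>j\<in>{m..<m+k}. eval_at T \<phi> ((iem_map T ^^ j) x))"
    unfolding birkhoff_sum_def lessThan_atLeast0 by (rule sum.atLeastLessThan_concat[symmetric]) auto
  also have "(\<Sum>j\<in>{m..<m+k}. eval_at T \<phi> ((iem_map T ^^ j) x)) = birkhoff_sum T k \<phi> ((iem_map T ^^ m) x)"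
    unfolding birkhoff_sum_def lessThan_atLeast0
    using sum.shift_bounds_nat_ivl[of "\<lambda>j. eval_at T \<phi> ((iem_map T ^^ j) x)" 0 m k]
    by (simp add: funpow_add add.commute)
  finally show ?thesis .
qed

lemma birkhoff_sum_Suc:
  "birkhoff_sum T (Suc k) \<phi> x = eval_at T \<phi> x + birkhoff_sum T k \<phi> (iem_map T x)"
  using birkhoff_sum_add[of T 1 k \<phi> x] by (simp add: birkhoff_sum_def)

lemma birkhoff_sum_0: "birkhoff_sum T 0 \<phi> x = 0"
  by (simp add: birkhoff_sum_def)

lemma eval_at_It: "iem T \<Longrightarrow> x \<in> It T \<alpha> \<Longrightarrow> eval_at T \<phi> x = \<phi> \<alpha> x"
  by (simp add: eval_at_def letter_It)

text \<open>The four facts are proved in one induction. For the loser, the tower of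
  \<open>last_t\<close> is stacked on that of \<open>last_b\<close>; the point where they meet lies
  outside the new interval, so no return occurs halfway.\<close>

lemma tower:
  assumes T: "iem T" "no_connection T"
  shows "x \<in> It (RV T n) \<alpha> \<Longrightarrow> orbit_defined T (hgt T n \<alpha>) x \<and>
    (iem_map T ^^ hgt T n \<alpha>) x = iem_map (RV T n) x \<and>
    (\<forall>j. 0 < j \<and> j < hgt T n \<alpha> \<longrightarrow> (iem_map T ^^ j) x \<notin> I_full (RV T n)) \<and>
    birkhoff_sum T (hgt T n \<alpha>) \<phi> x = SB T n \<phi> \<alpha> x"
proof (induction n arbitrary: \<alpha> x)
  case 0
  then show ?case using T
    by (auto simp: RV_0 orbit_defined_1 iem_dom_def birkhoff_sum_Suc birkhoff_sum_0 eval_at_It)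
next
  case (Suc n)
  let ?R = "RV T n"
  have R: "iem ?R" "generic_ends ?R" "RV T (Suc n) = step ?R"
    using RV_iem[OF T] RV_generic[OF T] RV_Suc[OF T] by auto
  have sub: "I_full (step ?R) \<subseteq> I_full ?R" using I_full_step_subset R by blast
  have x: "x \<in> It (step ?R) \<alpha>" using Suc.prems R by simp
  show ?case
  proof (cases "\<alpha> = loser ?R")
    case False
    note o = step_map_other[OF R(1,2) x False]
    show ?thesis using Suc.IH[OF o(1)] False o(2) sub by (auto simp: R(3) gstep_def)
  next
    case True
    note l = step_map_loser[OF R(1,2) x[unfolded True]]
    let ?y = "iem_map ?R x" and ?p = "hgt T n (last_b ?R)" and ?q = "hgt T n (last_t ?R)"
    have h: "hgt T (Suc n) \<alpha> = ?p + ?q" using True sum_lasts[OF R(1), of "hgt T n"] by simp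
    note 1 = Suc.IH[OF l(1)] and 2 = Suc.IH[OF l(3)]
    have "(iem_map T ^^ (?q + ?p)) x = iem_map (step ?R) x"
      using 1 2 l(5) by (simp add: funpow_add)
    moreover have "orbit_defined T (?p + ?q) x" using 1 2 by (simp add: orbit_defined_add)
    moreover have "(iem_map T ^^ j) x \<notin> I_full (step ?R)" if "0 < j" "j < ?p + ?q" for j
    proof (cases "j < ?p")
      case True
      then show ?thesis using 1 that sub by blast
    next
      case False
      then have k: "j = (j - ?p) + ?p" "j - ?p < ?q" using that by linarith+
      define k where "k = j - ?p"
      then have k: "j = k + ?p" "k < ?q" using k by auto
      have "(iem_map T ^^ j) x = (iem_map T ^^ k) ?y" using 1 by (simp add: k funpow_add)
      then show ?thesis using 2 l(4) sub k by (cases "k = 0") auto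
    qed
    moreover have "birkhoff_sum T (?p + ?q) \<phi> x = SB T n \<phi> (last_b ?R) x + SB T n \<phi> (last_t ?R) ?y"
      using 1 2 by (simp add: birkhoff_sum_add)
    ultimately show ?thesis unfolding h using True l(2) by (simp add: R(3) gstep_loser add.commute)
  qed
qed

lemma visit_time_hgt:
  assumes T: "iem T" "no_connection T" and x: "x \<in> It (RV T n) \<alpha>"
  shows "visit_time T 0 n x = hgt T n \<alpha>"
  unfolding visit_time_def return_time_def RV_0
proof (rule Least_equality)
  note t = tower[OF T x]
  show "0 < hgt T n \<alpha> \<and> (iem_map T ^^ hgt T n \<alpha>) x \<in> I_full (RV T n)"
    using t hgt_pos[of T n \<alpha>] iem_map_in_I[OF RV_iem[OF T] x] by simp
  fix r assume "0 < r \<and> (iem_map T ^^ r) x \<in> I_full (RV T n)"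
  then show "hgt T n \<alpha> \<le> r" using t not_less by blast
qed

lemma birkhoff_visit:
  assumes T: "iem T" "no_connection T" and x: "x \<in> It (RV T n) \<alpha>"
  shows "birkhoff_sum (RV T 0) (visit_time T 0 n x) \<phi> x = SB T n \<phi> \<alpha> x"
  using tower[OF T x] visit_time_hgt[OF T x] by (simp add: RV_0)

text \<open>The number of visits to the interval of \<beta> is the Birkhoff sum of its indicator,
  which is an element of \<Gamma>; \<open>KZ\<close> is the action of \<open>SB\<close> on
  \<Gamma>.\<close>

lemma B_0_eq_KZ:
  assumes T: "iem T" "no_connection T"
  shows "B T 0 n = KZ T n"
proof (intro vec_eq_iff[THEN iffD2] allI)
  fix \<alpha> \<beta>
  let ?c = "\<lambda>x. card {j. j < visit_time T 0 n x \<and> (iem_map (RV T 0) ^^ j) x \<in> It (RV T 0) \<beta>}"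
  have c: "real (?c x) = KZ T n $ \<alpha> $ \<beta>" if x: "x \<in> It (RV T n) \<alpha>" for x
  proof -
    let ?h = "hgt T n \<alpha>"
    have "KZ T n $ \<alpha> $ \<beta> = (KZ T n *v axis \<beta> 1) $ \<alpha>"
      by (simp add: matrix_vector_mul_component inner_axis)
    also have "\<dots> = SB T n (of_Gamma (axis \<beta> 1)) \<alpha> x" by (simp add: SB_Gamma[OF T]) (simp add: of_Gamma_def)
    also have "\<dots> = birkhoff_sum T ?h (of_Gamma (axis \<beta> 1)) x" using tower[OF T x] by metis
    also have "\<dots> = (\<Sum>j<?h. if (iem_map T ^^ j) x \<in> It T \<beta> then 1 else 0)"
      unfolding birkhoff_sum_def
    proof (rule sum.cong)
      fix j assume "j \<in> {..<?h}"
      then have "(iem_map T ^^ j) x \<in> iem_dom T" using tower[OF T x] by (auto simp: orbit_defined_def)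
      then obtain \<gamma> where "(iem_map T ^^ j) x \<in> It T \<gamma>" by (auto simp: iem_dom_def)
      then show "eval_at T (of_Gamma (axis \<beta> 1)) ((iem_map T ^^ j) x) =
          (if (iem_map T ^^ j) x \<in> It T \<beta> then 1 else 0)"
        using It_disjoint[OF T(1)] by (auto simp: eval_at_It[OF T(1)] of_Gamma_def axis_def)
    qed simp
    also have "\<dots> = real (card ({..<?h} \<inter> {j. (iem_map T ^^ j) x \<in> It T \<beta>}))"
      by (simp add: sum.If_cases)
    also have "{..<?h} \<inter> {j. (iem_map T ^^ j) x \<in> It T \<beta>} =
        {j. j < visit_time T 0 n x \<and> (iem_map (RV T 0) ^^ j) x \<in> It (RV T 0) \<beta>}"
      using visit_time_hgt[OF T x] by (auto simp: RV_0)
    finally show ?thesis by simp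
  qed
  let ?x = "lt (RV T n) \<alpha> + len (RV T n) \<alpha> / 2"
  have x: "?x \<in> It (RV T n) \<alpha>" by (rule It_nonempty[OF RV_iem[OF T]])
  have "(THE b. \<forall>x\<in>It (RV T n) \<alpha>. b = ?c x) = ?c ?x"
  proof (rule the_equality)
    show "\<forall>x\<in>It (RV T n) \<alpha>. ?c ?x = ?c x"
    proof
      fix z assume "z \<in> It (RV T n) \<alpha>"
      then have "real (?c ?x) = real (?c z)" unfolding c[OF x] by (rule c[symmetric])
      then show "?c ?x = ?c z" by (simp only: of_nat_eq_iff)
    qed
  qed (use x in blast)
  then show "B T 0 n $ \<alpha> $ \<beta> = KZ T n $ \<alpha> $ \<beta>" using c[OF x] by (simp add: B_def)
qed

lemma B_shift: "m \<le> n \<Longrightarrow> B T m n = B (RV T m) 0 (n - m)"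
  by (simp add: B_def visit_time_def RV_RV RV_0)

lemma B_eq_KZ:
  assumes T: "iem T" "no_connection T" and "m \<le> n"
  shows "B T m n = KZ (RV T m) (n - m)"
  by (simp only: B_shift[OF assms(3)] B_0_eq_KZ[OF RV_iem[OF T] RV_no_connection[OF T]])

lemma KZ_add: "KZ T (m + k) = KZ (RV T m) k ** KZ T m"
  by (induction k) (simp_all add: RV_RV matrix_mul_assoc)

text \<open>The total area of the towers is invariant: the area that the winner loses by being cut
  is the area that the loser gains in height. This bounds the sum of all oscillations uniformly in
  n.\<close>

lemma sum_hgt_len:
  assumes T: "iem T" "no_connection T"
  shows "(\<Sum>\<alpha>\<in>UNIV. real (hgt T n \<alpha>) * len (RV T n) \<alpha>) = sum (len T) UNIV"
proof (induction n)
  case 0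
  then show ?case by (simp add: RV_0)
next
  case (Suc n)
  let ?R = "RV T n" and ?h = "hgt T n"
  let ?l = "loser ?R" and ?w = "winner ?R"
  have "real (hgt T (Suc n) \<alpha>) * len (RV T (Suc n)) \<alpha> = real (?h \<alpha>) * len ?R \<alpha>
      + ((if \<alpha> = ?l then real (?h ?w) * len ?R ?l else 0) - (if \<alpha> = ?w then real (?h ?w) * len ?R ?l else 0))" for \<alpha>
    using winner_neq_loser[OF RV_iem[OF T], of n]
    by (simp add: RV_Suc[OF T] step_len algebra_simps)
  then show ?case using Suc by (simp add: sum.distrib sum_subtractf)
qed

text \<open>The map acts by translations, so every term of the sum contributes K times the same
  distance, and there are \<open>hgt T n \<alpha>\<close> terms.\<close>

lemma SB_lipschitz:
  assumes T: "iem T" "no_connection T"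
    and lip: "\<And>\<alpha> x y. x \<in> It_closed T \<alpha> \<Longrightarrow> y \<in> It_closed T \<alpha> \<Longrightarrow> \<bar>\<phi> \<alpha> x - \<phi> \<alpha> y\<bar> \<le> K * \<bar>x - y\<bar>"
  shows "x \<in> It_closed (RV T n) \<alpha> \<Longrightarrow> y \<in> It_closed (RV T n) \<alpha> \<Longrightarrow>
    \<bar>SB T n \<phi> \<alpha> x - SB T n \<phi> \<alpha> y\<bar> \<le> K * real (hgt T n \<alpha>) * \<bar>x - y\<bar>"
proof (induction n arbitrary: \<alpha> x y)
  case 0
  then show ?case using lip by (simp add: RV_0)
next
  case (Suc n)
  let ?R = "RV T n"
  have R: "iem ?R" "generic_ends ?R" "RV T (Suc n) = step ?R"
    using RV_iem[OF T] RV_generic[OF T] RV_Suc[OF T] by auto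
  have xy: "x \<in> It_closed (step ?R) \<alpha>" "y \<in> It_closed (step ?R) \<alpha>" using Suc.prems R by auto
  show ?case
  proof (cases "\<alpha> = loser ?R")
    case False
    then show ?thesis using Suc.IH[of x \<alpha> y] xy It_step_subset(2)[OF R(1,2) False]
      by (auto simp: gstep_def)
  next
    case True
    have "x \<in> It_closed ?R (last_b ?R)" "x + disp ?R (last_b ?R) \<in> It_closed ?R (last_t ?R)"
      "y \<in> It_closed ?R (last_b ?R)" "y + disp ?R (last_b ?R) \<in> It_closed ?R (last_t ?R)"
      using It_step_loser(2)[OF R(1,2)] xy True by auto
    note * = Suc.IH[OF this(1,3)] Suc.IH[OF this(2,4)]
    have h: "hgt T (Suc n) \<alpha> = hgt T n (last_b ?R) + hgt T n (last_t ?R)"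
      using True sum_lasts[OF R(1), of "hgt T n"] by simp
    show ?thesis unfolding h using * True
      by (simp add: gstep_def algebra_simps)
  qed
qed

lemma It_subset_closed: "It T \<alpha> \<subseteq> It_closed T \<alpha>"
  by (auto simp: It_def It_closed_def)

text \<open>The defining limit is taken inside the open interval, where both sums agree by
  \<open>birkhoff_visit\<close>; continuity of \<open>SB\<close> carries the equality to the
  ends.\<close>

lemma special_birkhoff_eq:
  assumes T: "iem T" "no_connection T"
    and cont: "continuous_on (It_closed (RV T n) \<alpha>) (SB T n \<phi> \<alpha>)" and x: "x \<in> It_closed (RV T n) \<alpha>"
  shows "special_birkhoff T 0 n \<phi> \<alpha> x = SB T n \<phi> \<alpha> x"
proof -
  let ?S = "It (RV T n) \<alpha>"
  have R: "iem (RV T n)" by (rule RV_iem[OF T])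
  have "closure ?S = It_closed (RV T n) \<alpha>"
    using iem_len[OF R, of \<alpha>] by (simp add: It_eq[OF R] It_closed_eq[OF R])
  then have nontriv: "at x within ?S \<noteq> bot"
    using x iem_len[OF R, of \<alpha>]
    by (simp add: trivial_limit_within It_closed_eq[OF R] flip: limpt_of_closure[of x ?S])
  have "((SB T n \<phi> \<alpha>) \<longlongrightarrow> SB T n \<phi> \<alpha> x) (at x within It_closed (RV T n) \<alpha>)"
    using cont x by (simp add: continuous_on_def)
  then have "((SB T n \<phi> \<alpha>) \<longlongrightarrow> SB T n \<phi> \<alpha> x) (at x within ?S)"
    by (rule tendsto_within_subset[OF _ It_subset_closed])
  then have "((\<lambda>y. birkhoff_sum (RV T 0) (visit_time T 0 n y) \<phi> y) \<longlongrightarrow> SB T n \<phi> \<alpha> x) (at x within ?S)"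
    by (rule Lim_transform_eventually) (auto simp: eventually_at_filter birkhoff_visit[OF T])
  then show ?thesis unfolding special_birkhoff_def by (rule tendsto_Lim[OF nontriv])
qed

section \<open>Splitting an orbit segment along one step\<close>

lemma lt_notin_dom: "iem T \<Longrightarrow> lt T \<alpha> \<notin> iem_dom T"
proof
  assume T: "iem T" and "lt T \<alpha> \<in> iem_dom T"
  then obtain \<beta> where b: "lt T \<alpha> \<in> It T \<beta>" by (auto simp: iem_dom_def)
  then show False using lt_less[OF T, of \<alpha> \<beta>] lt_less[OF T, of \<beta> \<alpha>] letters_bij_eq[OF iem_bij(1)[OF T], of \<alpha> \<beta>]
      iem_len[OF T, of \<alpha>]
    by (cases "pi_t T \<alpha>" "pi_t T \<beta>" rule: linorder_cases) (auto simp: It_eq[OF T])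
qed

text \<open>Such a point exists only if the bottom letter wins: it is the preimage of the last
  singularity, where the interval of \<open>last_b\<close> is cut. An orbit of \<open>T\<close>
  through it must stop at its image.\<close>

lemma step_dom_gap:
  assumes T: "iem T" and g: "generic_ends T"
    and y: "y \<in> iem_dom T" "y \<in> I_full (step T)" "y \<notin> iem_dom (step T)"
  shows "iem_map T y \<notin> iem_dom T"
proof -
  obtain \<alpha> where \<alpha>: "y \<in> It T \<alpha>" using y by (auto simp: iem_dom_def)
  have nin: "y \<notin> It (step T) \<beta>" for \<beta> using y(3) by (auto simp: iem_dom_def)
  have neq: "last_t T \<noteq> last_b T" by (rule last_neq[OF T])
  have y_lt: "y < max (lt T (last_t T)) (lb T (last_b T))" using y(2) by (simp add: I_full_step[OF T g])
  show ?thesis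
  proof (cases "top_wins T")
    case True
    have "y \<in> It (step T) \<alpha>"
      using \<alpha> y_lt True last_ends[OF T] neq
      by (auto simp: It_eq T iem_step[OF T g] lt_step[OF T] step_len winner_def loser_def top_wins_def)
    then show ?thesis using nin by blast
  next
    case False
    then have wl: "winner T = last_b T" "loser T = last_t T" by (auto simp: winner_def loser_def)
    have "\<alpha> \<noteq> last_t T" using \<alpha> y_lt False by (auto simp: It_eq[OF T] top_wins_def)
    moreover have "\<alpha> = last_b T"
    proof (rule ccontr)
      assume "\<alpha> \<noteq> last_b T"
      then have "It (step T) \<alpha> = It T \<alpha>" using \<open>\<alpha> \<noteq> last_t T\<close> wl
        by (simp add: It_eq T iem_step[OF T g] lt_step[OF T] step_len)
      then show False using nin \<alpha> by blast
    qed
    ultimately have "y = lt T (last_b T) + len T (last_b T) - len T (last_t T)"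
      using \<alpha> nin[of "last_b T"] nin[of "last_t T"] False neq wl
      by (auto simp: It_eq T iem_step[OF T g] lt_step[OF T] step_len)
    then have "iem_map T y = lt T (last_t T)"
      using iem_map_It[OF T \<alpha>] \<open>\<alpha> = last_b T\<close> last_ends[OF T] by (simp add: disp_def)
    then show ?thesis using lt_notin_dom[OF T] by simp
  qed
qed

text \<open>A point beyond the new interval belongs to \<open>last_t\<close>, whose bottom interval
  lies to the left of that of \<open>last_b\<close>. Hence one application of \<open>T\<close> is
  enough to enter the new interval.\<close>

lemma return_after_gap:
  assumes T: "iem T" and g: "generic_ends T" and y: "y \<in> iem_dom T" "y \<notin> I_full (step T)"
  shows "iem_map T y \<in> I_full (step T)"
proof -
  obtain \<alpha> where \<alpha>: "y \<in> It T \<alpha>" using y by (auto simp: iem_dom_def)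
  have y_ge: "max (lt T (last_t T)) (lb T (last_b T)) \<le> y"
    using y(2) \<alpha> lt_bounds(1)[OF T, of \<alpha>] by (auto simp: I_full_step[OF T g] It_eq[OF T])
  have "\<alpha> = last_t T"
  proof (rule ccontr)
    assume "\<alpha> \<noteq> last_t T"
    then have "pi_t T \<alpha> < pi_t T (last_t T)"
      by (rule letters_bij_last_less[OF iem_bij(1)[OF T] pi_last_t[OF T]])
    then show False using lt_less[OF T] \<alpha> y_ge by (fastforce simp: It_eq[OF T])
  qed
  then have "iem_map T y \<in> {lb T (last_t T)<..<lb T (last_t T) + len T (last_t T)}"
    using iem_map_Ib[OF T \<alpha>] by simp
  moreover have "lb T (last_t T) + len T (last_t T) \<le> lb T (last_b T)"
    by (rule lb_less[OF T letters_bij_last_less[OF iem_bij(2)[OF T] pi_last_b[OF T] last_neq[OF T]]])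
  ultimately show ?thesis using lb_bounds(1)[OF T, of "last_t T"] by (auto simp: I_full_step[OF T g])
qed

text \<open>The list \<open>xs\<close> holds the possible leftover at the end of the segment: the
  orbit may stop halfway through the double passage of the loser, or at the cut point.\<close>

lemma birkhoff_step_aux:
  assumes T: "iem T" and g: "generic_ends T"
  shows "orbit_defined T L y \<Longrightarrow> y \<in> I_full (step T) \<Longrightarrow>
    \<exists>L' xs. length xs \<le> 1 \<and> set xs \<subseteq> iem_dom T \<and> orbit_defined (step T) L' y \<and>
      (\<forall>\<phi>. birkhoff_sum T L \<phi> y = (\<Sum>p\<leftarrow>xs. eval_at T \<phi> p) + birkhoff_sum (step T) L' (gstep T \<phi>) y)"
proof (induction L arbitrary: y rule: less_induct)
  case (less L)
  have S: "iem (step T)" by (rule iem_step[OF T g])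
  show ?case
  proof (cases L)
    case 0
    then show ?thesis
      by (intro exI[of _ 0] exI[of _ "[]"]) (auto simp: birkhoff_sum_0 orbit_defined_0)
  next
    case (Suc k)
    have y: "y \<in> iem_dom T" "orbit_defined T k (iem_map T y)"
      using less.prems Suc by (auto simp: orbit_defined_Suc)
    show ?thesis
    proof (cases "y \<in> iem_dom (step T)")
      case False
      then have "iem_map T y \<notin> iem_dom T" using step_dom_gap[OF T g y(1) less.prems(2)] by blast
      then have "k = 0" using y(2) by (cases k) (auto simp: orbit_defined_Suc)
      then show ?thesis using y Suc
        by (intro exI[of _ 0] exI[of _ "[y]"]) (auto simp: birkhoff_sum_0 birkhoff_sum_Suc orbit_defined_0)
    next
      case True
      then obtain \<alpha> where \<alpha>: "y \<in> It (step T) \<alpha>" by (auto simp: iem_dom_def)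
      have ret: "iem_map (step T) y \<in> I_full (step T)" by (rule iem_map_in_I[OF S \<alpha>])
      show ?thesis
      proof (cases "\<alpha> = loser T")
        case False
        note o = step_map_other[OF T g \<alpha> False]
        obtain L' xs where L': "length xs \<le> 1" "set xs \<subseteq> iem_dom T" "orbit_defined (step T) L' (iem_map T y)"
          "\<And>\<phi>. birkhoff_sum T k \<phi> (iem_map T y) = (\<Sum>p\<leftarrow>xs. eval_at T \<phi> p)
            + birkhoff_sum (step T) L' (gstep T \<phi>) (iem_map T y)"
          using less.IH[of k "iem_map T y"] y(2) ret o(2) Suc by auto
        show ?thesis using L' True o Suc \<alpha> False
          by (intro exI[of _ "Suc L'"] exI[of _ xs])
            (auto simp: birkhoff_sum_Suc orbit_defined_Suc eval_at_It[OF T o(1)] eval_at_It[OF S \<alpha>] gstep_other)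
      next
        case l: True
        note o = step_map_loser[OF T g \<alpha>[unfolded l]]
        show ?thesis
        proof (cases k)
          case 0
          then show ?thesis using y Suc
            by (intro exI[of _ 0] exI[of _ "[y]"]) (auto simp: birkhoff_sum_0 birkhoff_sum_Suc orbit_defined_0)
        next
          case k: (Suc k')
          let ?z = "iem_map (step T) y"
          have "orbit_defined T k' ?z" using y(2) o(5) by (simp add: k orbit_defined_Suc)
          then obtain L' xs where L': "length xs \<le> 1" "set xs \<subseteq> iem_dom T" "orbit_defined (step T) L' ?z"
            "\<And>\<phi>. birkhoff_sum T k' \<phi> ?z = (\<Sum>p\<leftarrow>xs. eval_at T \<phi> p) + birkhoff_sum (step T) L' (gstep T \<phi>) ?z"
            using less.IH[of k' ?z] ret Suc k by auto
          show ?thesis using L' True o(5) Suc k \<alpha> l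
            by (intro exI[of _ "Suc L'"] exI[of _ xs])
              (auto simp: birkhoff_sum_Suc orbit_defined_Suc eval_at_It[OF T o(1)] eval_at_It[OF T o(3)]
                eval_at_It[OF S \<alpha>] gstep_loser o(2)[symmetric])
        qed
      qed
    qed
  qed
qed

text \<open>The second possible extra term comes from the beginning, when the segment starts outside
  the new interval.\<close>

lemma birkhoff_step:
  assumes T: "iem T" and g: "generic_ends T" and L: "orbit_defined T L y"
  obtains L' y' xs where "length xs \<le> 2" "set xs \<subseteq> iem_dom T" "orbit_defined (step T) L' y'"
    "\<And>\<phi>. birkhoff_sum T L \<phi> y = (\<Sum>p\<leftarrow>xs. eval_at T \<phi> p) + birkhoff_sum (step T) L' (gstep T \<phi>) y'"
proof (cases "y \<in> I_full (step T)")
  case True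
  then obtain L' xs where "length xs \<le> 1" "set xs \<subseteq> iem_dom T" "orbit_defined (step T) L' y"
      "\<And>\<phi>. birkhoff_sum T L \<phi> y = (\<Sum>p\<leftarrow>xs. eval_at T \<phi> p) + birkhoff_sum (step T) L' (gstep T \<phi>) y"
    using birkhoff_step_aux[OF T g L] by metis
  then show ?thesis by (intro that[of xs L' y]) auto
next
  case False
  show ?thesis
  proof (cases L)
    case 0
    then show ?thesis by (intro that[of "[]" 0 y]) (auto simp: birkhoff_sum_0 orbit_defined_0)
  next
    case (Suc k)
    have y: "y \<in> iem_dom T" "orbit_defined T k (iem_map T y)"
      using L Suc by (auto simp: orbit_defined_Suc)
    have "iem_map T y \<in> I_full (step T)" by (rule return_after_gap[OF T g y(1) False])
    then obtain L' xs where "length xs \<le> 1" "set xs \<subseteq> iem_dom T" "orbit_defined (step T) L' (iem_map T y)"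
      "\<And>\<phi>. birkhoff_sum T k \<phi> (iem_map T y) = (\<Sum>p\<leftarrow>xs. eval_at T \<phi> p)
        + birkhoff_sum (step T) L' (gstep T \<phi>) (iem_map T y)"
      using birkhoff_step_aux[OF T g y(2)] by metis
    then show ?thesis using y Suc
      by (intro that[of "y # xs" L' "iem_map T y"]) (auto simp: birkhoff_sum_Suc)
  qed
qed

text \<open>The last conjunct keeps track of length: the Birkhoff sum of the heights along the
  remaining segment counts original points, so it never exceeds N.\<close>

lemma birkhoff_decomposition:
  assumes T: "iem T" "no_connection T"
    and M: "\<And>i \<alpha> z. z \<in> It (RV T i) \<alpha> \<Longrightarrow> \<bar>SB T i f \<alpha> z\<bar> \<le> M i"
    and x: "orbit_defined T N x"
  shows "\<exists>L y. orbit_defined (RV T n) L y \<and>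
    \<bar>birkhoff_sum T N f x\<bar> \<le> 2 * (\<Sum>i<n. M i) + \<bar>birkhoff_sum (RV T n) L (SB T n f) y\<bar> \<and>
    birkhoff_sum (RV T n) L (SB T n (of_Gamma 1)) y \<le> real N"
proof (induction n)
  case 0
  have "birkhoff_sum T N (of_Gamma 1) x = real N" by (simp add: birkhoff_sum_def eval_at_def of_Gamma_def)
  then show ?case using x by (intro exI[of _ N] exI[of _ x]) (simp add: RV_0)
next
  case (Suc n)
  let ?R = "RV T n"
  have R: "iem ?R" "generic_ends ?R" "RV T (Suc n) = step ?R"
    using RV_iem[OF T] RV_generic[OF T] RV_Suc[OF T] by auto
  obtain L y where L: "orbit_defined ?R L y"
    "\<bar>birkhoff_sum T N f x\<bar> \<le> 2 * (\<Sum>i<n. M i) + \<bar>birkhoff_sum ?R L (SB T n f) y\<bar>"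
    "birkhoff_sum ?R L (SB T n (of_Gamma 1)) y \<le> real N" using Suc by auto
  obtain L' y' xs where *: "length xs \<le> 2" "set xs \<subseteq> iem_dom ?R" "orbit_defined (step ?R) L' y'"
    "\<And>\<phi>. birkhoff_sum ?R L \<phi> y = (\<Sum>p\<leftarrow>xs. eval_at ?R \<phi> p) + birkhoff_sum (step ?R) L' (gstep ?R \<phi>) y'"
    using birkhoff_step[OF R(1,2) L(1)] by metis
  have ev: "\<bar>eval_at ?R (SB T n f) p\<bar> \<le> M n" "0 \<le> eval_at ?R (SB T n (of_Gamma 1)) p" if p: "p \<in> iem_dom ?R" for p
  proof -
    obtain \<alpha> where \<alpha>: "p \<in> It ?R \<alpha>" using p by (auto simp: iem_dom_def)
    show "\<bar>eval_at ?R (SB T n f) p\<bar> \<le> M n" using M[OF \<alpha>] by (simp add: eval_at_It[OF R(1) \<alpha>])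
    show "0 \<le> eval_at ?R (SB T n (of_Gamma 1)) p"
      by (simp add: SB_Gamma[OF T] eval_at_def) (simp add: of_Gamma_def KZ_hgt[OF T])
  qed
  have Mn: "0 \<le> M n" using M[OF It_nonempty[OF R(1)]] by (meson abs_ge_zero order_trans)
  have "\<bar>\<Sum>p\<leftarrow>xs. eval_at ?R (SB T n f) p\<bar> \<le> real (length xs) * M n"
    using *(2) ev(1)
  proof (induction xs)
    case (Cons p xs)
    then have "\<bar>eval_at ?R (SB T n f) p\<bar> \<le> M n" "\<bar>\<Sum>p\<leftarrow>xs. eval_at ?R (SB T n f) p\<bar> \<le> real (length xs) * M n" by auto
    then show ?case by (simp add: algebra_simps)
  qed simp
  also have "\<dots> \<le> 2 * M n" using *(1) Mn by (intro mult_right_mono) auto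
  finally have 1: "\<bar>\<Sum>p\<leftarrow>xs. eval_at ?R (SB T n f) p\<bar> \<le> 2 * M n" .
  have 2: "0 \<le> (\<Sum>p\<leftarrow>xs. eval_at ?R (SB T n (of_Gamma 1)) p)"
    using *(2) ev(2) by (intro sum_list_nonneg) auto
  show ?case
    using 1 2 L *(3) *(4)[of "SB T n f"] *(4)[of "SB T n (of_Gamma 1)"]
    by (intro exI[of _ L'] exI[of _ y']) (auto simp: R(3))
qed

text \<open>A nonempty remainder would use up at least one full tower, hence more than N points.
  Thus nothing remains at stage n.\<close>

lemma birkhoff_bound:
  assumes T: "iem T" "no_connection T"
    and M: "\<And>i \<alpha> z. z \<in> It (RV T i) \<alpha> \<Longrightarrow> \<bar>SB T i f \<alpha> z\<bar> \<le> M i"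
    and x: "orbit_defined T N x" and N: "\<And>\<alpha>. N < hgt T n \<alpha>"
  shows "\<bar>birkhoff_sum T N f x\<bar> \<le> 2 * (\<Sum>i<n. M i)"
proof -
  obtain L y where L: "orbit_defined (RV T n) L y"
    "\<bar>birkhoff_sum T N f x\<bar> \<le> 2 * (\<Sum>i<n. M i) + \<bar>birkhoff_sum (RV T n) L (SB T n f) y\<bar>"
    "birkhoff_sum (RV T n) L (SB T n (of_Gamma 1)) y \<le> real N"
    using birkhoff_decomposition[OF assms(1-4)] by metis
  have ev: "eval_at (RV T n) (SB T n (of_Gamma 1)) p = real (hgt T n (letter (RV T n) p))" for p
    by (simp add: SB_Gamma[OF T] eval_at_def) (simp add: of_Gamma_def KZ_hgt[OF T])
  have "L = 0"
  proof (cases L)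
    case (Suc k)
    have "0 \<le> birkhoff_sum (RV T n) k (SB T n (of_Gamma 1)) (iem_map (RV T n) y)"
      by (simp add: birkhoff_sum_def ev sum_nonneg)
    then have "real (hgt T n (letter (RV T n) y)) \<le> real N" using L(3) by (simp add: Suc birkhoff_sum_Suc ev)
    then show ?thesis using N[of "letter (RV T n) y"] by simp
  qed simp
  then show ?thesis using L(2) by (simp add: birkhoff_sum_0)
qed

section \<open>Positivity of the cocycle\<close>


lemma letters_bij_initial_segment:
  assumes p: "letters_bij (p :: 'a::finite \<Rightarrow> nat)"
    and X: "\<And>\<alpha> \<beta>. \<beta> \<in> X \<Longrightarrow> \<alpha> \<notin> X \<Longrightarrow> p \<beta> < p \<alpha>"
  shows "p -` {1..card X} = X"
proof -
  have "p \<gamma> \<le> card X \<longleftrightarrow> \<gamma> \<in> X" for \<gamma>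
  proof (cases "\<gamma> \<in> X")
    case True
    have "\<delta> \<in> X \<and> \<delta> \<noteq> \<gamma>" if "p \<delta> < p \<gamma>" for \<delta>
      using X[of \<gamma> \<delta>] True that by (metis less_asym less_irrefl)
    then have "{\<delta>. p \<delta> < p \<gamma>} \<subseteq> X - {\<gamma>}" by blast
    then have "card {\<delta>. p \<delta> < p \<gamma>} \<le> card (X - {\<gamma>})" by (intro card_mono) auto
    moreover have "card (X - {\<gamma>}) < card X" by (rule card_Diff1_less) (use True in auto)
    ultimately show ?thesis using letters_bij_card[OF p, of \<gamma>] True by linarith
  next
    case False
    then have "X \<subseteq> {\<delta>. p \<delta> < p \<gamma>}" using X by blast
    then have "card X \<le> card {\<delta>. p \<delta> < p \<gamma>}" by (intro card_mono) auto
    then show ?thesis using letters_bij_card[OF p, of \<gamma>] False by linarith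
  qed
  then show ?thesis using letters_bij_range[OF p] by auto
qed

lemma bounded_mono_nat_eventually_const:
  fixes f :: "nat \<Rightarrow> nat"
  assumes "\<And>n. n \<ge> n1 \<Longrightarrow> f n \<le> f (Suc n)" "\<And>n. f n \<le> K"
  obtains N where "N \<ge> n1" "\<And>n. n \<ge> N \<Longrightarrow> f (Suc n) = f n"
proof -
  have mono: "f m \<le> f n" if "n1 \<le> m" "m \<le> n" for m n
    using that(2)
  proof (induction n rule: dec_induct)
    case (step n)
    then show ?case using assms(1)[of n] that by linarith
  qed simp
  let ?S = "f ` {n1..}"
  have fin: "finite ?S" by (rule finite_subset[of _ "{..K}"]) (use assms(2) in auto)
  have "Max ?S \<in> ?S" by (rule Max_in) (use fin in auto)
  then obtain N where N: "n1 \<le> N" "f N = Max ?S" by auto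
  have "f n = f N" if "n \<ge> N" for n
  proof (rule antisym)
    show "f n \<le> f N" using Max_ge[OF fin, of "f n"] N that by auto
    show "f N \<le> f n" using mono[of N n] N(1) that by simp
  qed
  then show thesis using N by (intro that[of N]) auto
qed

text \<open>A letter that neither wins nor loses can only move to the right, so its position is eventually
  constant; from then on no letter is inserted to its left, hence no letter to its left wins.\<close>

lemma row_eventually_separated:
  fixes p :: "nat \<Rightarrow> 'a::finite \<Rightarrow> nat" and w l :: "nat \<Rightarrow> 'a"
  assumes bij: "\<And>n. letters_bij (p n)" and wl: "\<And>n. w n \<noteq> l n"
    and keep: "\<And>n. c n \<Longrightarrow> p (Suc n) = p n \<and> p n (w n) = CARD('a)"
    and move: "\<And>n. \<not> c n \<Longrightarrow> p (Suc n) = move_after (p n) (l n) (w n) \<and> p n (l n) = CARD('a)"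
    and X: "\<And>n. n \<ge> n1 \<Longrightarrow> w n \<notin> X \<and> l n \<notin> X"
    and inf: "\<And>\<alpha>. \<alpha> \<notin> X \<Longrightarrow> \<exists>\<^sub>F n in sequentially. w n = \<alpha>"
  shows "\<forall>\<^sub>F n in sequentially. \<forall>\<beta>\<in>X. \<forall>\<alpha>. \<alpha> \<notin> X \<longrightarrow> p n \<beta> < p n \<alpha>"
proof -
  have le: "p n \<beta> \<le> p (Suc n) \<beta>" if "n \<ge> n1" "\<beta> \<in> X" for n \<beta>
    using keep[of n] move[of n] X[OF that(1)] that(2) by (cases "c n") (auto simp: move_after_def)
  let ?f = "\<lambda>n. \<Sum>\<beta>\<in>X. p n \<beta>"
  have "?f n \<le> card X * CARD('a)" for n
    using sum_bounded_above[of X "p n" "CARD('a)"] letters_bij_range[OF bij[of n]] by simp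
  then obtain N where N: "N \<ge> n1" "\<And>n. n \<ge> N \<Longrightarrow> ?f (Suc n) = ?f n"
    using bounded_mono_nat_eventually_const[of n1 ?f] le by (metis (no_types, lifting) sum_mono)
  have const: "p (Suc n) \<beta> = p n \<beta>" if "n \<ge> N" "\<beta> \<in> X" for n \<beta>
    using sum_mono_inv[of "p n" X "p (Suc n)" \<beta>] N le that by auto
  have "p n \<beta> < p n \<alpha>" if n: "n \<ge> N" and \<beta>: "\<beta> \<in> X" and \<alpha>: "\<alpha> \<notin> X" for n \<alpha> \<beta>
  proof (rule ccontr)
    assume "\<not> p n \<beta> < p n \<alpha>"
    moreover have "p n \<alpha> \<noteq> p n \<beta>" using letters_bij_eq[OF bij[of n]] \<alpha> \<beta> by metis
    ultimately have less: "p n \<alpha> < p n \<beta>" by simp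
    have persist: "p m \<alpha> < p m \<beta>" if "n \<le> m" for m
      using that
    proof (induction m rule: dec_induct)
      case (step m)
      show ?case
      proof (cases "c m")
        case False
        have "\<alpha> \<noteq> l m" using step move[OF False] letters_bij_range[OF bij[of m], of \<beta>] by auto
        moreover have "\<beta> \<noteq> l m" using X[of m] step n N \<beta> by auto
        ultimately show ?thesis using step move[OF False] move_after_less_iff[of \<beta> "l m" \<alpha>] by simp
      qed (use step keep in auto)
    qed (rule less)
    obtain m where m: "m \<ge> n" "w m = \<alpha>" using inf[OF \<alpha>] by (auto simp: frequently_sequentially)
    have "\<not> c m" using keep[of m] m persist[OF m(1)] letters_bij_range[OF bij[of m], of \<beta>] by auto
    moreover have "\<beta> \<noteq> l m" using X[of m] m n N \<beta> by auto
    ultimately have "p (Suc m) \<beta> = Suc (p m \<beta>)"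
      using move[of m] m persist[OF m(1)] by (auto simp: move_after_def)
    then show False using const[of m \<beta>] m n \<beta> by simp
  qed
  then show ?thesis unfolding eventually_sequentially by blast
qed

lemma sum_len_step:
  assumes "iem T"
  shows "sum (len (step T)) UNIV = sum (len T) UNIV - len T (loser T)"
proof -
  have "sum (len (step T)) UNIV = sum (\<lambda>\<alpha>. len T \<alpha> - (if \<alpha> = winner T then len T (loser T) else 0)) UNIV"
    by (intro sum.cong) (auto simp: step_len)
  then show ?thesis by (simp add: sum_subtractf)
qed

text \<open>Let X be the set of letters that eventually stop winning. Lengths of losers are cut off
  from the total length, so they tend to 0, whereas a letter that no longer wins keeps its length;
  letters of X therefore eventually stop losing too. By \<open>row_eventually_separated\<close> X is
  then an initial segment of both rows, and irreducibility leaves only X empty, since some letter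
  outside X wins.\<close>

lemma letter_wins_infinitely_often:
  assumes T: "iem (T :: 'a::finite iem)" "no_connection T"
  shows "\<exists>\<^sub>F n in sequentially. winner (RV T n) = \<alpha>"
proof -
  let ?w = "\<lambda>n. winner (RV T n)" and ?l = "\<lambda>n. loser (RV T n)"
  define X where "X = {\<alpha>. \<forall>\<^sub>F n in sequentially. ?w n \<noteq> \<alpha>}"
  have R: "iem (RV T n)" for n by (rule RV_iem[OF T])
  have inf: "\<exists>\<^sub>F n in sequentially. ?w n = \<alpha>" if "\<alpha> \<notin> X" for \<alpha>
    using that by (simp add: X_def frequently_def)
  have "summable (\<lambda>n. len (RV T n) (?l n))"
  proof (rule summableI_nonneg_bounded)
    fix n
    show "0 \<le> len (RV T n) (?l n)" using iem_len[OF R] by (simp add: less_imp_le)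
    have "(\<Sum>i<n. len (RV T i) (?l i)) = sum (len T) UNIV - sum (len (RV T n)) UNIV"
      by (induction n) (simp_all add: RV_0 RV_Suc[OF T] sum_len_step[OF R])
    also have "\<dots> \<le> sum (len T) UNIV" using iem_len[OF R[of n]] by (simp add: sum_nonneg less_imp_le)
    finally show "(\<Sum>i<n. len (RV T i) (?l i)) \<le> sum (len T) UNIV" .
  qed
  then have lim: "(\<lambda>n. len (RV T n) (?l n)) \<longlonglongrightarrow> 0" by (rule summable_LIMSEQ_zero)
  have "\<forall>\<^sub>F n in sequentially. ?l n \<noteq> \<alpha>" if \<alpha>: "\<alpha> \<in> X" for \<alpha>
  proof -
    obtain n0 where n0: "\<And>n. n \<ge> n0 \<Longrightarrow> ?w n \<noteq> \<alpha>" using \<alpha> by (auto simp: X_def eventually_sequentially)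
    have const: "len (RV T n) \<alpha> = len (RV T n0) \<alpha>" if "n \<ge> n0" for n
      using that
    proof (induction n rule: dec_induct)
      case (step n)
      then show ?case using n0[of n] by (auto simp: RV_Suc[OF T] step_len)
    qed simp
    have "\<forall>\<^sub>F n in sequentially. len (RV T n) (?l n) < len (RV T n0) \<alpha>"
      by (rule order_tendstoD(2)[OF lim iem_len[OF R]])
    moreover have "\<forall>\<^sub>F n in sequentially. n \<ge> n0" by (rule eventually_ge_at_top)
    ultimately show ?thesis by eventually_elim (metis const less_irrefl)
  qed
  then have "\<forall>\<^sub>F n in sequentially. \<forall>\<alpha>\<in>X. ?w n \<noteq> \<alpha> \<and> ?l n \<noteq> \<alpha>"
    by (intro eventually_ball_finite) (auto simp: X_def intro: eventually_conj)
  then obtain n1 where n1: "\<And>n. n \<ge> n1 \<Longrightarrow> ?w n \<notin> X \<and> ?l n \<notin> X"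
    unfolding eventually_sequentially by blast
  have "\<forall>\<^sub>F n in sequentially. \<forall>\<beta>\<in>X. \<forall>\<alpha>. \<alpha> \<notin> X \<longrightarrow> pi_t (RV T n) \<beta> < pi_t (RV T n) \<alpha>"
    by (rule row_eventually_separated[where w = ?w and l = ?l and c = "\<lambda>n. top_wins (RV T n)" and ?n1.0 = n1])
      (use iem_bij(1)[OF R] winner_neq_loser[OF R] pi_last_t[OF R] n1 inf in
        \<open>auto simp: RV_Suc[OF T] step_def winner_def loser_def\<close>)
  moreover have "\<forall>\<^sub>F n in sequentially. \<forall>\<beta>\<in>X. \<forall>\<alpha>. \<alpha> \<notin> X \<longrightarrow> pi_b (RV T n) \<beta> < pi_b (RV T n) \<alpha>"
    by (rule row_eventually_separated[where w = ?w and l = ?l and c = "\<lambda>n. \<not> top_wins (RV T n)" and ?n1.0 = n1])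
      (use iem_bij(2)[OF R] winner_neq_loser[OF R] pi_last_b[OF R] n1 inf in
        \<open>auto simp: RV_Suc[OF T] step_def winner_def loser_def\<close>)
  ultimately have "\<forall>\<^sub>F n in sequentially. (\<forall>\<beta>\<in>X. \<forall>\<alpha>. \<alpha> \<notin> X \<longrightarrow> pi_t (RV T n) \<beta> < pi_t (RV T n) \<alpha>) \<and>
      (\<forall>\<beta>\<in>X. \<forall>\<alpha>. \<alpha> \<notin> X \<longrightarrow> pi_b (RV T n) \<beta> < pi_b (RV T n) \<alpha>)"
    by (rule eventually_conj)
  then obtain n where n: "\<And>\<alpha> \<beta>. \<beta> \<in> X \<Longrightarrow> \<alpha> \<notin> X \<Longrightarrow> pi_t (RV T n) \<beta> < pi_t (RV T n) \<alpha>"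
      "\<And>\<alpha> \<beta>. \<beta> \<in> X \<Longrightarrow> \<alpha> \<notin> X \<Longrightarrow> pi_b (RV T n) \<beta> < pi_b (RV T n) \<alpha>"
    unfolding eventually_sequentially by blast
  have "pi_t (RV T n) -` {1..card X} = pi_b (RV T n) -` {1..card X}"
    using letters_bij_initial_segment[OF iem_bij(1)[OF R] n(1)]
      letters_bij_initial_segment[OF iem_bij(2)[OF R] n(2)] by simp
  then have "\<not> (1 \<le> card X \<and> card X < CARD('a))" using R[of n] unfolding iem_def by blast
  moreover have "card X < CARD('a)"
  proof (rule psubset_card_mono)
    show "X \<subset> UNIV" using n1[of n1] by blast
  qed simp
  ultimately have "X = {}" by (simp add: not_less_eq_eq)
  then show ?thesis using inf by simp
qed

section \<open>Entries of the cocycle matrices\<close>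

lemma KZ_Suc_entry:
  assumes T: "iem T" "no_connection T"
  shows "KZ T (Suc n) $ \<alpha> $ \<beta> =
    KZ T n $ \<alpha> $ \<beta> + (if \<alpha> = loser (RV T n) then KZ T n $ winner (RV T n) $ \<beta> else 0)"
proof -
  have e: "M $ \<gamma> $ \<beta> = (M *v axis \<beta> 1) $ \<gamma>" for M :: "real^'a^'a" and \<gamma>
    by (simp add: matrix_vector_mul_component inner_axis)
  show ?thesis unfolding e KZ.simps(2) matrix_vector_mul_assoc[symmetric] elem_vec[OF RV_iem[OF T]] ..
qed

lemma KZ_nonneg:
  assumes T: "iem T" "no_connection T" shows "0 \<le> KZ T n $ \<alpha> $ \<beta>"
  by (induction n arbitrary: \<alpha>) (simp_all add: mat_def KZ_Suc_entry[OF T] del: KZ.simps(2))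

lemma KZ_mono:
  assumes T: "iem T" "no_connection T" and "m \<le> n" shows "KZ T m $ \<alpha> $ \<beta> \<le> KZ T n $ \<alpha> $ \<beta>"
  using assms(3)
proof (induction n rule: dec_induct)
  case (step n)
  then show ?case using KZ_nonneg[OF T, of n "winner (RV T n)" \<beta>] by (auto simp: KZ_Suc_entry[OF T] simp del: KZ.simps(2))
qed simp

lemma KZ_Ints:
  assumes T: "iem T" "no_connection T" shows "KZ T n $ \<alpha> $ \<beta> \<in> \<int>"
  by (induction n arbitrary: \<alpha>) (simp_all add: mat_def KZ_Suc_entry[OF T] del: KZ.simps(2))

text \<open>The row in which the winner stands last does not change, so the winner takes part in the
  next comparison.\<close>

lemma winner_next:
  assumes T: "iem T" and g: "generic_ends T"
  shows "winner T \<in> {winner (step T), loser (step T)}"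
  using winner_loser[of "step T"]
  by (auto simp: winner_def last_t_def last_b_def step_def)

text \<open>The row of the loser gains the row of the winner. If the support of a column stopped growing
  before being full, the first winner outside the support could only lose to another letter outside
  it, and the letters of the support would never win again.\<close>

lemma KZ_column_positive:
  assumes T: "iem (T :: 'a::finite iem)" "no_connection T"
  shows "\<forall>\<^sub>F n in sequentially. \<forall>\<alpha>. 0 < KZ T n $ \<alpha> $ \<beta>"
proof -
  let ?w = "\<lambda>n. winner (RV T n)" and ?l = "\<lambda>n. loser (RV T n)"
  define P where "P = {\<alpha>. \<exists>n. 0 < KZ T n $ \<alpha> $ \<beta>}"
  have "\<forall>\<^sub>F n in sequentially. 0 < KZ T n $ \<alpha> $ \<beta>" if \<alpha>: "\<alpha> \<in> P" for \<alpha>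
  proof -
    obtain m where "0 < KZ T m $ \<alpha> $ \<beta>" using \<alpha> by (auto simp: P_def)
    then show ?thesis unfolding eventually_sequentially
      by (intro exI[of _ m]) (use KZ_mono[OF T, of m _ \<alpha> \<beta>] in force)
  qed
  then have ev: "\<forall>\<^sub>F n in sequentially. \<forall>\<alpha>\<in>P. 0 < KZ T n $ \<alpha> $ \<beta>"
    by (intro eventually_ball_finite) auto
  then obtain n0 where n0: "\<And>n \<alpha>. n \<ge> n0 \<Longrightarrow> \<alpha> \<in> P \<Longrightarrow> 0 < KZ T n $ \<alpha> $ \<beta>"
    unfolding eventually_sequentially by blast
  have closed: "?l n \<in> P" if "n \<ge> n0" "?w n \<in> P" for n
  proof -
    have "0 < KZ T (Suc n) $ ?l n $ \<beta>"
      using n0[OF that] KZ_nonneg[OF T, of n "?l n" \<beta>] by (simp add: KZ_Suc_entry[OF T] del: KZ.simps(2))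
    then show ?thesis by (auto simp: P_def simp del: KZ.simps(2))
  qed
  have "P = UNIV"
  proof (rule ccontr)
    assume "P \<noteq> UNIV"
    then obtain \<gamma> where \<gamma>: "\<gamma> \<notin> P" by auto
    obtain n where n: "n \<ge> n0" "?w n = \<gamma>"
      using letter_wins_infinitely_often[OF T, of \<gamma>] by (auto simp: frequently_sequentially)
    have out: "?w m \<notin> P" if "m \<ge> n" for m
      using that
    proof (induction m rule: dec_induct)
      case base
      then show ?case using n \<gamma> by simp
    next
      case (step m)
      then show ?case
        using winner_next[OF RV_iem[OF T] RV_generic[OF T], of m] closed[of "Suc m"] n
        by (auto simp: RV_Suc[OF T])
    qed
    have "0 < KZ T 0 $ \<beta> $ \<beta>" by (simp add: mat_def)
    then have "\<beta> \<in> P" unfolding P_def by blast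
    moreover obtain m where "m \<ge> n" "?w m = \<beta>"
      using letter_wins_infinitely_often[OF T, of \<beta>] by (auto simp: frequently_sequentially)
    ultimately show False using out by auto
  qed
  then show ?thesis using ev by simp
qed

lemma KZ_positive:
  assumes T: "iem (T :: 'a::finite iem)" "no_connection T"
  shows "\<exists>n. \<forall>\<alpha> \<beta>. 0 < KZ T n $ \<alpha> $ \<beta>"
proof -
  have "\<forall>\<^sub>F n in sequentially. \<forall>\<beta>. \<forall>\<alpha>. 0 < KZ T n $ \<alpha> $ \<beta>"
    by (rule eventually_all_finite) (rule KZ_column_positive[OF T])
  then show ?thesis unfolding eventually_sequentially by blast
qed

text \<open>\<open>KZ_positive\<close>, applied to the map at the current accelerated time, makes
  the least index meaningful. The index increases strictly because the identity matrix has a zero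
  entry, and positive entries are at least 1 because they are integers.\<close>

lemma accel_props:
  assumes T: "iem (T :: 'a::finite iem)" "no_connection T"
  shows "accel T k < accel T (Suc k)"
    "1 \<le> B T (accel T k) (accel T (Suc k)) $ \<alpha> $ \<beta>"
proof -
  let ?m = "accel T k" and ?P = "\<lambda>n. accel T k \<le> n \<and> (\<forall>\<alpha> \<beta>. 0 < B T (accel T k) n $ \<alpha> $ \<beta>)"
  obtain j where j: "\<And>\<alpha> \<beta>. 0 < KZ (RV T ?m) j $ \<alpha> $ \<beta>"
    using KZ_positive[OF RV_iem[OF T] RV_no_connection[OF T]] by blast
  have "?P (?m + j)" using j B_eq_KZ[OF T, of ?m "?m + j"] by simp
  then have P: "?P (accel T (Suc k))" unfolding accel.simps by (rule LeastI)
  have KZ: "B T ?m (accel T (Suc k)) = KZ (RV T ?m) (accel T (Suc k) - ?m)"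
    using P by (intro B_eq_KZ[OF T]) simp
  obtain a b :: 'a where ab: "a \<noteq> b" using last_neq[OF T(1)] by blast
  have "accel T (Suc k) \<noteq> ?m"
  proof
    assume eq: "accel T (Suc k) = ?m"
    have "B T ?m ?m $ a $ b = 0" using B_eq_KZ[OF T, of ?m ?m] ab by (simp add: mat_def)
    moreover have "0 < B T ?m ?m $ a $ b" using P unfolding eq by blast
    ultimately show False by simp
  qed
  then show "accel T k < accel T (Suc k)" using P by simp
  have "0 < KZ (RV T ?m) (accel T (Suc k) - ?m) $ \<alpha> $ \<beta>" using P KZ by metis
  moreover have "KZ (RV T ?m) (accel T (Suc k) - ?m) $ \<alpha> $ \<beta> \<in> \<int>"
    by (rule KZ_Ints[OF RV_iem[OF T] RV_no_connection[OF T]])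
  ultimately show "1 \<le> B T (accel T k) (accel T (Suc k)) $ \<alpha> $ \<beta>"
    unfolding KZ by (auto elim!: Ints_cases)
qed

section \<open>The boundary operator and the kernel of \<open>\<Omega>\<close>\<close>


lemma Omega_vec:
  assumes "iem T"
  shows "(Omega T *v c) $ \<alpha> = psum (pi_b T) (($) c) \<alpha> - psum (pi_t T) (($) c) \<alpha>"
proof -
  have "Omega T $ \<alpha> $ \<beta> * c $ \<beta> = (if pi_b T \<beta> < pi_b T \<alpha> then c $ \<beta> else 0)
      - (if pi_t T \<beta> < pi_t T \<alpha> then c $ \<beta> else 0)" for \<beta>
    using letters_bij_eq[OF iem_bij(1)[OF assms], of \<alpha> \<beta>] letters_bij_eq[OF iem_bij(2)[OF assms], of \<alpha> \<beta>]
    by (auto simp: Omega_def)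
  then show ?thesis
    by (simp add: matrix_vector_mult_def psum_def sum_subtractf sum.If_cases Int_def)
qed

lemma matrix_minus_vec: "(- A) *v x = - ((A :: real^'n^'m) *v x)"
  by (simp add: matrix_vector_mult_def vec_eq_iff sum_negf)

lemma Omega_antisym: "transpose (Omega T) = - Omega T"
  by (auto simp: transpose_def Omega_def vec_eq_iff)

lemma transpose_elem_vec:
  assumes "iem T"
  shows "(transpose (elem T) *v c) $ \<alpha> = c $ \<alpha> + (if \<alpha> = winner T then c $ loser T else 0)"
proof -
  have "(transpose (elem T) *v c) $ \<alpha> = (\<Sum>\<beta>\<in>UNIV. (if \<alpha> = \<beta> then c $ \<beta> else 0)
      + (if \<alpha> = winner T \<and> \<beta> = loser T then c $ \<beta> else 0))"
    unfolding matrix_vector_mult_def elem_def transpose_def using winner_neq_loser[OF assms]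
    by (auto intro!: sum.cong)
  also have "\<dots> = c $ \<alpha> + (if \<alpha> = winner T then c $ loser T else 0)"
    by (cases "\<alpha> = winner T") (simp_all add: sum.distrib)
  finally show ?thesis .
qed

lemma transpose_elem_fun:
  assumes "iem T"
  shows "($) (transpose (elem T) *v c) = (($) c)(winner T := c $ winner T + c $ loser T)"
  by (intro ext, subst transpose_elem_vec[OF assms]) auto

lemma Omega_step:
  assumes T: "iem T" and g: "generic_ends T"
  shows "Omega (step T) = elem T ** Omega T ** transpose (elem T)"
proof -
  have "Omega (step T) *v c = (elem T ** Omega T ** transpose (elem T)) *v c" for c
  proof (rule vec_eq_iff[THEN iffD2, rule_format])
    fix \<alpha>
    show "(Omega (step T) *v c) $ \<alpha> = ((elem T ** Omega T ** transpose (elem T)) *v c) $ \<alpha>"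
      unfolding matrix_vector_mul_assoc[symmetric] elem_vec[OF T] Omega_vec[OF T]
        Omega_vec[OF iem_step[OF T g]] transpose_elem_fun[OF T]
        psum_step_disp[OF T, of "($) c" \<alpha>]
      by (auto simp: loser_def winner_def)
  qed
  then show ?thesis by (simp add: matrix_eq)
qed

lemma Omega_RV:
  assumes T: "iem T" "no_connection T"
  shows "Omega (RV T n) = KZ T n ** Omega T ** transpose (KZ T n)"
  by (induction n)
    (simp_all add: RV_0 RV_Suc[OF T] Omega_step[OF RV_iem[OF T] RV_generic[OF T]] matrix_transpose_mul
      matrix_mul_assoc transpose_mat)

text \<open>For \<open>w\<close> in the kernel of \<open>\<Omega>\<close>, \<open>bracket T w\<close> is a linear combination of the
  components of the boundary operator, written as a sum over letters so that its invariance
  under special Birkhoff sums is a computation with two letters.\<close>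

definition bracket :: "'a::finite iem \<Rightarrow> ('a \<Rightarrow> real) \<Rightarrow> ('a \<Rightarrow> real \<Rightarrow> real) \<Rightarrow> real" where
  "bracket T w \<phi> = (\<Sum>\<alpha>\<in>UNIV. (psum (pi_t T) w \<alpha> + w \<alpha>) * \<phi> \<alpha> (lt T \<alpha> + len T \<alpha>)
      - psum (pi_t T) w \<alpha> * \<phi> \<alpha> (lt T \<alpha>))"

text \<open>On the kernel of \<open>Omega\<close> both rows have the same partial sums, so these may
  be computed in whichever row the step leaves unchanged. The vector y is the image of w under the
  transposed elementary matrix.\<close>

lemma kernel_step:
  fixes T :: "'a::finite iem"
  assumes T: "iem T" and g: "generic_ends T"
    and w: "\<And>\<alpha>. psum (pi_b (step T)) w \<alpha> = psum (pi_t (step T)) w \<alpha>"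
  defines "y \<equiv> w(winner T := w (winner T) + w (loser T))"
  shows "psum (pi_b T) y \<alpha> = psum (pi_t T) y \<alpha>"
    "psum (pi_t (step T)) w \<alpha> = psum (pi_t T) y \<alpha>"
    "psum (pi_t T) y (last_t T) + y (last_t T) = psum (pi_t T) y (last_b T) + y (last_b T)"
proof -
  define D where "D = (\<lambda>\<alpha>. psum (pi_b T) y \<alpha> - psum (pi_t T) y \<alpha>)"
  have D: "(if \<alpha> = loser T then D (last_b T) + D (last_t T) else D \<alpha>) = 0" for \<alpha>
  proof -
    have "psum (pi_b (step T)) w \<alpha> - psum (pi_t (step T)) w \<alpha> =
        (if \<alpha> = loser T then D (last_b T) + D (last_t T) else D \<alpha>)"
      unfolding D_def y_def by (rule psum_step_disp[OF T])
    then show ?thesis using w[of \<alpha>] by simp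
  qed
  have "D \<alpha> = 0" if "\<alpha> \<noteq> loser T" for \<alpha> using D[of \<alpha>] that by simp
  \<comment> \<open>The two last letters are the winner and the loser; D vanishes at the winner and
    the sum of both values vanishes.\<close>
  moreover have "D (loser T) = 0"
    using D[of "loser T"] D[of "winner T"] winner_neq_loser[OF T] sum_lasts[OF T, of D] by simp
  ultimately have D0: "D \<alpha> = 0" for \<alpha> by (cases "\<alpha> = loser T") auto
  then show ker: "psum (pi_b T) y \<alpha> = psum (pi_t T) y \<alpha>" for \<alpha> by (simp add: D_def)
  show "psum (pi_t (step T)) w \<alpha> = psum (pi_t T) y \<alpha>"
  proof (cases "top_wins T")
    case True
    then show ?thesis using psum_step_t[OF T, of w \<alpha>] by (simp add: y_def)
  next
    case False
    then show ?thesis using psum_step_b[OF T, of w \<alpha>] w ker by (simp add: y_def)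
  qed
  show "psum (pi_t T) y (last_t T) + y (last_t T) = psum (pi_t T) y (last_b T) + y (last_b T)"
    using psum_last[OF iem_bij(1)[OF T] pi_last_t[OF T], of y]
      psum_last[OF iem_bij(2)[OF T] pi_last_b[OF T], of y] ker by simp
qed

lemma sum_two:
  fixes f :: "'a::finite \<Rightarrow> real"
  assumes "a \<noteq> b"
  shows "sum f UNIV = f a + f b + sum f (UNIV - {a, b})"
proof -
  have "sum f UNIV = sum f {a, b} + sum f (UNIV - {a, b})"
    by (subst add.commute, rule sum.subset_diff) auto
  then show ?thesis using assms by simp
qed

text \<open>Only the terms of the two last letters change. The step cuts one interval and thereby
  creates two values at the cut point; their coefficients are the partial sum at the left end of the
  loser and the one at the right end of the winner. These agree on the kernel, so the new values
  cancel.\<close>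

lemma bracket_step:
  fixes T :: "'a::finite iem"
  assumes T: "iem T" and g: "generic_ends T"
    and w: "\<And>\<alpha>. psum (pi_b (step T)) w \<alpha> = psum (pi_t (step T)) w \<alpha>"
  shows "bracket (step T) w (gstep T \<phi>) = bracket T (w(winner T := w (winner T) + w (loser T))) \<phi>"
proof -
  define y where "y = w(winner T := w (winner T) + w (loser T))"
  define P where "P = psum (pi_t T) y"
  let ?a = "last_b T" and ?b = "last_t T"
  note k = kernel_step[OF T g w, folded y_def P_def]
  have P': "psum (pi_t (step T)) w = P" using k(2) by (intro ext) simp
  have neq: "?a \<noteq> ?b" using last_neq[OF T] by simp
  note ends = last_ends[OF T]
  let ?f' = "\<lambda>\<alpha>. (P \<alpha> + w \<alpha>) * gstep T \<phi> \<alpha> (lt (step T) \<alpha> + len (step T) \<alpha>) - P \<alpha> * gstep T \<phi> \<alpha> (lt (step T) \<alpha>)"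
  let ?f = "\<lambda>\<alpha>. (P \<alpha> + y \<alpha>) * \<phi> \<alpha> (lt T \<alpha> + len T \<alpha>) - P \<alpha> * \<phi> \<alpha> (lt T \<alpha>)"
  have wl: "loser T = ?a \<and> winner T = ?b \<or> loser T = ?b \<and> winner T = ?a" by (auto simp: winner_def loser_def)
  have "sum ?f' (UNIV - {?a, ?b}) = sum ?f (UNIV - {?a, ?b})"
    by (rule sum.cong) (use wl in \<open>auto simp: gstep_def step_len y_def lt_step[OF T]\<close>)
  moreover have "?f' ?a + ?f' ?b = ?f ?a + ?f ?b"
  proof (cases "top_wins T")
    case True
    then have wl: "winner T = ?b" "loser T = ?a" by (auto simp: winner_def loser_def)
    have y: "y ?b = w ?b + w ?a" "y ?a = w ?a" using neq by (auto simp: y_def wl)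
    have x: "lt T ?a + len T ?a + disp T ?a = lt T ?b + len T ?b"
      "lt T ?a + disp T ?a = lt T ?b + (len T ?b - len T ?a)" using ends by (auto simp: disp_def)
    have Pa: "P ?a = P ?b + w ?b" using k(3) y by simp
    have e: "?f' ?a = (P ?a + w ?a) * (\<phi> ?a (lt T ?a + len T ?a) + \<phi> ?b (lt T ?b + len T ?b))
        - P ?a * (\<phi> ?a (lt T ?a) + \<phi> ?b (lt T ?b + (len T ?b - len T ?a)))"
      "?f' ?b = (P ?b + w ?b) * \<phi> ?b (lt T ?b + (len T ?b - len T ?a)) - P ?b * \<phi> ?b (lt T ?b)"
      by (simp_all add: neq neq[symmetric] x gstep_def wl lt_step[OF T] True step_len)
    show ?thesis unfolding e unfolding y Pa by (simp add: algebra_simps)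
  next
    case False
    then have wl: "winner T = ?a" "loser T = ?b" by (auto simp: winner_def loser_def)
    have y: "y ?a = w ?a + w ?b" "y ?b = w ?b" using neq by (auto simp: y_def wl)
    let ?s = "lt T ?a + len T ?a - len T ?b"
    have x: "?s + disp T ?a = lt T ?b" "lt T ?a + len T ?a + disp T ?a = lt T ?b + len T ?b"
      using ends by (auto simp: disp_def)
    have Pb: "P ?b = P ?a + w ?a" using k(3) y by simp
    have e: "?f' ?b = (P ?b + w ?b) * (\<phi> ?a (lt T ?a + len T ?a) + \<phi> ?b (lt T ?b + len T ?b))
        - P ?b * (\<phi> ?a ?s + \<phi> ?b (lt T ?b))"
      "?f' ?a = (P ?a + w ?a) * \<phi> ?a ?s - P ?a * \<phi> ?a (lt T ?a)"
      by (simp_all add: neq neq[symmetric] x gstep_def wl lt_step[OF T] False step_len add_diff_eq)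
    show ?thesis unfolding e unfolding y Pb by (simp add: algebra_simps)
  qed
  ultimately have "sum ?f' UNIV = sum ?f UNIV"
    using sum_two[OF neq, of ?f'] sum_two[OF neq, of ?f] by linarith
  then show ?thesis unfolding bracket_def P' y_def[symmetric] P_def[symmetric] .
qed

lemma kernel_psum:
  assumes "iem T" shows "Omega T *v w = 0 \<longleftrightarrow> (\<forall>\<alpha>. psum (pi_b T) (($) w) \<alpha> = psum (pi_t T) (($) w) \<alpha>)"
  by (simp add: vec_eq_iff Omega_vec[OF assms])

lemma bracket_SB:
  assumes T: "iem T" "no_connection T"
  shows "Omega (RV T n) *v w = 0 \<Longrightarrow>
    \<exists>w0. Omega T *v w0 = 0 \<and> bracket (RV T n) (($) w) (SB T n \<phi>) = bracket T (($) w0) \<phi>"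
proof (induction n arbitrary: w)
  case 0
  then show ?case by (auto simp: RV_0)
next
  case (Suc n)
  let ?R = "RV T n" and ?y = "transpose (elem (RV T n)) *v w"
  have R: "iem ?R" "generic_ends ?R" "RV T (Suc n) = step ?R"
    using RV_iem[OF T] RV_generic[OF T] RV_Suc[OF T] by auto
  have w: "psum (pi_b (step ?R)) (($) w) \<alpha> = psum (pi_t (step ?R)) (($) w) \<alpha>" for \<alpha>
    using Suc.prems kernel_psum[OF iem_step[OF R(1,2)]] R(3) by simp
  have "Omega ?R *v ?y = 0"
    unfolding kernel_psum[OF R(1)] transpose_elem_fun[OF R(1)] using kernel_step(1)[OF R(1,2) w] by simp
  then obtain w0 where w0: "Omega T *v w0 = 0" "bracket ?R (($) ?y) (SB T n \<phi>) = bracket T (($) w0) \<phi>"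
    using Suc.IH by blast
  moreover have "bracket (RV T (Suc n)) (($) w) (SB T (Suc n) \<phi>) = bracket ?R (($) ?y) (SB T n \<phi>)"
    unfolding R(3) SB.simps transpose_elem_fun[OF R(1)] by (rule bracket_step[OF R(1,2) w])
  ultimately show ?case by metis
qed

section \<open>Cycles of \<open>sigma\<close> and the boundary operator\<close>

lemma sum_over_letters:
  assumes "letters_bij (p :: 'a::finite \<Rightarrow> nat)"
  shows "(\<Sum>\<alpha>\<in>UNIV. f (p \<alpha>)) = (\<Sum>i=1..CARD('a). f i)"
  using assms by (intro sum.reindex_bij_betw) (simp add: letters_bij_def)

lemma sum_boundary_values:
  fixes T :: "'a::finite iem" and h :: "nat \<Rightarrow> real"
  assumes T: "iem T"
  shows "(\<Sum>i\<le>CARD('a). h i * (val_left T \<phi> i - val_right T \<phi> i)) =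
    (\<Sum>\<alpha>\<in>UNIV. h (pi_t T \<alpha>) * \<phi> \<alpha> (lt T \<alpha> + len T \<alpha>) - h (pi_t T \<alpha> - 1) * \<phi> \<alpha> (lt T \<alpha>))"
proof -
  let ?d = "CARD('a)"
  note bij = iem_bij(1)[OF T]
  have nz: "pi_t T \<alpha> \<noteq> 0" for \<alpha> using letters_bij_range[OF bij, of \<alpha>] by linarith
  have "(\<Sum>\<alpha>\<in>UNIV. h (pi_t T \<alpha>) * \<phi> \<alpha> (lt T \<alpha> + len T \<alpha>)) = (\<Sum>\<alpha>\<in>UNIV. h (pi_t T \<alpha>) * val_left T \<phi> (pi_t T \<alpha>))"
    by (intro sum.cong) (simp_all add: val_left_def letters_bij_inv_app[OF bij] u_pi[OF T] nz)
  also have "\<dots> = (\<Sum>i=1..?d. h i * val_left T \<phi> i)" by (rule sum_over_letters[OF bij])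
  also have "\<dots> = (\<Sum>i\<le>?d. h i * val_left T \<phi> i)"
    by (rule sum.mono_neutral_left) (auto simp: val_left_def)
  finally have 1: "(\<Sum>\<alpha>\<in>UNIV. h (pi_t T \<alpha>) * \<phi> \<alpha> (lt T \<alpha> + len T \<alpha>)) = (\<Sum>i\<le>?d. h i * val_left T \<phi> i)" .
  have "h (pi_t T \<alpha> - 1) * \<phi> \<alpha> (lt T \<alpha>) = h (pi_t T \<alpha> - 1) * val_right T \<phi> (pi_t T \<alpha> - 1)" for \<alpha>
  proof -
    have "pi_t T \<alpha> - 1 + 1 = pi_t T \<alpha>" "pi_t T \<alpha> - 1 \<noteq> ?d" using letters_bij_range[OF bij, of \<alpha>] by linarith+
    then show ?thesis unfolding val_right_def by (simp only: letters_bij_inv_app[OF bij] u_pred[OF T] if_False)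
  qed
  then have "(\<Sum>\<alpha>\<in>UNIV. h (pi_t T \<alpha> - 1) * \<phi> \<alpha> (lt T \<alpha>)) =
      (\<Sum>\<alpha>\<in>UNIV. h (pi_t T \<alpha> - 1) * val_right T \<phi> (pi_t T \<alpha> - 1))" by (intro sum.cong refl)
  also have "\<dots> = (\<Sum>i=1..?d. h (i - 1) * val_right T \<phi> (i - 1))" by (rule sum_over_letters[OF bij])
  also have "\<dots> = (\<Sum>i<?d. h i * val_right T \<phi> i)"
    by (rule sum.reindex_bij_witness[of _ Suc "\<lambda>i. i - 1"]) auto
  also have "\<dots> = (\<Sum>i\<le>?d. h i * val_right T \<phi> i)"
    by (rule sum.mono_neutral_left) (auto simp: val_right_def)
  finally show ?thesis using 1 by (simp add: sum_subtractf right_diff_distrib)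
qed

text \<open>In terms of letters, \<open>sigma\<close> goes from the left end of \<alpha> in the top
  row to its left end in the bottom row, and by \<open>sigma_bottom\<close> from its right end in
  the bottom row to the one in the top row. Invariance along cycles is tested with these two
  rules.\<close>

lemma sigma_top:
  assumes T: "iem (T :: 'a::finite iem)"
  shows "sigma T (U (pi_t T \<alpha> - 1)) = Vsym CARD('a) (pi_b T \<alpha> - 1)"
proof -
  have "pi_t T \<alpha> - 1 < CARD('a)" "pi_t T \<alpha> - 1 + 1 = pi_t T \<alpha>"
    using letters_bij_range[OF iem_bij(1)[OF T], of \<alpha>] by linarith+
  then show ?thesis unfolding sigma_def Let_def symbol.case
    by (simp only: if_True letters_bij_inv_app[OF iem_bij(1)[OF T]])
qed

lemma sigma_bottom:
  assumes T: "iem (T :: 'a::finite iem)"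
  shows "sigma T (Vsym CARD('a) (pi_b T \<alpha>)) = U (pi_t T \<alpha>)"
  using letters_bij_range[OF iem_bij(2)[OF T], of \<alpha>] letters_bij_inv_app[OF iem_bij(2)[OF T], of \<alpha>]
  by (auto simp: sigma_def Vsym_def Let_def)

lemma symbols_cases:
  assumes T: "iem (T :: 'a::finite iem)" and s: "s \<in> symbols CARD('a)"
  obtains \<alpha> where "s = U (pi_t T \<alpha> - 1)" | \<alpha> where "s = Vsym CARD('a) (pi_b T \<alpha>)"
proof -
  have top: "\<exists>\<alpha>. U i = U (pi_t T \<alpha> - 1)" if "i < CARD('a)" for i
    using letters_bij_inv[OF iem_bij(1)[OF T], of "Suc i"] that by (intro exI[of _ "inv (pi_t T) (Suc i)"]) simp
  have bot: "\<exists>\<alpha>. Vsym CARD('a) j = Vsym CARD('a) (pi_b T \<alpha>)" if "1 \<le> j" "j \<le> CARD('a)" for j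
    using letters_bij_inv[OF iem_bij(2)[OF T], of j] that by (intro exI[of _ "inv (pi_b T) j"]) simp
  have d: "U CARD('a) = Vsym CARD('a) CARD('a)" "Vsym CARD('a) 0 = U 0" by (auto simp: Vsym_def)
  have "(\<exists>i<CARD('a). s = U i) \<or> (\<exists>j. 1 \<le> j \<and> j \<le> CARD('a) \<and> s = Vsym CARD('a) j)"
  proof (cases "s \<in> U ` {0..CARD('a)}")
    case True
    then obtain i where i: "s = U i" "i \<le> CARD('a)" by auto
    then show ?thesis using d(1) zero_less_card_finite[where 'a='a]
      by (cases "i = CARD('a)") (auto intro!: exI[of _ "CARD('a)"] simp: Suc_le_eq)
  next
    case False
    then obtain j where j: "s = Vsym CARD('a) j" "j \<le> CARD('a)" using s by (auto simp: symbols_def)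
    show ?thesis
    proof (cases "j = 0")
      case True
      then show ?thesis using j d(2) zero_less_card_finite[where 'a='a] by (intro disjI1 exI[of _ 0]) auto
    next
      case False
      then show ?thesis using j by (intro disjI2 exI[of _ j]) auto
    qed
  qed
  then show thesis using that top bot by metis
qed

lemma Vsym_symbols: "j \<le> d \<Longrightarrow> Vsym d j \<in> symbols d"
  and U_symbols: "i \<le> d \<Longrightarrow> U i \<in> symbols d"
  by (auto simp: symbols_def)

lemma sigma_permutes:
  assumes T: "iem (T :: 'a::finite iem)"
  shows "sigma T permutes symbols CARD('a)"
proof (rule bij_imp_permutes)
  let ?S = "symbols CARD('a)"
  have fin: "finite ?S" by (simp add: symbols_def)
  note rt = letters_bij_range[OF iem_bij(1)[OF T]] and rb = letters_bij_range[OF iem_bij(2)[OF T]]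
  have into: "sigma T ` ?S \<subseteq> ?S"
  proof (rule image_subsetI)
    fix s assume "s \<in> ?S"
    with T show "sigma T s \<in> ?S"
    proof (cases rule: symbols_cases)
      case (1 \<alpha>)
      have "pi_b T \<alpha> - 1 \<le> CARD('a)" using rb[of \<alpha>] by linarith
      then show ?thesis unfolding 1 sigma_top[OF T] by (rule Vsym_symbols)
    next
      case (2 \<alpha>)
      then show ?thesis using rt[of \<alpha>] by (simp only: sigma_bottom[OF T] U_symbols)
    qed
  qed
  have U: "U i \<in> sigma T ` ?S" if i: "1 \<le> i" "i \<le> CARD('a)" for i
  proof -
    have "pi_t T (inv (pi_t T) i) = i" by (rule letters_bij_inv[OF iem_bij(1)[OF T] i])
    then have "U i = sigma T (Vsym CARD('a) (pi_b T (inv (pi_t T) i)))" by (simp only: sigma_bottom[OF T])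
    then show ?thesis using rb Vsym_symbols by blast
  qed
  have V: "Vsym CARD('a) j \<in> sigma T ` ?S" if j: "j < CARD('a)" for j
  proof -
    let ?\<alpha> = "inv (pi_b T) (Suc j)"
    have "pi_b T ?\<alpha> = Suc j" by (rule letters_bij_inv[OF iem_bij(2)[OF T]]) (use j in auto)
    then have "Vsym CARD('a) j = sigma T (U (pi_t T ?\<alpha> - 1))" by (simp add: sigma_top[OF T, unfolded One_nat_def])
    moreover have "U (pi_t T ?\<alpha> - 1) \<in> ?S" using rt[of ?\<alpha>] by (intro U_symbols) linarith
    ultimately show ?thesis by blast
  qed
  have "?S \<subseteq> sigma T ` ?S"
  proof
    fix s assume "s \<in> ?S"
    then consider i where "s = U i" "i \<le> CARD('a)" | j where "s = Vsym CARD('a) j" "j \<le> CARD('a)"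
      by (auto simp: symbols_def)
    then show "s \<in> sigma T ` ?S"
    proof cases
      case (1 i)
      then show ?thesis using U[of i] V[of 0] by (cases "i = 0") (auto simp: Vsym_def)
    next
      case (2 j)
      then show ?thesis using U[of j] V[of j] by (cases "j = CARD('a)") (auto simp: Vsym_def)
    qed
  qed
  then have eq: "sigma T ` ?S = ?S" using into by blast
  then have "inj_on (sigma T) ?S" using fin by (intro eq_card_imp_inj_on) auto
  then show "bij_betw (sigma T) ?S ?S" using eq by (simp add: bij_betw_def)
  fix s assume s: "s \<notin> ?S"
  show "sigma T s = s"
  proof (cases s)
    case (U i)
    then have "\<not> i \<le> CARD('a)" using s by (auto simp: symbols_def)
    then show ?thesis using U by (simp add: sigma_def Let_def)
  next
    case (V j)
    then have "\<not> (0 < j \<and> j < CARD('a))"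
      using s Vsym_symbols[of j "CARD('a)"] by (auto simp: Vsym_def)
    then show ?thesis using V by (auto simp: sigma_def Let_def)
  qed
qed

lemma cycles_sigma_iff:
  assumes T: "iem (T :: 'a::finite iem)" and C: "C \<in> cycles T"
  shows "sigma T s \<in> C \<longleftrightarrow> s \<in> C"
proof -
  have fin: "finite (symbols CARD('a))" by (simp add: symbols_def)
  obtain x where x: "C = orbit (sigma T) x" using C by (auto simp: cycles_def)
  have cyc: "cyclic_on (sigma T) C" unfolding x by (rule cyclic_on_orbit[OF sigma_permutes[OF T] fin])
  show ?thesis using cyclic_on_f_in[OF sigma_permutes[OF T] cyc] cyclic_on_inI[OF cyc] by blast
qed

lemma cycle_eq:
  assumes T: "iem (T :: 'a::finite iem)" and C: "C \<in> cycles T"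
  shows "s \<in> C \<longleftrightarrow> orbit (sigma T) s = C"
proof -
  have fin: "finite (symbols CARD('a))" by (simp add: symbols_def)
  have perm: "permutation (sigma T)" using sigma_permutes[OF T] fin by (auto simp: permutation_permutes)
  obtain x where x: "C = orbit (sigma T) x" using C by (auto simp: cycles_def)
  show ?thesis using cyclic_on_orbit'[OF perm, of x] permutation_self_in_orbit[OF perm, of s]
    unfolding x cyclic_on_alldef by blast
qed

lemma invariant_on_orbit:
  assumes T: "iem (T :: 'a::finite iem)" and F: "\<And>s. s \<in> symbols CARD('a) \<Longrightarrow> F (sigma T s) = F s"
    and s: "s \<in> symbols CARD('a)" and t: "t \<in> orbit (sigma T) s"
  shows "F t = F s"
proof -
  have "t \<in> symbols CARD('a) \<and> F t = F s" using t
  proof induction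
    case base
    then show ?case using F[OF s] s permutes_in_image[OF sigma_permutes[OF T]] by simp
  next
    case (step t)
    then show ?case using F permutes_in_image[OF sigma_permutes[OF T]] by simp
  qed
  then show ?thesis ..
qed

text \<open>F attaches to each symbol the partial sum of w up to that point. Membership in the
  kernel says that F is invariant under \<open>sigma\<close>, hence constant on each cycle; grouping
  the end points by cycles writes the bracket as a combination of components of the
  boundary.\<close>

lemma bracket_boundary_zero:
  fixes T :: "'a::finite iem"
  assumes T: "iem T" and \<phi>: "\<And>C. C \<in> cycles T \<Longrightarrow> boundary T \<phi> C = 0"
    and w: "\<And>\<alpha>. psum (pi_b T) w \<alpha> = psum (pi_t T) w \<alpha>"
  shows "bracket T w \<phi> = 0"
proof -
  let ?d = "CARD('a)"
  define F where "F s = (case s of U i \<Rightarrow> \<Sum>\<alpha> | pi_t T \<alpha> \<le> i. w \<alpha> | V j \<Rightarrow> \<Sum>\<alpha> | pi_b T \<alpha> \<le> j. w \<alpha>)" for s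
  have U1: "F (U (pi_t T \<alpha>)) = psum (pi_t T) w \<alpha> + w \<alpha>" for \<alpha>
    using sum_le_psum[OF iem_bij(1)[OF T]] by (simp add: F_def)
  have U0: "F (U (pi_t T \<alpha> - 1)) = psum (pi_t T) w \<alpha>" for \<alpha>
  proof -
    have "\<And>\<beta>. pi_t T \<beta> \<le> pi_t T \<alpha> - 1 \<longleftrightarrow> pi_t T \<beta> < pi_t T \<alpha>"
      using letters_bij_range[OF iem_bij(1)[OF T], of \<alpha>] by auto
    then show ?thesis by (simp add: F_def psum_def)
  qed
  have F_V: "F (Vsym ?d j) = (\<Sum>\<alpha> | pi_b T \<alpha> \<le> j. w \<alpha>)" for j
  proof -
    have *: "\<not> pi_t T \<alpha> \<le> 0" "\<not> pi_b T \<alpha> \<le> 0" "pi_t T \<alpha> \<le> ?d" "pi_b T \<alpha> \<le> ?d" for \<alpha>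
      using letters_bij_range[OF iem_bij(1)[OF T], of \<alpha>] letters_bij_range[OF iem_bij(2)[OF T], of \<alpha>] by linarith+
    have "(\<Sum>\<alpha> | pi_t T \<alpha> \<le> 0. w \<alpha>) = (\<Sum>\<alpha> | pi_b T \<alpha> \<le> 0. w \<alpha>)"
      using *(1,2) by (intro sum.cong) blast+
    then show ?thesis using *(3,4) unfolding F_def Vsym_def by (cases "j = 0"; cases "j = ?d") simp_all
  qed
  have V1: "F (Vsym ?d (pi_b T \<alpha>)) = psum (pi_b T) w \<alpha> + w \<alpha>" for \<alpha>
    using sum_le_psum[OF iem_bij(2)[OF T]] by (simp add: F_V)
  have V0: "F (Vsym ?d (pi_b T \<alpha> - 1)) = psum (pi_b T) w \<alpha>" for \<alpha>
  proof -
    have "\<And>\<beta>. pi_b T \<beta> \<le> pi_b T \<alpha> - 1 \<longleftrightarrow> pi_b T \<beta> < pi_b T \<alpha>"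
      using letters_bij_range[OF iem_bij(2)[OF T], of \<alpha>] by auto
    then show ?thesis by (simp add: F_V psum_def)
  qed
  have inv: "F (sigma T s) = F s" if s: "s \<in> symbols ?d" for s
    using T s
  proof (cases rule: symbols_cases)
    case (1 \<alpha>)
    then show ?thesis by (simp only: sigma_top[OF T] U0 V0 w)
  next
    case (2 \<alpha>)
    then show ?thesis by (simp only: sigma_bottom[OF T] U1 V1 w)
  qed
  let ?D = "\<lambda>i. val_left T \<phi> i - val_right T \<phi> i"
  have "bracket T w \<phi> = (\<Sum>i\<le>?d. F (U i) * ?D i)"
    unfolding sum_boundary_values[OF T, of "\<lambda>i. F (U i)"] bracket_def U0 U1 ..
  also have "\<dots> = (\<Sum>C\<in>cycles T. \<Sum>i\<in>{i\<in>{..?d}. orbit (sigma T) (U i) = C}. F (U i) * ?D i)"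
    by (rule sum.group[symmetric]) (auto simp: cycles_def symbols_def)
  also have "\<dots> = (\<Sum>C\<in>cycles T. 0)"
  proof (rule sum.cong)
    fix C assume C: "C \<in> cycles T"
    then obtain x where x: "x \<in> symbols ?d" "C = orbit (sigma T) x" by (auto simp: cycles_def)
    have "(\<Sum>i\<in>{i\<in>{..?d}. orbit (sigma T) (U i) = C}. F (U i) * ?D i) = (\<Sum>i | i \<le> ?d \<and> U i \<in> C. F x * ?D i)"
    proof (rule sum.cong)
      have "F t = F x" if "t \<in> C" for t
        using invariant_on_orbit[where F = F, OF T _ x(1)] inv that x(2) by blast
      then show "F (U i) * ?D i = F x * ?D i" if "i \<in> {i. i \<le> ?d \<and> U i \<in> C}" for i using that by simp
    qed (use cycle_eq[OF T C] in auto)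
    also have "\<dots> = F x * boundary T \<phi> C" by (simp add: boundary_def sum_distrib_left)
    finally show "(\<Sum>i\<in>{i\<in>{..?d}. orbit (sigma T) (U i) = C}. F (U i) * ?D i) = 0" using \<phi>[OF C] by simp
  qed simp
  finally show ?thesis by simp
qed

lemma psum_telescope:
  assumes p: "letters_bij (p :: 'a::finite \<Rightarrow> nat)"
  shows "psum p (\<lambda>\<beta>. h (p \<beta>) - h (p \<beta> - 1)) \<alpha> = h (p \<alpha> - 1) - (h 0 :: real)"
proof -
  let ?n = "p \<alpha> - 1"
  have "psum p (\<lambda>\<beta>. h (p \<beta>) - h (p \<beta> - 1)) \<alpha> = (\<Sum>\<beta>\<in>UNIV. if p \<beta> < p \<alpha> then h (p \<beta>) - h (p \<beta> - 1) else 0)"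
    by (simp add: psum_def sum.If_cases)
  also have "\<dots> = (\<Sum>i=1..CARD('a). if i < p \<alpha> then h i - h (i - 1) else 0)"
    by (rule sum_over_letters[OF p, of "\<lambda>i. if i < p \<alpha> then h i - h (i - 1) else 0"])
  also have "\<dots> = (\<Sum>i\<in>{i \<in> {1..CARD('a)}. i < p \<alpha>}. h i - h (i - 1))"
    by (rule sum.inter_filter[symmetric]) simp
  also have "\<dots> = (\<Sum>i<?n. h (Suc i) - h i)"
    using letters_bij_range[OF p, of \<alpha>]
    by (intro sum.reindex_bij_witness[of _ Suc "\<lambda>i. i - 1"]) auto
  also have "\<dots> = h ?n - h 0" by (rule sum_lessThan_telescope)
  finally show ?thesis .
qed

text \<open>The component of the boundary along C is the scalar product with a vector n, the
  increments of the indicator of C. Since C is invariant under \<open>sigma\<close>, these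
  increments are the same along both rows, so n lies in the kernel of \<open>Omega\<close>, which is
  orthogonal to its image by antisymmetry.\<close>

lemma range_Omega_subset_Gamma_bd:
  fixes T :: "'a::finite iem"
  assumes T: "iem T"
  shows "Omega T *v x \<in> Gamma_bd T"
  unfolding Gamma_bd_def
proof (intro CollectI ballI)
  fix C assume C: "C \<in> cycles T"
  let ?d = "CARD('a)"
  define h where "h i = (if U i \<in> C then 1 else (0::real))" for i
  define hb where "hb j = (if Vsym ?d j \<in> C then 1 else (0::real))" for j
  define n :: "real^'a" where "n = (\<chi> \<alpha>. h (pi_t T \<alpha>) - h (pi_t T \<alpha> - 1))"
  have hb: "hb (pi_b T \<alpha>) = h (pi_t T \<alpha>)" "hb (pi_b T \<alpha> - 1) = h (pi_t T \<alpha> - 1)" for \<alpha>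
    unfolding h_def hb_def
    using cycles_sigma_iff[OF T C, of "Vsym ?d (pi_b T \<alpha>)"] cycles_sigma_iff[OF T C, of "U (pi_t T \<alpha> - 1)"]
    by (simp_all only: sigma_top[OF T] sigma_bottom[OF T])
  have "h 0 = hb 0" by (simp add: h_def hb_def Vsym_def)
  have nt: "($) n = (\<lambda>\<alpha>. h (pi_t T \<alpha>) - h (pi_t T \<alpha> - 1))" by (auto simp: n_def)
  have nb: "($) n = (\<lambda>\<alpha>. hb (pi_b T \<alpha>) - hb (pi_b T \<alpha> - 1))" unfolding hb by (rule nt)
  have "psum (pi_b T) (($) n) \<alpha> = psum (pi_t T) (($) n) \<alpha>" for \<alpha>
  proof -
    have "psum (pi_b T) (($) n) \<alpha> = hb (pi_b T \<alpha> - 1) - hb 0"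
      unfolding nb by (rule psum_telescope[OF iem_bij(2)[OF T]])
    also have "\<dots> = h (pi_t T \<alpha> - 1) - h 0" using hb \<open>h 0 = hb 0\<close> by simp
    also have "\<dots> = psum (pi_t T) (($) n) \<alpha>"
      unfolding nt by (rule psum_telescope[OF iem_bij(1)[OF T], symmetric])
    finally show ?thesis .
  qed
  then have "Omega T *v n = 0" by (simp add: kernel_psum[OF T])
  then have "n v* Omega T = 0"
    by (metis Omega_antisym matrix_minus_vec neg_equal_0_iff_equal transpose_matrix_vector
        transpose_transpose vector_transpose_matrix)
  then have orth: "n \<bullet> (Omega T *v x) = 0" by (metis dot_lmul_matrix inner_zero_left)
  let ?\<phi> = "of_Gamma (Omega T *v x)"
  have "boundary T ?\<phi> C = (\<Sum>i\<le>?d. h i * (val_left T ?\<phi> i - val_right T ?\<phi> i))"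
    unfolding boundary_def h_def by (rule sum.mono_neutral_cong_left) auto
  also have "\<dots> = n \<bullet> (Omega T *v x)"
    unfolding sum_boundary_values[OF T] by (simp add: of_Gamma_def n_def inner_vec_def algebra_simps)
  finally show "boundary T ?\<phi> C = 0" using orth by simp
qed

text \<open>The link between the two descriptions: on constants the partial sums cancel, so a zero
  bracket is orthogonality to a kernel vector.\<close>

lemma bracket_Gamma: "bracket T (($) w) (of_Gamma c) = w \<bullet> c"
  by (simp add: bracket_def of_Gamma_def inner_vec_def algebra_simps)

lemma mem_range_matrix_iff:
  fixes A :: "real^'n^'m"
  shows "c \<in> range ((*v) A) \<longleftrightarrow> (\<forall>w. transpose A *v w = 0 \<longrightarrow> w \<bullet> c = 0)"
proof -
  have sub: "subspace (range ((*v) A))"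
    by (intro linear_subspace_image matrix_vector_mul_linear subspace_UNIV)
  have "(range ((*v) A))\<^sup>\<bottom> = ((*v) (transpose A)) -` {0}"
    using ker_orthogonal_comp_adjoint[OF matrix_vector_mul_linear, of "transpose A"]
    unfolding adjoint_matrix transpose_transpose by (rule sym)
  then have "range ((*v) A) = (((*v) (transpose A)) -` {0})\<^sup>\<bottom>" using orthogonal_comp_self[OF sub] by simp
  then show ?thesis by (auto simp: orthogonal_comp_def orthogonal_def)
qed

lemma mem_range_Omega_iff: "c \<in> range ((*v) (Omega T)) \<longleftrightarrow> (\<forall>w. Omega T *v w = 0 \<longrightarrow> w \<bullet> c = 0)"
  unfolding mem_range_matrix_iff Omega_antisym by (simp add: matrix_minus_vec)

lemma Gamma_bd_eq_range_Omega:
  assumes T: "iem T"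
  shows "Gamma_bd T = range ((*v) (Omega T))"
proof
  show "range ((*v) (Omega T)) \<subseteq> Gamma_bd T" using range_Omega_subset_Gamma_bd[OF T] by blast
  show "Gamma_bd T \<subseteq> range ((*v) (Omega T))"
  proof
    fix c assume c: "c \<in> Gamma_bd T"
    show "c \<in> range ((*v) (Omega T))"
      unfolding mem_range_Omega_iff
    proof (intro allI impI)
      fix w assume "Omega T *v w = 0"
      then show "w \<bullet> c = 0"
        using bracket_boundary_zero[OF T, of "of_Gamma c" "($) w"] c
        by (simp add: kernel_psum[OF T] Gamma_bd_def bracket_Gamma)
    qed
  qed
qed

section \<open>Growth along the algorithm\<close>


declare accel.simps(2) [simp del]

section \<open>Norm inequalities for matrices and vectors\<close>

lemma row_sum_le_mat_norm: "(\<Sum>\<beta>\<in>UNIV. \<bar>M $ \<alpha> $ \<beta>\<bar>) \<le> mat_norm (M :: real^'a::finite^'a)"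
  unfolding mat_norm_def by (rule Max_ge) auto

lemma mat_norm_leI: "(\<And>\<alpha>. (\<Sum>\<beta>\<in>UNIV. \<bar>M $ \<alpha> $ \<beta>\<bar>) \<le> K) \<Longrightarrow> mat_norm (M :: real^'a::finite^'a) \<le> K"
  unfolding mat_norm_def by (rule Max.boundedI) auto

lemma mat_norm_attained: "\<exists>\<alpha>. mat_norm (M :: real^'a::finite^'a) = (\<Sum>\<beta>\<in>UNIV. \<bar>M $ \<alpha> $ \<beta>\<bar>)"
proof -
  have "mat_norm M \<in> range (\<lambda>\<alpha>. \<Sum>\<beta>\<in>UNIV. \<bar>M $ \<alpha> $ \<beta>\<bar>)" unfolding mat_norm_def by (rule Max_in) auto
  then show ?thesis by auto
qed

lemma mat_norm_nonneg: "0 \<le> mat_norm (M :: real^'a::finite^'a)"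
  by (rule order_trans[OF _ row_sum_le_mat_norm]) (simp add: sum_nonneg)

lemma mat_norm_mult: "mat_norm (A ** X) \<le> mat_norm A * mat_norm (X :: real^'a::finite^'a)"
proof (rule mat_norm_leI)
  fix \<alpha>
  have "(\<Sum>\<beta>\<in>UNIV. \<bar>(A ** X) $ \<alpha> $ \<beta>\<bar>) \<le> (\<Sum>\<beta>\<in>UNIV. \<Sum>\<gamma>\<in>UNIV. \<bar>A $ \<alpha> $ \<gamma>\<bar> * \<bar>X $ \<gamma> $ \<beta>\<bar>)"
    unfolding matrix_matrix_mult_def by (intro sum_mono) (auto simp: abs_mult[symmetric] intro: sum_abs)
  also have "\<dots> = (\<Sum>\<gamma>\<in>UNIV. \<bar>A $ \<alpha> $ \<gamma>\<bar> * (\<Sum>\<beta>\<in>UNIV. \<bar>X $ \<gamma> $ \<beta>\<bar>))"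
    by (subst sum.swap) (simp add: sum_distrib_left)
  also have "\<dots> \<le> (\<Sum>\<gamma>\<in>UNIV. \<bar>A $ \<alpha> $ \<gamma>\<bar> * mat_norm X)"
    by (intro sum_mono mult_left_mono row_sum_le_mat_norm) auto
  also have "\<dots> \<le> mat_norm A * mat_norm X"
    by (simp add: sum_distrib_right[symmetric] mult_right_mono row_sum_le_mat_norm mat_norm_nonneg)
  finally show "(\<Sum>\<beta>\<in>UNIV. \<bar>(A ** X) $ \<alpha> $ \<beta>\<bar>) \<le> mat_norm A * mat_norm X" .
qed

lemma abs_entry_le_mat_norm: "\<bar>M $ \<alpha> $ \<beta>\<bar> \<le> mat_norm (M :: real^'a::finite^'a)"
  by (rule order_trans[OF _ row_sum_le_mat_norm[of M \<alpha>]]) (rule member_le_sum, auto)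

lemma norm_vec_le: "(\<And>\<alpha>. \<bar>x $ \<alpha>\<bar> \<le> K) \<Longrightarrow> norm (x :: real^'a::finite) \<le> real CARD('a) * K"
  using norm_le_l1_cart[of x] sum_bounded_above[of UNIV "\<lambda>\<alpha>. \<bar>x $ \<alpha>\<bar>" K] by simp

lemma abs_mat_vec_le: "\<bar>(M *v x) $ \<alpha>\<bar> \<le> mat_norm M * infnorm (x :: real^'a::finite)"
proof -
  have "\<bar>(M *v x) $ \<alpha>\<bar> \<le> (\<Sum>\<beta>\<in>UNIV. \<bar>M $ \<alpha> $ \<beta>\<bar> * infnorm x)"
    unfolding matrix_vector_mult_def
    by (auto simp: abs_mult intro!: order_trans[OF sum_abs] sum_mono mult_left_mono component_le_infnorm_cart)
  also have "\<dots> \<le> mat_norm M * infnorm x"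
    by (simp add: sum_distrib_right[symmetric] mult_right_mono row_sum_le_mat_norm infnorm_pos_le)
  finally show ?thesis .
qed

lemma infnorm_leI: "(\<And>\<alpha>. \<bar>x $ \<alpha>\<bar> \<le> K) \<Longrightarrow> infnorm (x :: real^'a::finite) \<le> K"
  unfolding infnorm_cart by (rule cSup_least) auto

lemma infnorm_mat_vec_le: "infnorm (M *v x) \<le> mat_norm M * infnorm (x :: real^'a::finite)"
  by (rule infnorm_leI) (rule abs_mat_vec_le)

lemma norm_mat_vec_le: "norm (M *v x) \<le> real CARD('a) * mat_norm M * norm (x :: real^'a::finite)"
proof -
  have "norm (M *v x) \<le> real CARD('a) * (mat_norm M * infnorm x)" by (rule norm_vec_le) (rule abs_mat_vec_le)
  also have "\<dots> \<le> real CARD('a) * (mat_norm M * norm x)"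
    by (intro mult_left_mono infnorm_le_norm mat_norm_nonneg) auto
  finally show ?thesis by (simp add: mult.assoc)
qed

lemma norm_le_card_infnorm: "norm (x :: real^'a::finite) \<le> real CARD('a) * infnorm x"
  by (rule norm_vec_le) (rule component_le_infnorm_cart)

lemma norm_transpose_vec_le:
  "norm (transpose M *v x) \<le> real CARD('a) ^ 2 * mat_norm M * norm (x :: real^'a::finite)"
proof -
  have "\<bar>(transpose M *v x) $ \<alpha>\<bar> \<le> real CARD('a) * (mat_norm M * norm x)" for \<alpha>
  proof -
    have "\<bar>(transpose M *v x) $ \<alpha>\<bar> \<le> (\<Sum>\<beta>\<in>UNIV. \<bar>M $ \<beta> $ \<alpha>\<bar> * \<bar>x $ \<beta>\<bar>)"
      unfolding matrix_vector_mult_def transpose_def by (auto simp: abs_mult[symmetric] intro: sum_abs)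
    also have "\<dots> \<le> (\<Sum>\<beta>\<in>(UNIV::'a set). mat_norm M * norm x)"
      by (intro sum_mono mult_mono abs_entry_le_mat_norm component_le_norm_cart mat_norm_nonneg) auto
    finally show ?thesis by simp
  qed
  from norm_vec_le[OF this] show ?thesis by (simp add: power2_eq_square mult.assoc)
qed

lemma one_le_mult_real: "1 \<le> x \<Longrightarrow> 1 \<le> y \<Longrightarrow> 1 \<le> x * (y::real)"
  using mult_mono[of 1 x 1 y] by simp

definition rv_norm :: "'a::finite iem \<Rightarrow> nat \<Rightarrow> real" where
  "rv_norm T n = mat_norm (KZ T n)"

text \<open>The entries are nonnegative, so a row sum is the image of the constant 1. Consequently
  \<open>rv_norm\<close> is the largest tower height.\<close>

lemma row_sum_KZ:
  assumes T: "iem (T :: 'a::finite iem)" "no_connection T"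
  shows "(\<Sum>\<beta>\<in>UNIV. \<bar>KZ T n $ \<alpha> $ \<beta>\<bar>) = real (hgt T n \<alpha>)"
  unfolding KZ_hgt[OF T, symmetric] matrix_vector_mult_def
  using KZ_nonneg[OF T] by (auto intro!: sum.cong simp: abs_of_nonneg)

lemma hgt_le_rv_norm:
  assumes T: "iem (T :: 'a::finite iem)" "no_connection T" shows "real (hgt T n \<alpha>) \<le> rv_norm T n"
  using row_sum_le_mat_norm[of "KZ T n" \<alpha>] row_sum_KZ[OF T] by (simp add: rv_norm_def)

lemma rv_norm_attained:
  assumes T: "iem (T :: 'a::finite iem)" "no_connection T" shows "\<exists>\<alpha>. rv_norm T n = real (hgt T n \<alpha>)"
  using mat_norm_attained[of "KZ T n"] row_sum_KZ[OF T] by (simp add: rv_norm_def)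

lemma rv_norm_ge_1:
  assumes T: "iem (T :: 'a::finite iem)" "no_connection T" shows "1 \<le> rv_norm T n"
  using hgt_le_rv_norm[OF T, of n undefined] hgt_pos[of T n undefined] by linarith

lemma hgt_le:
  assumes "m \<le> n" shows "hgt T m \<alpha> \<le> hgt T n \<alpha>"
  using assms by (induction n rule: dec_induct) (auto intro: order_trans)

lemma rv_norm_mono:
  assumes T: "iem (T :: 'a::finite iem)" "no_connection T" and "m \<le> n" shows "rv_norm T m \<le> rv_norm T n"
proof -
  obtain \<alpha> where "rv_norm T m = real (hgt T m \<alpha>)" using rv_norm_attained[OF T] by blast
  then show ?thesis using hgt_le[OF assms(3), of T \<alpha>] hgt_le_rv_norm[OF T, of n \<alpha>] by linarith
qed

lemma rv_norm_0: "iem T \<Longrightarrow> no_connection T \<Longrightarrow> rv_norm (T :: 'a::finite iem) 0 = 1"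
  using rv_norm_attained[of T 0] by auto

lemma rv_norm_split:
  assumes "m \<le> n" shows "rv_norm T n \<le> rv_norm (RV T m) (n - m) * rv_norm T m"
  using mat_norm_mult[of "KZ (RV T m) (n - m)" "KZ T m"] KZ_add[of T m "n - m"] assms
  by (simp add: rv_norm_def)

lemma hgt_split:
  assumes T: "iem (T :: 'a::finite iem)" "no_connection T" and "m \<le> n"
  shows "real (hgt T n \<alpha>) = (\<Sum>\<beta>\<in>UNIV. B T m n $ \<alpha> $ \<beta> * real (hgt T m \<beta>))"
proof -
  have "real (hgt T n \<alpha>) = (KZ (RV T m) (n - m) *v (KZ T m *v 1)) $ \<alpha>"
    using KZ_add[of T m "n - m"] assms(3) by (simp add: KZ_hgt[OF T, symmetric] matrix_vector_mul_assoc)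
  moreover have "KZ T m *v 1 = (\<chi> \<beta>. real (hgt T m \<beta>))" by (simp add: vec_eq_iff KZ_hgt[OF T])
  ultimately show ?thesis by (simp add: B_eq_KZ[OF assms]) (simp add: matrix_vector_mult_def)
qed

text \<open>Every step raises one tower by at least 1, so n is at most the sum of the
  heights.\<close>

lemma steps_le_rv_norm:
  assumes T: "iem (T :: 'a::finite iem)" "no_connection T"
  shows "real n \<le> real CARD('a) * rv_norm T n"
proof -
  have "n \<le> (\<Sum>\<alpha>\<in>UNIV. hgt T n \<alpha>)"
  proof (induction n)
    case (Suc n)
    then show ?case using hgt_pos[of T n "winner (RV T n)"] by (simp add: sum.distrib)
  qed simp
  then have "real n \<le> (\<Sum>\<alpha>\<in>UNIV. real (hgt T n \<alpha>))" by (metis of_nat_mono of_nat_sum)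
  also have "\<dots> \<le> (\<Sum>\<alpha>\<in>(UNIV::'a set). rv_norm T n)" by (intro sum_mono hgt_le_rv_norm[OF T])
  finally show ?thesis by simp
qed

text \<open>As g is positive everywhere, the finitely many exceptional indices only enlarge the
  constant.\<close>

lemma bigo_sequence_bound:
  fixes f g :: "nat \<Rightarrow> real"
  assumes "f \<in> O(g)" "\<And>n. 0 < g n"
  shows "\<exists>C>0. \<forall>n. \<bar>f n\<bar> \<le> C * g n"
proof -
  obtain c where c: "c > 0" "\<forall>\<^sub>F n in sequentially. norm (f n) \<le> c * norm (g n)"
    using landau_o.bigE[OF assms(1)] by blast
  then obtain N where N: "\<And>n. n \<ge> N \<Longrightarrow> \<bar>f n\<bar> \<le> c * g n"
    unfolding eventually_sequentially using assms(2) by (metis abs_of_pos real_norm_def)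
  let ?C = "c + (\<Sum>i<N. \<bar>f i\<bar> / g i)"
  have s: "0 \<le> (\<Sum>i<N. \<bar>f i\<bar> / g i)" using assms(2) by (intro sum_nonneg) (simp add: less_imp_le)
  have "\<bar>f n\<bar> \<le> ?C * g n" for n
  proof (cases "n < N")
    case True
    have "\<bar>f n\<bar> / g n \<le> (\<Sum>i<N. \<bar>f i\<bar> / g i)"
      by (rule member_le_sum) (use True assms(2) in \<open>auto simp: less_imp_le\<close>)
    then have "\<bar>f n\<bar> / g n \<le> ?C" using c(1) by linarith
    then show ?thesis using assms(2)[of n] by (simp add: pos_divide_le_eq)
  next
    case False
    then have "\<bar>f n\<bar> \<le> c * g n" using N by simp
    also have "\<dots> \<le> ?C * g n" using s assms(2)[of n] by (intro mult_right_mono) auto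
    finally show ?thesis .
  qed
  moreover have "0 < ?C" using s c(1) by linarith
  ultimately show ?thesis by blast
qed

lemma linear_le_exponential:
  assumes "(\<tau>::real) > 0"
  shows "\<exists>C>0. \<forall>j::nat. 2 * real j + 1 \<le> C * (2 ^ j) powr \<tau>"
proof -
  define x where "x = 2 powr \<tau> - (1::real)"
  have x: "0 < x" using assms by (simp add: x_def)
  have "2 * real j + 1 \<le> (2 / x + 1) * (2 ^ j) powr \<tau>" for j :: nat
  proof -
    have p: "(2 ^ j) powr \<tau> = (1 + x) ^ j"
      by (simp add: x_def powr_realpow[symmetric] powr_powr mult.commute)
    have "1 + real j * x \<le> (1 + x) ^ j" using x by (intro Bernoulli_inequality) auto
    then have "real j \<le> (1 + x) ^ j / x" "1 \<le> (1 + x) ^ j" using x by (auto simp: field_simps intro: one_le_power)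
    then have "2 * real j + 1 \<le> 2 * ((1 + x) ^ j / x) + (1 + x) ^ j" by linarith
    then show ?thesis unfolding p using x by (simp add: field_simps)
  qed
  then show ?thesis using x by (intro exI[of _ "2 / x + 1"]) (auto intro: add_pos_pos)
qed

section \<open>Consequences of the growth hypothesis along the accelerated times\<close>

context
  fixes T :: "'a::finite iem"
  assumes T: "iem T" "no_connection T"
    and acc: "\<And>\<tau>. \<tau> > 0 \<Longrightarrow>
      (\<lambda>k. mat_norm (B T (accel T k) (accel T (Suc k)))) \<in> O(\<lambda>k. mat_norm (B T 0 (accel T k)) powr \<tau>)"
begin

private abbreviation (input) "a \<equiv> accel T"
private abbreviation (input) "N \<equiv> rv_norm T"
private abbreviation (input) "M k \<equiv> mat_norm (B T (a k) (a (Suc k)))"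

lemma accel_strict_mono: "strict_mono (accel T)"
  by (simp add: strict_mono_Suc_iff accel_props(1)[OF T])

private lemma acc_bound: "\<tau> > 0 \<Longrightarrow> \<exists>C\<ge>1. \<forall>k. M k \<le> C * N (a k) powr \<tau>"
proof -
  assume \<tau>: "\<tau> > 0"
  have "(\<lambda>k. M k) \<in> O(\<lambda>k. N (a k) powr \<tau>)" using acc[OF \<tau>] by (simp add: rv_norm_def B_0_eq_KZ[OF T])
  moreover have pos: "0 < N (a k) powr \<tau>" for k using rv_norm_ge_1[OF T, of "a k"] by simp
  ultimately have "\<exists>C>0. \<forall>k. \<bar>M k\<bar> \<le> C * N (a k) powr \<tau>" by (rule bigo_sequence_bound)
  then obtain C where C: "\<And>k. \<bar>M k\<bar> \<le> C * N (a k) powr \<tau>" by blast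
  have "M k \<le> max C 1 * N (a k) powr \<tau>" for k
  proof -
    have "M k \<le> C * N (a k) powr \<tau>" using C[of k] by linarith
    also have "\<dots> \<le> max C 1 * N (a k) powr \<tau>" using pos[of k] by (intro mult_right_mono) auto
    finally show ?thesis .
  qed
  then show ?thesis by (intro exI[of _ "max C 1"]) auto
qed

private lemma N_Suc: "N (a (Suc k)) \<le> M k * N (a k)"
  using rv_norm_split[of "a k" "a (Suc k)" T] accel_props(1)[OF T, of k] B_eq_KZ[OF T, of "a k" "a (Suc k)"]
  by (simp add: rv_norm_def)

text \<open>With all entries at least 1, each new tower passes through every old one, in particular
  the tallest.\<close>

private lemma hgt_Suc_ge: "N (a k) \<le> real (hgt T (a (Suc k)) \<alpha>)"
proof -
  obtain \<beta> where \<beta>: "N (a k) = real (hgt T (a k) \<beta>)" using rv_norm_attained[OF T] by blast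
  have "real (hgt T (a k) \<beta>) \<le> (\<Sum>\<gamma>\<in>UNIV. real (hgt T (a k) \<gamma>))" by (rule member_le_sum) auto
  also have "\<dots> \<le> (\<Sum>\<gamma>\<in>UNIV. B T (a k) (a (Suc k)) $ \<alpha> $ \<gamma> * real (hgt T (a k) \<gamma>))"
    using mult_right_mono[OF accel_props(2)[OF T, of k \<alpha>]] by (intro sum_mono) force
  also have "\<dots> = real (hgt T (a (Suc k)) \<alpha>)"
    using hgt_split[OF T, of "a k" "a (Suc k)" \<alpha>] accel_props(1)[OF T, of k] by simp
  finally show ?thesis using \<beta> by simp
qed

text \<open>After one accelerated time all the heights reach N(a k); after the next, each tower
  contains all of these, and there are at least two letters.\<close>

private lemma N_double: "2 * N (a k) \<le> N (a (Suc (Suc k)))"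
proof -
  have "2 * N (a k) \<le> real CARD('a) * N (a k)"
    using iem_card[OF T(1)] rv_norm_ge_1[OF T, of "a k"] by (intro mult_right_mono) auto
  also have "\<dots> \<le> (\<Sum>\<gamma>\<in>UNIV. real (hgt T (a (Suc k)) \<gamma>))"
    using sum_bounded_below[of UNIV "N (a k)" "\<lambda>\<gamma>. real (hgt T (a (Suc k)) \<gamma>)"] hgt_Suc_ge by simp
  also have "\<dots> \<le> (\<Sum>\<gamma>\<in>UNIV. B T (a (Suc k)) (a (Suc (Suc k))) $ \<alpha> $ \<gamma> * real (hgt T (a (Suc k)) \<gamma>))" for \<alpha>
    using mult_right_mono[OF accel_props(2)[OF T, of "Suc k" \<alpha>]] by (intro sum_mono) force
  also have "(\<Sum>\<gamma>\<in>UNIV. B T (a (Suc k)) (a (Suc (Suc k))) $ \<alpha> $ \<gamma> * real (hgt T (a (Suc k)) \<gamma>)) \<le> N (a (Suc (Suc k)))" for \<alpha>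
    using hgt_split[OF T, of "a (Suc k)" "a (Suc (Suc k))" \<alpha>] accel_props(1)[OF T, of "Suc k"]
      hgt_le_rv_norm[OF T, of "a (Suc (Suc k))" \<alpha>] by simp
  finally show ?thesis .
qed

private lemma N_exp: "2 ^ (k div 2) \<le> N (a k)"
proof (induction k rule: less_induct)
  case (less k)
  show ?case
  proof (cases "k < 2")
    case True
    then show ?thesis using rv_norm_ge_1[OF T, of "a k"] by simp
  next
    case False
    then obtain j where j: "k = Suc (Suc j)" by (metis add_2_eq_Suc le_add_diff_inverse not_less)
    then show ?thesis using less[of j] N_double[of j] by simp
  qed
qed

private lemma index_bound: "\<tau> > 0 \<Longrightarrow> \<exists>C\<ge>1. \<forall>k. real k \<le> C * N (a k) powr \<tau>"
proof -
  assume \<tau>: "\<tau> > 0"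
  obtain C where C: "C > 0" "\<And>j::nat. 2 * real j + 1 \<le> C * (2 ^ j) powr \<tau>" using linear_le_exponential[OF \<tau>] by blast
  have "real k \<le> max C 1 * N (a k) powr \<tau>" for k
  proof -
    have "real k \<le> 2 * real (k div 2) + 1" by linarith
    also have "\<dots> \<le> C * (2 ^ (k div 2)) powr \<tau>" by (rule C(2))
    also have "\<dots> \<le> max C 1 * N (a k) powr \<tau>"
      using C(1) \<tau> N_exp by (intro mult_mono powr_mono2) auto
    finally show ?thesis .
  qed
  then show ?thesis by (intro exI[of _ "max C 1"]) auto
qed

private lemma gap_bound: "real (a (Suc k)) - real (a k) \<le> real CARD('a) * M k"
  using steps_le_rv_norm[OF RV_iem[OF T, of "a k"] RV_no_connection[OF T, of "a k"], of "a (Suc k) - a k"]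
    B_eq_KZ[OF T, of "a k" "a (Suc k)"] accel_props(1)[OF T, of k]
  by (simp add: rv_norm_def of_nat_diff)

text \<open>One half of \<tau> pays for the number k of blocks, which is logarithmic by
  \<open>N_exp\<close>; the other half pays for the length of a block, bounded by its matrix norm in
  \<open>gap_bound\<close>.\<close>

private lemma accel_bound: "\<tau> > 0 \<Longrightarrow> \<exists>C\<ge>1. \<forall>k. real (a k) \<le> C * N (a k) powr \<tau>"
proof -
  assume \<tau>: "\<tau> > 0"
  obtain C1 where C1: "C1 \<ge> 1" "\<And>k. M k \<le> C1 * N (a k) powr (\<tau>/2)" using acc_bound[of "\<tau>/2"] \<tau> by auto
  obtain C2 where C2: "C2 \<ge> 1" "\<And>k. real k \<le> C2 * N (a k) powr (\<tau>/2)" using index_bound[of "\<tau>/2"] \<tau> by auto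
  let ?D = "real CARD('a)"
  have D: "?D \<ge> 1" using iem_card[OF T(1)] by simp
  have "real (a k) \<le> ?D * C1 * C2 * N (a k) powr \<tau>" for k
  proof -
    have "real (a k) = (\<Sum>i<k. real (a (Suc i)) - real (a i))"
      by (subst sum_lessThan_telescope) simp
    also have "\<dots> \<le> (\<Sum>i<k. ?D * (C1 * N (a k) powr (\<tau>/2)))"
    proof (rule sum_mono)
      fix i assume "i \<in> {..<k}"
      then have "a i \<le> a k" using strict_mono_mono[OF accel_strict_mono] by (auto simp: mono_def)
      then have "N (a i) powr (\<tau>/2) \<le> N (a k) powr (\<tau>/2)"
        using rv_norm_mono[OF T] rv_norm_ge_1[OF T, of "a i"] \<tau> by (intro powr_mono2) auto
      then have "M i \<le> C1 * N (a k) powr (\<tau>/2)" using C1(2)[of i] C1(1) by (meson mult_left_mono order_trans zero_le_one)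
      then have "?D * M i \<le> ?D * (C1 * N (a k) powr (\<tau>/2))" by (intro mult_left_mono) auto
      then show "real (a (Suc i)) - real (a i) \<le> ?D * (C1 * N (a k) powr (\<tau>/2))" using gap_bound[of i] by linarith
    qed
    also have "\<dots> = real k * (?D * (C1 * N (a k) powr (\<tau>/2)))" by simp
    also have "\<dots> \<le> (C2 * N (a k) powr (\<tau>/2)) * (?D * (C1 * N (a k) powr (\<tau>/2)))"
      using C1(1) by (intro mult_right_mono C2(2)) auto
    also have "\<dots> = ?D * C1 * C2 * (N (a k) powr (\<tau>/2) * N (a k) powr (\<tau>/2))" by simp
    also have "N (a k) powr (\<tau>/2) * N (a k) powr (\<tau>/2) = N (a k) powr \<tau>" by (simp add: powr_add[symmetric])
    finally show ?thesis .
  qed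
  moreover have "1 \<le> ?D * C1 * C2" using D C1(1) C2(1) by (intro one_le_mult_real)
  ultimately show ?thesis by blast
qed

private lemma accel_between: "\<exists>k. a k \<le> n \<and> n < a (Suc k)"
proof -
  have "\<exists>k. n < a k" using seq_suble[OF accel_strict_mono, of "Suc n"] by (intro exI[of _ "Suc n"]) linarith
  then obtain k where k: "n < a k" "\<And>j. j < k \<Longrightarrow> \<not> n < a j" using exists_least_iff[of "\<lambda>k. n < a k"] by blast
  then have "k \<noteq> 0" by (cases k) auto
  then obtain j where "k = Suc j" by (cases k) auto
  then show ?thesis using k(1) k(2)[of j] by (intro exI[of _ j]) simp
qed

private lemma N_Suc_square: "\<exists>C\<ge>1. \<forall>k. N (a (Suc k)) \<le> C * N (a k) ^ 2"
proof -
  obtain C where C: "C \<ge> 1" "\<And>k. M k \<le> C * N (a k) powr 1" using acc_bound[of 1] by auto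
  have "N (a (Suc k)) \<le> C * N (a k) ^ 2" for k
  proof -
    have N: "0 < N (a k)" using rv_norm_ge_1[OF T, of "a k"] by simp
    have "N (a (Suc k)) \<le> M k * N (a k)" by (rule N_Suc)
    also have "\<dots> \<le> (C * N (a k)) * N (a k)" using C(2)[of k] N by (intro mult_right_mono) auto
    finally show ?thesis by (simp add: power2_eq_square mult.assoc)
  qed
  then show ?thesis using C(1) by blast
qed

text \<open>Between two accelerated times n is bounded by the later one, whose norm is at most a
  constant times the square of N(n). This is why the exponent \<tau>/2 is used.\<close>

lemma steps_subpolynomial:
  assumes "\<tau> > 0"
  shows "\<exists>C\<ge>1. \<forall>n. real n \<le> C * rv_norm T n powr \<tau>"
proof -
  obtain C where C: "C \<ge> 1" "\<And>k. real (a k) \<le> C * N (a k) powr (\<tau>/2)" using accel_bound[of "\<tau>/2"] assms by auto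
  obtain C' where C': "C' \<ge> 1" "\<And>k. N (a (Suc k)) \<le> C' * N (a k) ^ 2" using N_Suc_square by blast
  have "real n \<le> C * C' powr (\<tau>/2) * N n powr \<tau>" for n
  proof -
    obtain k where k: "a k \<le> n" "n < a (Suc k)" using accel_between by blast
    have N: "1 \<le> N (a k)" "N (a k) \<le> N n" using rv_norm_ge_1[OF T] rv_norm_mono[OF T k(1)] by auto
    have "real n \<le> real (a (Suc k))" using k by simp
    also have "\<dots> \<le> C * N (a (Suc k)) powr (\<tau>/2)" by (rule C(2))
    also have "\<dots> \<le> C * (C' * N (a k) ^ 2) powr (\<tau>/2)"
      using C(1) C'(2)[of k] assms rv_norm_ge_1[OF T, of "a (Suc k)"] by (intro mult_left_mono powr_mono2) auto
    also have "\<dots> \<le> C * (C' * N n ^ 2) powr (\<tau>/2)"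
      using C(1) C'(1) assms N by (intro mult_left_mono powr_mono2 power_mono) auto
    also have "(C' * N n ^ 2) powr (\<tau>/2) = C' powr (\<tau>/2) * N n powr \<tau>"
      using C'(1) N by (simp add: powr_mult powr_powr flip: powr_numeral)
    finally show ?thesis by (simp add: mult.assoc)
  qed
  moreover have "1 \<le> C * C' powr (\<tau>/2)"
    using C(1) ge_one_powr_ge_zero[OF C'(1), of "\<tau>/2"] assms by (intro one_le_mult_real) auto
  ultimately show ?thesis by blast
qed

text \<open>If n lies between the accelerated times k and k + 1, the smallest height is already at
  least the norm at k - 1, while N(n) is at most the norm at k + 1. Two applications of
  \<open>N_Suc_square\<close> give the exponent 4.\<close>

lemma rv_norm_le_hgt_power:
  "\<exists>C\<ge>1. \<forall>n \<alpha>. rv_norm T n \<le> C * real (hgt T n \<alpha>) ^ 4"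
proof -
  obtain C where C: "C \<ge> 1" "\<And>k. N (a (Suc k)) \<le> C * N (a k) ^ 2" using N_Suc_square by blast
  \<comment> \<open>The cube comes from inserting one square bound into the other; the second entry
    covers n before the first positive accelerated time.\<close>
  let ?K = "max (C ^ 3) (N (a (Suc 0)))"
  have "N n \<le> ?K * real (hgt T n \<alpha>) ^ 4" for n \<alpha>
  proof -
    obtain k where k: "a k \<le> n" "n < a (Suc k)" using accel_between by blast
    have h: "1 \<le> real (hgt T n \<alpha>)" using hgt_pos[of T n \<alpha>] by simp
    have Nn: "N n \<le> N (a (Suc k))" using rv_norm_mono[OF T, of n "a (Suc k)"] k by simp
    show ?thesis
    proof (cases k)
      case 0
      have "N n \<le> N (a (Suc 0)) * 1" using Nn 0 by simp
      also have "\<dots> \<le> ?K * real (hgt T n \<alpha>) ^ 4"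
        using h rv_norm_ge_1[OF T, of "a (Suc 0)"] by (intro mult_mono one_le_power) auto
      finally show ?thesis .
    next
      case (Suc j)
      have N: "1 \<le> N (a j)" "1 \<le> N (a (Suc j))" using rv_norm_ge_1[OF T] by auto
      have "N (a j) \<le> real (hgt T n \<alpha>)"
        using hgt_Suc_ge[of j \<alpha>] hgt_le[OF k(1), of T \<alpha>] Suc by simp
      note le = this
      have "N n \<le> C * N (a (Suc j)) ^ 2" using Nn C(2)[of "Suc j"] Suc by simp
      also have "\<dots> \<le> C * (C * N (a j) ^ 2) ^ 2" using C N by (intro mult_left_mono power_mono C(2)) auto
      also have "\<dots> = C ^ 3 * N (a j) ^ 4" by (simp add: power_mult_distrib eval_nat_numeral mult_ac)
      also have "\<dots> \<le> ?K * real (hgt T n \<alpha>) ^ 4" using le N C(1) by (intro mult_mono power_mono) (auto simp: le_max_iff_disj)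
      finally show ?thesis .
    qed
  qed
  moreover have "1 \<le> ?K" using one_le_power[OF C(1), of 3] by simp
  ultimately show ?thesis by blast
qed

end

section \<open>The symplectic structure and duality\<close>


lemma It_closed_nonempty: "iem T \<Longrightarrow> lt T \<alpha> \<in> It_closed T \<alpha>"
  using iem_len[of T \<alpha>] by (simp add: It_closed_eq)

lemma It_closed_compact: "compact (It_closed T \<alpha>)"
  by (simp add: It_closed_def)

lemma nth_deriv_le_C_norm:
  assumes \<phi>: "\<phi> \<in> C_space r T" and k: "k \<le> r" and x: "x \<in> It_closed T \<alpha>"
  shows "\<bar>nth_deriv_within (It_closed T \<alpha>) k (\<phi> \<alpha>) x\<bar> \<le> C_norm r T \<phi>"
proof -
  let ?S = "It_closed T \<alpha>"
  let ?g = "nth_deriv_within ?S k (\<phi> \<alpha>)"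
  have "continuous_on ?S (\<lambda>x. \<bar>?g x\<bar>)"
    using \<phi> k by (auto simp: C_space_def Cr_on_def intro!: continuous_intros)
  then have "bdd_above ((\<lambda>x. \<bar>?g x\<bar>) ` ?S)"
    by (intro bounded_imp_bdd_above compact_imp_bounded compact_continuous_image It_closed_compact)
  then have "\<bar>?g x\<bar> \<le> (SUP x\<in>?S. \<bar>?g x\<bar>)" by (rule cSUP_upper[OF x])
  also have "\<dots> \<le> Cr_norm_on r ?S (\<phi> \<alpha>)" unfolding Cr_norm_on_def by (rule Max_ge) (use k in auto)
  also have "\<dots> \<le> C_norm r T \<phi>" unfolding C_norm_def by (rule Max_ge) auto
  finally show ?thesis .
qed

lemma C1_abs_le:
  assumes "\<phi> \<in> C_space 1 T" "x \<in> It_closed T \<alpha>" shows "\<bar>\<phi> \<alpha> x\<bar> \<le> C_norm 1 T \<phi>"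
  using nth_deriv_le_C_norm[OF assms(1) _ assms(2), of 0] by (simp add: nth_deriv_within_def)

lemma C1_lipschitz:
  assumes \<phi>: "\<phi> \<in> C_space 1 T" and x: "x \<in> It_closed T \<alpha>" and y: "y \<in> It_closed T \<alpha>"
  shows "\<bar>\<phi> \<alpha> x - \<phi> \<alpha> y\<bar> \<le> C_norm 1 T \<phi> * \<bar>x - y\<bar>"
proof -
  let ?S = "It_closed T \<alpha>" and ?D = "\<lambda>x. vector_derivative (\<phi> \<alpha>) (at x within It_closed T \<alpha>)"
  have "norm (\<phi> \<alpha> x - \<phi> \<alpha> y) \<le> C_norm 1 T \<phi> * norm (x - y)"
  proof (rule differentiable_bound[OF _ _ _ x y])
    show "convex ?S" by (simp add: It_closed_def)
    fix z assume z: "z \<in> ?S"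
    have "\<phi> \<alpha> differentiable (at z within ?S)"
      using \<phi> z by (force simp: C_space_def Cr_on_def nth_deriv_within_def)
    then show "(\<phi> \<alpha> has_derivative (\<lambda>h. h *\<^sub>R ?D z)) (at z within ?S)"
      using vector_derivative_works has_vector_derivative_def by blast
    have "\<bar>?D z\<bar> \<le> C_norm 1 T \<phi>"
      using nth_deriv_le_C_norm[OF \<phi> _ z, of 1] by (simp add: nth_deriv_within_def)
    then show "onorm (\<lambda>h. h *\<^sub>R ?D z) \<le> C_norm 1 T \<phi>"
      by (intro onorm_le) (simp add: abs_mult mult.commute mult_left_mono)
  qed
  then show ?thesis by simp
qed

lemma C_norm_nonneg:
  assumes "iem T" "\<phi> \<in> C_space r T" shows "0 \<le> C_norm r T \<phi>"
  using nth_deriv_le_C_norm[OF assms(2) _ It_closed_nonempty[OF assms(1)], of 0]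
  by (meson abs_ge_zero le0 order_trans)

lemma C_norm_0_le:
  assumes T: "iem T" and K: "\<And>\<alpha> x. x \<in> It_closed T \<alpha> \<Longrightarrow> \<bar>\<psi> \<alpha> x\<bar> \<le> K"
  shows "C_norm 0 T \<psi> \<le> K"
proof -
  have "(SUP x\<in>It_closed T \<alpha>. \<bar>\<psi> \<alpha> x\<bar>) \<le> K" for \<alpha>
    by (rule cSUP_least) (use It_closed_nonempty[OF T] K in auto)
  then show ?thesis
    by (auto simp: C_norm_def Cr_norm_on_def nth_deriv_within_def intro!: Max.boundedI)
qed

lemma SB_continuous:
  assumes T: "iem T" "no_connection T"
    and lip: "\<And>\<alpha> x y. x \<in> It_closed T \<alpha> \<Longrightarrow> y \<in> It_closed T \<alpha> \<Longrightarrow> \<bar>\<phi> \<alpha> x - \<phi> \<alpha> y\<bar> \<le> K * \<bar>x - y\<bar>"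
  shows "continuous_on (It_closed (RV T n) \<alpha>) (SB T n \<phi> \<alpha>)"
proof (rule lipschitz_on_continuous_on)
  show "(max 0 (K * real (hgt T n \<alpha>)))-lipschitz_on (It_closed (RV T n) \<alpha>) (SB T n \<phi> \<alpha>)"
  proof (rule lipschitz_onI)
    fix x y assume *: "x \<in> It_closed (RV T n) \<alpha>" "y \<in> It_closed (RV T n) \<alpha>"
    have "\<bar>SB T n \<phi> \<alpha> x - SB T n \<phi> \<alpha> y\<bar> \<le> K * real (hgt T n \<alpha>) * \<bar>x - y\<bar>"
      by (rule SB_lipschitz[OF T lip *])
    also have "\<dots> \<le> max 0 (K * real (hgt T n \<alpha>)) * \<bar>x - y\<bar>" by (intro mult_right_mono) auto
    finally show "dist (SB T n \<phi> \<alpha> x) (SB T n \<phi> \<alpha> y) \<le> max 0 (K * real (hgt T n \<alpha>)) * dist x y"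
      by (simp add: dist_real_def)
  qed simp
qed

lemma SB_near_constant:
  assumes T: "iem T" "no_connection T"
    and lip: "\<And>\<alpha> x y. x \<in> It_closed T \<alpha> \<Longrightarrow> y \<in> It_closed T \<alpha> \<Longrightarrow> \<bar>\<phi> \<alpha> x - \<phi> \<alpha> y\<bar> \<le> K * \<bar>x - y\<bar>"
    and x: "x \<in> It_closed (RV T n) \<alpha>" "y \<in> It_closed (RV T n) \<alpha>" and K: "0 \<le> K"
  shows "\<bar>SB T n \<phi> \<alpha> x - SB T n \<phi> \<alpha> y\<bar> \<le> K * (real (hgt T n \<alpha>) * len (RV T n) \<alpha>)"
proof -
  have "\<bar>SB T n \<phi> \<alpha> x - SB T n \<phi> \<alpha> y\<bar> \<le> K * real (hgt T n \<alpha>) * \<bar>x - y\<bar>"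
    by (rule SB_lipschitz[OF T lip x])
  also have "\<dots> \<le> K * real (hgt T n \<alpha>) * len (RV T n) \<alpha>"
    using x K by (intro mult_left_mono) (auto simp: It_closed_eq[OF RV_iem[OF T]])
  finally show ?thesis by (simp add: mult.assoc)
qed

lemma Omega_inner: "(Omega T *v x) \<bullet> y = - (x \<bullet> (Omega T *v y))"
proof -
  have "x \<bullet> (Omega T *v y) = (transpose (Omega T) *v x) \<bullet> y"
    by (simp add: dot_lmul_matrix)
  also have "\<dots> = - ((Omega T *v x) \<bullet> y)" unfolding Omega_antisym matrix_minus_vec by simp
  finally show ?thesis by simp
qed

text \<open>Freeze the sums at their left end points to get c0, and split c0 = c + w with w
  orthogonal to the image, hence in the kernel. The bracket with w vanishes on the special Birkhoff
  sums by invariance, while on c0 it equals the square of the norm of w. The two differ only through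
  oscillations, which bounds w. In the constant, 1 accounts for the oscillation and d for w.\<close>

lemma special_birkhoff_near_range_Omega:
  fixes T :: "'a::finite iem"
  assumes T: "iem T" "no_connection T" and \<phi>: "\<phi> \<in> C1_0 T"
  shows "\<exists>c \<in> range ((*v) (Omega (RV T n))). \<forall>\<alpha>. \<forall>x\<in>It_closed (RV T n) \<alpha>.
    \<bar>SB T n \<phi> \<alpha> x - c $ \<alpha>\<bar> \<le> (1 + real CARD('a)) * sum (len T) UNIV * C_norm 1 T \<phi>"
proof -
  let ?R = "RV T n" and ?K = "C_norm 1 T \<phi>" and ?L = "sum (len T) UNIV" and ?D = "real CARD('a)"
  have R: "iem ?R" by (rule RV_iem[OF T])
  have \<phi>1: "\<phi> \<in> C_space 1 T" and bd: "\<And>C. C \<in> cycles T \<Longrightarrow> boundary T \<phi> C = 0"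
    using \<phi> by (auto simp: C1_0_def)
  have K: "0 \<le> ?K" by (rule C_norm_nonneg[OF T(1) \<phi>1])
  let ?osc = "\<lambda>\<alpha>. ?K * (real (hgt T n \<alpha>) * len ?R \<alpha>)"
  have osc: "\<bar>SB T n \<phi> \<alpha> x - SB T n \<phi> \<alpha> y\<bar> \<le> ?osc \<alpha>" if "x \<in> It_closed ?R \<alpha>" "y \<in> It_closed ?R \<alpha>" for \<alpha> x y
    by (rule SB_near_constant[OF T C1_lipschitz[OF \<phi>1] that K])
  have osc_nonneg: "0 \<le> ?osc \<alpha>" for \<alpha> using K iem_len[OF R, of \<alpha>] by simp
  have osc_sum: "sum ?osc UNIV = ?K * ?L" by (simp add: sum_hgt_len[OF T] flip: sum_distrib_left)
  then have osc_le: "?osc \<alpha> \<le> ?K * ?L" for \<alpha>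
    using member_le_sum[of \<alpha> UNIV ?osc] osc_nonneg by simp
  define c0 :: "real^'a" where "c0 = (\<chi> \<alpha>. SB T n \<phi> \<alpha> (lt ?R \<alpha>))"
  have sub: "subspace (range ((*v) (Omega ?R)))"
    by (intro linear_subspace_image matrix_vector_mul_linear subspace_UNIV)
  obtain c w where cw: "c0 = c + w" "c \<in> range ((*v) (Omega ?R))" "w \<in> (range ((*v) (Omega ?R)))\<^sup>\<bottom>"
    using subspace_sum_orthogonal_comp[OF sub] set_plus_elim by blast
  have orth: "w \<bullet> d = 0" if "d \<in> range ((*v) (Omega ?R))" for d
    using cw(3) that by (auto simp: orthogonal_comp_def orthogonal_def inner_commute)
  have ker: "Omega ?R *v w = 0"
  proof -
    have "(Omega ?R *v w) \<bullet> (Omega ?R *v w) = 0" unfolding Omega_inner using orth by simp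
    then show ?thesis by simp
  qed
  obtain w0 where w0: "Omega T *v w0 = 0" "bracket ?R (($) w) (SB T n \<phi>) = bracket T (($) w0) \<phi>"
    using bracket_SB[OF T ker] by blast
  have b0: "bracket ?R (($) w) (SB T n \<phi>) = 0"
    unfolding w0(2) using bracket_boundary_zero[OF T(1) bd, of "($) w0"] w0(1) kernel_psum[OF T(1)] by simp
  \<comment> \<open>The second bracket is zero; subtracting it leaves only differences between the
    two ends of one interval.\<close>
  have "w \<bullet> c0 = bracket ?R (($) w) (of_Gamma c0) - bracket ?R (($) w) (SB T n \<phi>)"
    by (simp add: bracket_Gamma b0)
  also have "\<dots> = (\<Sum>\<alpha>\<in>UNIV. (psum (pi_t ?R) (($) w) \<alpha> + w $ \<alpha>) *
      (SB T n \<phi> \<alpha> (lt ?R \<alpha>) - SB T n \<phi> \<alpha> (lt ?R \<alpha> + len ?R \<alpha>)))"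
    unfolding bracket_def of_Gamma_def c0_def by (simp add: sum_subtractf[symmetric] algebra_simps)
  also have "\<dots> \<le> (\<Sum>\<alpha>\<in>UNIV. (?D * norm w) * ?osc \<alpha>)"
  proof (rule sum_mono)
    fix \<alpha>
    have "\<bar>psum (pi_t ?R) (($) w) \<alpha> + w $ \<alpha>\<bar> = \<bar>sum (($) w) {\<beta>. pi_t ?R \<beta> \<le> pi_t ?R \<alpha>}\<bar>"
      using sum_le_psum[OF iem_bij(1)[OF R], of "($) w" \<alpha>] by simp
    also have "\<dots> \<le> (\<Sum>\<beta> | pi_t ?R \<beta> \<le> pi_t ?R \<alpha>. \<bar>w $ \<beta>\<bar>)" by (rule sum_abs)
    also have "\<dots> \<le> (\<Sum>\<beta>\<in>UNIV. \<bar>w $ \<beta>\<bar>)" by (rule sum_mono2) auto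
    also have "\<dots> \<le> ?D * norm w"
      using sum_bounded_above[of UNIV "\<lambda>\<beta>. \<bar>w $ \<beta>\<bar>" "norm w"] component_le_norm_cart[of w] by simp
    finally have 1: "\<bar>psum (pi_t ?R) (($) w) \<alpha> + w $ \<alpha>\<bar> \<le> ?D * norm w" .
    have "lt ?R \<alpha> \<in> It_closed ?R \<alpha>" "lt ?R \<alpha> + len ?R \<alpha> \<in> It_closed ?R \<alpha>"
      using iem_len[OF R, of \<alpha>] by (auto simp: It_closed_eq[OF R])
    then have 2: "\<bar>SB T n \<phi> \<alpha> (lt ?R \<alpha>) - SB T n \<phi> \<alpha> (lt ?R \<alpha> + len ?R \<alpha>)\<bar> \<le> ?osc \<alpha>" by (rule osc)
    have "(psum (pi_t ?R) (($) w) \<alpha> + w $ \<alpha>) * (SB T n \<phi> \<alpha> (lt ?R \<alpha>) - SB T n \<phi> \<alpha> (lt ?R \<alpha> + len ?R \<alpha>))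
      \<le> \<bar>psum (pi_t ?R) (($) w) \<alpha> + w $ \<alpha>\<bar> * \<bar>SB T n \<phi> \<alpha> (lt ?R \<alpha>) - SB T n \<phi> \<alpha> (lt ?R \<alpha> + len ?R \<alpha>)\<bar>"
      unfolding abs_mult[symmetric] by (rule abs_ge_self)
    also have "\<dots> \<le> (?D * norm w) * ?osc \<alpha>" by (intro mult_mono 1 2) auto
    finally show "(psum (pi_t ?R) (($) w) \<alpha> + w $ \<alpha>) *
        (SB T n \<phi> \<alpha> (lt ?R \<alpha>) - SB T n \<phi> \<alpha> (lt ?R \<alpha> + len ?R \<alpha>)) \<le> (?D * norm w) * ?osc \<alpha>" .
  qed
  also have "\<dots> = (?D * norm w) * (?K * ?L)" by (subst sum_distrib_left[symmetric]) (simp only: osc_sum)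
  finally have "w \<bullet> c0 \<le> (?D * norm w) * (?K * ?L)" .
  moreover have "w \<bullet> c0 = norm w * norm w" using orth[OF cw(2)]
    by (simp add: cw(1) inner_add_right flip: power2_norm_eq_inner power2_eq_square)
  ultimately have "norm w * norm w \<le> norm w * (?D * (?K * ?L))" by (simp add: mult_ac)
  then have nw: "norm w \<le> ?D * (?K * ?L)"
    using K iem_len[OF T(1)] by (cases "norm w = 0") (auto simp: sum_nonneg less_imp_le)
  show ?thesis
  proof (intro bexI[OF _ cw(2)] allI ballI)
    fix \<alpha> x assume x: "x \<in> It_closed ?R \<alpha>"
    have "\<bar>SB T n \<phi> \<alpha> x - c0 $ \<alpha>\<bar> \<le> ?K * ?L"
      using osc[OF x It_closed_nonempty[OF R]] osc_le[of \<alpha>] by (simp add: c0_def)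
    moreover have "\<bar>w $ \<alpha>\<bar> \<le> ?D * (?K * ?L)" using component_le_norm_cart[of w \<alpha>] nw by linarith
    moreover have "c0 $ \<alpha> = c $ \<alpha> + w $ \<alpha>" by (simp add: cw(1))
    ultimately have "\<bar>SB T n \<phi> \<alpha> x - c $ \<alpha>\<bar> \<le> ?K * ?L + ?D * (?K * ?L)" by linarith
    then show "\<bar>SB T n \<phi> \<alpha> x - c $ \<alpha>\<bar> \<le> (1 + ?D) * ?L * ?K" by (simp add: algebra_simps)
  qed
qed

section \<open>The cocycle on the image of \<open>Omega\<close>\<close>

lemma elem_zero:
  assumes T: "iem T" and "elem T *v x = 0" shows "x = 0"
proof -
  have e: "x $ \<alpha> + (if \<alpha> = loser T then x $ winner T else 0) = 0" for \<alpha>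
    using elem_vec[OF T, of x \<alpha>] assms(2) by simp
  have "x $ winner T = 0" using e[of "winner T"] winner_neq_loser[OF T] by simp
  then have "x $ \<alpha> = 0" for \<alpha> using e[of \<alpha>] by (auto split: if_splits)
  then show ?thesis by (simp add: vec_eq_iff)
qed

lemma KZ_zero:
  assumes T: "iem T" "no_connection T" shows "KZ T n *v x = 0 \<Longrightarrow> x = 0"
proof (induction n)
  case (Suc n)
  then have "elem (RV T n) *v (KZ T n *v x) = 0" by (simp add: matrix_vector_mul_assoc)
  then show ?case using elem_zero[OF RV_iem[OF T]] Suc.IH by blast
qed simp

lemma KZ_inj:
  assumes T: "iem T" "no_connection T" shows "inj ((*v) (KZ T n))"
  using KZ_zero[OF T] matrix_vector_mul_linear[of "KZ T n"] by (auto simp: linear_injective_0)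

lemma Omega_RV_vec:
  assumes T: "iem T" "no_connection T"
  shows "Omega (RV T n) *v y = KZ T n *v (Omega T *v (transpose (KZ T n) *v y))"
  unfolding Omega_RV[OF T] matrix_vector_mul_assoc by (simp add: matrix_mul_assoc)

lemma KZ_range_Omega:
  assumes T: "iem T" "no_connection T" and c: "c \<in> range ((*v) (Omega T))"
  shows "KZ T n *v c \<in> range ((*v) (Omega (RV T n)))"
  unfolding mem_range_Omega_iff
proof (intro allI impI)
  fix w assume "Omega (RV T n) *v w = 0"
  then have "Omega T *v (transpose (KZ T n) *v w) = 0" using KZ_zero[OF T] Omega_RV_vec[OF T] by metis
  then have "(transpose (KZ T n) *v w) \<bullet> c = 0" using c mem_range_Omega_iff by blast
  then show "w \<bullet> (KZ T n *v c) = 0" by (simp add: dot_lmul_matrix)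
qed

lemma KZ_range_Omega_preimage:
  assumes T: "iem T" "no_connection T" and c: "c \<in> range ((*v) (Omega (RV T n)))"
  obtains c0 where "c0 \<in> range ((*v) (Omega T))" "KZ T n *v c0 = c"
proof -
  obtain y where "c = Omega (RV T n) *v y" using c by auto
  then show thesis using that[OF rangeI] Omega_RV_vec[OF T] by simp
qed

text \<open>The cocycle preserves the symplectic form \<open>\<langle>\<Omega>x, \<Omega>y\<rangle> \<mapsto> x \<bullet> \<Omega>y\<close> on the image of \<open>\<Omega>\<close>.\<close>

lemma symplectic_transport:
  assumes T: "iem T" "no_connection T" and c: "c \<in> range ((*v) (Omega T))"
    and q: "Omega (RV T n) *v q = KZ T n *v (Omega T *v x)"
  shows "x \<bullet> c = q \<bullet> (KZ T n *v c)"
proof -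
  obtain y where y: "c = Omega T *v y" using c by auto
  have "KZ T n *v (Omega T *v (transpose (KZ T n) *v q) - Omega T *v x) = 0"
    using q Omega_RV_vec[OF T] by (simp add: matrix_vector_mult_diff_distrib)
  then have eq: "Omega T *v (transpose (KZ T n) *v q) = Omega T *v x" using KZ_zero[OF T] by fastforce
  have "q \<bullet> (KZ T n *v c) = (transpose (KZ T n) *v q) \<bullet> (Omega T *v y)"
    by (simp add: y dot_lmul_matrix)
  also have "\<dots> = - ((Omega T *v (transpose (KZ T n) *v q)) \<bullet> y)" unfolding Omega_inner by simp
  also have "\<dots> = - ((Omega T *v x) \<bullet> y)" unfolding eq ..
  also have "\<dots> = x \<bullet> c" unfolding Omega_inner y by simp
  finally show ?thesis ..
qed

text \<open>\<open>Omega\<close> depends only on two order relations on a finite alphabet. Hence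
  constants attached to it, such as the one in \<open>Omega_uniform_preimage\<close>, can be chosen
  independent of n.\<close>

lemma finite_range_Omega: "finite (range (Omega :: 'a::finite iem \<Rightarrow> real^'a^'a))"
proof -
  let ?F = "\<lambda>(R :: ('a \<times> 'a) set, R'). (\<chi> \<alpha> \<beta>. if (\<alpha>, \<beta>) \<in> R \<and> (\<beta>, \<alpha>) \<in> R' then 1
      else if (\<beta>, \<alpha>) \<in> R \<and> (\<alpha>, \<beta>) \<in> R' then - 1 else 0) :: real^'a^'a"
  have "Omega T \<in> range ?F" for T :: "'a iem"
    by (rule range_eqI[of _ _ "({(\<alpha>, \<beta>). pi_t T \<alpha> < pi_t T \<beta>}, {(\<alpha>, \<beta>). pi_b T \<alpha> < pi_b T \<beta>})"])
      (auto simp: Omega_def vec_eq_iff)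
  then have "range (Omega :: 'a iem \<Rightarrow> real^'a^'a) \<subseteq> range ?F" by blast
  then show ?thesis by (rule finite_subset) simp
qed

lemma matrix_bounded_preimage:
  fixes A :: "real^'n^'m"
  shows "\<exists>K. \<forall>c\<in>range ((*v) A). \<exists>q. A *v q = c \<and> norm q \<le> K * norm c"
proof -
  obtain g where g: "linear g" "\<And>v. A *v (g (A *v v)) = A *v v"
    using linear_exists_right_inverse_on[OF matrix_vector_mul_linear[of A] subspace_UNIV] by auto
  obtain K where "\<And>x. norm (g x) \<le> K * norm x" using linear_bounded[OF g(1)] by blast
  then show ?thesis using g(2) by (intro exI[of _ K]) auto
qed

lemma Omega_uniform_preimage:
  "\<exists>K>0. \<forall>(T :: 'a::finite iem). \<forall>c\<in>range ((*v) (Omega T)). \<exists>q. Omega T *v q = c \<and> norm q \<le> K * norm c"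
proof -
  obtain K where K: "\<And>A::real^'a^'a. \<forall>c\<in>range ((*v) A). \<exists>q. A *v q = c \<and> norm q \<le> K A * norm c"
    using matrix_bounded_preimage by metis
  let ?M = "range (Omega :: 'a iem \<Rightarrow> real^'a^'a)"
  let ?K = "1 + (\<Sum>A\<in>?M. \<bar>K A\<bar>)"
  have "K (Omega T) \<le> ?K" for T :: "'a iem"
  proof -
    have "\<bar>K (Omega T)\<bar> \<le> (\<Sum>A\<in>?M. \<bar>K A\<bar>)"
      by (rule member_le_sum) (use finite_range_Omega in auto)
    then show ?thesis by linarith
  qed
  then have "\<exists>q. Omega T *v q = c \<and> norm q \<le> ?K * norm c" if "c \<in> range ((*v) (Omega T))"
    for T :: "'a iem" and c
    using K[of "Omega T"] that by (meson mult_right_mono norm_ge_zero order_trans)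
  moreover have "0 < ?K" by (simp add: add_pos_nonneg sum_nonneg)
  ultimately show ?thesis by blast
qed

lemma norm_Omega_vec: "norm (Omega T *v x) \<le> real CARD('a) ^ 2 * norm (x :: real^'a::finite)"
proof -
  have "mat_norm (Omega T) \<le> real CARD('a)"
  proof (rule mat_norm_leI)
    fix \<alpha> :: 'a
    have "\<And>\<beta>. \<bar>Omega T $ \<alpha> $ \<beta>\<bar> \<le> 1" by (simp add: Omega_def)
    then show "(\<Sum>\<beta>\<in>UNIV. \<bar>Omega T $ \<alpha> $ \<beta>\<bar>) \<le> real CARD('a)"
      using sum_bounded_above[of UNIV "\<lambda>\<beta>. \<bar>Omega T $ \<alpha> $ \<beta>\<bar>" 1] by simp
  qed
  then have *: "real CARD('a) * mat_norm (Omega T) * norm x \<le> real CARD('a) * real CARD('a) * norm x"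
    by (intro mult_right_mono mult_left_mono) auto
  show ?thesis unfolding power2_eq_square by (rule order_trans[OF norm_mat_vec_le *])
qed

lemma subspace_range_Omega: "subspace (range ((*v) (Omega T)))"
  by (intro linear_subspace_image matrix_vector_mul_linear subspace_UNIV)

lemma orthogonal_decomposition:
  fixes S :: "'b::euclidean_space set"
  assumes "subspace S"
  obtains s p where "x = s + p" "s \<in> S" "\<And>t. t \<in> S \<Longrightarrow> p \<bullet> t = 0"
  using orthogonal_subspace_decomp_exists[of S x] assms span_eq_iff by (metis orthogonal_def)

text \<open>\<open>Omega\<close> is injective on its image, since kernel and image are orthogonal;
  so the preimage V of S inside the image has the dimension of S. Isotropy makes V and S orthogonal,
  and both fit into the image.\<close>

lemma isotropic_dim_le:
  fixes T :: "'a::finite iem"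
  assumes S: "subspace S" "S \<subseteq> range ((*v) (Omega T))"
    and iso: "\<And>x s. Omega T *v x \<in> S \<Longrightarrow> s \<in> S \<Longrightarrow> x \<bullet> s = 0"
  shows "2 * dim S \<le> rank (Omega T)"
proof -
  let ?R = "range ((*v) (Omega T))"
  define V where "V = {x \<in> ?R. Omega T *v x \<in> S}"
  have inj: "inj_on ((*v) (Omega T)) (span V)"
  proof (rule inj_onI)
    have "span V \<subseteq> ?R" by (rule span_minimal) (auto simp: V_def subspace_range_Omega)
    moreover fix x y assume "x \<in> span V" "y \<in> span V" and eq: "Omega T *v x = Omega T *v y"
    ultimately have "x - y \<in> ?R" using subspace_diff[OF subspace_range_Omega] by blast
    moreover have "Omega T *v (x - y) = 0" using eq by (simp add: matrix_vector_mult_diff_distrib)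
    ultimately have "(x - y) \<bullet> (x - y) = 0" using mem_range_Omega_iff by blast
    then show "x = y" by simp
  qed
  have "S \<subseteq> (*v) (Omega T) ` V"
  proof
    fix s assume s: "s \<in> S"
    then obtain x where x: "s = Omega T *v x" using S(2) by auto
    obtain r k where rk: "x = r + k" "r \<in> ?R" "\<And>t. t \<in> ?R \<Longrightarrow> k \<bullet> t = 0"
      using orthogonal_decomposition[OF subspace_range_Omega] by metis
    have "(Omega T *v k) \<bullet> (Omega T *v k) = 0" unfolding Omega_inner using rk(3) by simp
    then have "Omega T *v r = s" using x rk(1) by (simp add: matrix_vector_right_distrib)
    then show "s \<in> (*v) (Omega T) ` V" using rk(2) s by (auto simp: V_def)
  qed
  then have "(*v) (Omega T) ` V = S" by (auto simp: V_def)
  then have "dim S = dim V" using dim_image_eq[OF matrix_vector_mul_linear inj] by simp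
  moreover have "dim (V \<union> S) = dim V + dim S" by (rule dim_orthogonal_sum) (auto simp: V_def intro: iso)
  moreover have "dim (V \<union> S) \<le> dim ?R" by (rule dim_subset) (use S(2) in \<open>auto simp: V_def\<close>)
  ultimately show ?thesis by (simp add: rank_dim_range)
qed

text \<open>Otherwise adjoining \<open>Omega T *v p\<close> to S would give a larger isotropic
  space, which the dimension forbids. The + 1 leaves room for the rounding in the definition of the
  genus.\<close>

lemma lagrangian_perp:
  fixes T :: "'a::finite iem"
  assumes S: "subspace S" "S \<subseteq> range ((*v) (Omega T))"
    and iso: "\<And>x s. Omega T *v x \<in> S \<Longrightarrow> s \<in> S \<Longrightarrow> x \<bullet> s = 0"
    and dim: "rank (Omega T) \<le> 2 * dim S + 1"
    and p: "\<And>s. s \<in> S \<Longrightarrow> p \<bullet> s = 0"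
  shows "Omega T *v p \<in> S"
proof (rule ccontr)
  let ?c = "Omega T *v p" and ?S = "span (insert (Omega T *v p) S)"
  assume c: "?c \<notin> S"
  have span_S: "span S = S" using S(1) by (simp add: span_eq_iff)
  have "dim ?S = Suc (dim S)" using c dim_insert[of ?c S] by (simp add: span_S)
  moreover have "2 * dim ?S \<le> rank (Omega T)"
  proof (rule isotropic_dim_le)
    show "subspace ?S" by simp
    show "?S \<subseteq> range ((*v) (Omega T))" by (rule span_minimal) (use S(2) in \<open>auto simp: subspace_range_Omega\<close>)
    fix x t assume "Omega T *v x \<in> ?S" "t \<in> ?S"
    then obtain k k' where k: "Omega T *v x - k *\<^sub>R ?c \<in> S" and k': "t - k' *\<^sub>R ?c \<in> S"
      using span_breakdown_eq[of _ ?c S] span_S by metis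
    define x1 where "x1 = x - k *\<^sub>R p"
    define t1 where "t1 = t - k' *\<^sub>R ?c"
    have x1: "Omega T *v x1 \<in> S" using k
      by (simp add: x1_def matrix_vector_mult_diff_distrib matrix_vector_mult_scaleR)
    have t1: "t1 \<in> S" using k' by (simp add: t1_def)
    \<comment> \<open>Antisymmetry makes the new direction isotropic by itself; paired with S it
      gives zero because p is orthogonal to S.\<close>
    have pp: "p \<bullet> ?c = 0" using Omega_inner[of T p p] by (simp add: inner_commute)
    have "x1 \<bullet> ?c = - ((Omega T *v x1) \<bullet> p)" using Omega_inner[of T x1 p] by simp
    also have "\<dots> = 0" using p[OF x1] by (simp add: inner_commute)
    finally have "x1 \<bullet> ?c = 0" .
    then have "(x1 + k *\<^sub>R p) \<bullet> (t1 + k' *\<^sub>R ?c) = 0"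
      using iso[OF x1 t1] p[OF t1] pp by (simp add: inner_add_left inner_add_right)
    then show "x \<bullet> t = 0" by (simp add: x1_def t1_def)
  qed
  ultimately show False using dim by simp
qed

lemma subspace_KZ_image: "subspace S \<Longrightarrow> subspace ((*v) (KZ T n) ` S)"
  by (intro linear_subspace_image matrix_vector_mul_linear)

text \<open>Since \<open>S\<close> is Lagrangian, the quotient of the image of \<open>\<Omega>\<close> by \<open>S\<close> is dual to \<open>S\<close>: a bound
  for the cocycle on \<open>S\<close> is a bound for its inverse on the quotient.\<close>

lemma infdist_duality:
  fixes T :: "'a::finite iem"
  assumes T: "iem T" "no_connection T"
    and S: "subspace S" "S \<subseteq> range ((*v) (Omega T))"
    and iso: "\<And>x s. Omega T *v x \<in> S \<Longrightarrow> s \<in> S \<Longrightarrow> x \<bullet> s = 0"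
    and dim: "rank (Omega T) \<le> 2 * dim S + 1"
  shows "\<exists>K>0. \<forall>m k b c. 0 \<le> b \<longrightarrow> c \<in> range ((*v) (Omega (RV T m))) \<longrightarrow>
    (\<forall>s\<in>(*v) (KZ T m) ` S. norm (KZ (RV T m) k *v s) \<le> b * norm s) \<longrightarrow>
    infdist c ((*v) (KZ T m) ` S) \<le> K * b * infdist (KZ (RV T m) k *v c) ((*v) (KZ T (m + k)) ` S)"
proof -
  let ?S = "\<lambda>n. (*v) (KZ T n) ` S"
  obtain K where K: "K > 0" "\<And>(T :: 'a iem) c. c \<in> range ((*v) (Omega T)) \<Longrightarrow>
      \<exists>q. Omega T *v q = c \<and> norm q \<le> K * norm c"
    using Omega_uniform_preimage by blast
  let ?D = "real CARD('a) ^ 2"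
  have sub: "subspace (?S n)" for n by (rule subspace_KZ_image[OF S(1)])
  have range: "?S n \<subseteq> range ((*v) (Omega (RV T n)))" for n using KZ_range_Omega[OF T] S(2) by blast
  have iso_n: "x \<bullet> t = 0" if xt: "Omega (RV T n) *v x \<in> ?S n" "t \<in> ?S n" for n x t
  proof -
    obtain s s' where s: "Omega (RV T n) *v x = KZ T n *v s" "s \<in> S" "t = KZ T n *v s'" "s' \<in> S"
      using xt by auto
    obtain y where y: "s = Omega T *v y" using s(2) S(2) by auto
    have "y \<bullet> s' = x \<bullet> t" unfolding s(3)
      by (rule symplectic_transport[OF T]) (use s S(2) y in auto)
    then show ?thesis using iso[of y s'] s y by simp
  qed
  have dim_n: "rank (Omega (RV T n)) \<le> 2 * dim (?S n) + 1" for n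
  proof -
    have "range ((*v) (Omega (RV T n))) = (*v) (KZ T n) ` range ((*v) (Omega T))"
      using KZ_range_Omega[OF T] KZ_range_Omega_preimage[OF T, of _ n] by (auto, metis image_eqI rangeI)
    moreover have "dim ((*v) (KZ T n) ` X) = dim X" for X
      by (rule dim_image_eq[OF matrix_vector_mul_linear]) (rule inj_on_subset[OF KZ_inj[OF T]], simp)
    ultimately show ?thesis using dim by (simp add: rank_dim_range)
  qed
  have main: "infdist c (?S m) \<le> K * ?D * b * infdist (KZ (RV T m) k *v c) (?S (m + k))"
    if b: "0 \<le> b" and c: "c \<in> range ((*v) (Omega (RV T m)))"
      and bound: "\<And>s. s \<in> ?S m \<Longrightarrow> norm (KZ (RV T m) k *v s) \<le> b * norm s" for m k b c
  proof -
    let ?R = "RV T m" and ?Q = "KZ (RV T m) k"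
    have R: "iem ?R" "no_connection ?R" by (rule RV_iem[OF T], rule RV_no_connection[OF T])
    obtain s p where sp: "c = s + p" "s \<in> ?S m" "\<And>t. t \<in> ?S m \<Longrightarrow> p \<bullet> t = 0"
      using orthogonal_decomposition[OF sub] by metis
    have \<Omega>p: "Omega ?R *v p \<in> ?S m"
      by (rule lagrangian_perp[OF sub range iso_n dim_n sp(3)])
    have Q\<Omega>p: "?Q *v (Omega ?R *v p) \<in> ?S (m + k)"
      using \<Omega>p by (auto simp: KZ_add simp flip: matrix_vector_mul_assoc)
    obtain q where q: "Omega (RV T (m + k)) *v q = ?Q *v (Omega ?R *v p)"
        "norm q \<le> K * norm (?Q *v (Omega ?R *v p))"
      using K(2)[of "?Q *v (Omega ?R *v p)" "RV T (m + k)"] Q\<Omega>p range by blast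
    have "norm q \<le> K * (b * (?D * norm p))"
    proof -
      have "norm (?Q *v (Omega ?R *v p)) \<le> b * norm (Omega ?R *v p)" by (rule bound[OF \<Omega>p])
      also have "\<dots> \<le> b * (?D * norm p)" by (intro mult_left_mono norm_Omega_vec b)
      finally show ?thesis using q(2) K(1) by (meson mult_left_mono less_imp_le order_trans)
    qed
    note nq = this
    have closed: "closed (?S (m + k))" by (rule closed_subspace[OF sub])
    obtain t where t: "t \<in> ?S (m + k)" "infdist (?Q *v c) (?S (m + k)) = dist (?Q *v c) t"
      using infdist_attains_inf[OF closed] sp(2) by blast
    \<comment> \<open>The symplectic pairing of c with \<open>Omega ?R *v p\<close>, computed at
      both times. At time m it is the square of the norm of p; at time m + k, isotropy allows
      subtracting from the image of c its nearest point t in the stable image.\<close>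
    have "p \<bullet> c = q \<bullet> (?Q *v c)"
      by (rule symplectic_transport[OF R c]) (use q(1) in \<open>simp add: RV_RV\<close>)
    moreover have "p \<bullet> c = norm p * norm p" using sp(3)[OF sp(2)]
      by (simp add: sp(1) inner_add_right flip: power2_norm_eq_inner power2_eq_square)
    moreover have "q \<bullet> t = 0" by (rule iso_n[OF _ t(1)]) (use q(1) Q\<Omega>p in simp)
    ultimately have "norm p * norm p = q \<bullet> (?Q *v c - t)" by (simp add: inner_diff_right)
    also have "\<dots> \<le> norm q * norm (?Q *v c - t)" by (rule norm_cauchy_schwarz)
    also have "\<dots> \<le> K * (b * (?D * norm p)) * norm (?Q *v c - t)" by (intro mult_right_mono nq) auto
    finally have "norm p * norm p \<le> norm p * (K * ?D * b * norm (?Q *v c - t))" by (simp add: mult_ac)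
    then have "norm p \<le> K * ?D * b * norm (?Q *v c - t)"
      using K(1) b by (cases "norm p = 0") auto
    moreover have "infdist c (?S m) \<le> norm p"
      using infdist_le[OF sp(2), of c] by (simp add: sp(1) dist_norm)
    ultimately show ?thesis using t(2) by (simp add: dist_norm)
  qed
  show ?thesis
  proof (intro exI[of _ "K * ?D"] conjI allI impI)
    show "0 < K * ?D" using K(1) by simp
  qed (rule main, assumption, assumption, drule bspec, assumption, assumption)
qed

section \<open>The stable space\<close>


lemma Gamma_s_iff:
  assumes T: "iem (T :: 'a::finite iem)" "no_connection T"
  shows "c \<in> Gamma_s T \<longleftrightarrow> (\<exists>\<sigma>>0. \<exists>C. \<forall>n. norm (KZ T n *v c) \<le> C * rv_norm T n powr (- \<sigma>))"
proof
  assume "c \<in> Gamma_s T"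
  then obtain \<sigma> where \<sigma>: "\<sigma> > 0" "(\<lambda>n. infnorm (KZ T n *v c)) \<in> O(\<lambda>n. rv_norm T n powr (- \<sigma>))"
    by (auto simp: Gamma_s_def B_0_eq_KZ[OF T] rv_norm_def)
  have "0 < rv_norm T n powr (- \<sigma>)" for n using rv_norm_ge_1[OF T, of n] by simp
  then obtain C where C: "\<And>n. \<bar>infnorm (KZ T n *v c)\<bar> \<le> C * rv_norm T n powr (- \<sigma>)"
    using bigo_sequence_bound[OF \<sigma>(2)] by blast
  have "norm (KZ T n *v c) \<le> (real CARD('a) * C) * rv_norm T n powr (- \<sigma>)" for n
  proof -
    have "norm (KZ T n *v c) \<le> real CARD('a) * infnorm (KZ T n *v c)" by (rule norm_le_card_infnorm)
    also have "\<dots> \<le> real CARD('a) * (C * rv_norm T n powr (- \<sigma>))"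
      using C[of n] by (intro mult_left_mono) auto
    finally show ?thesis by (simp add: mult.assoc)
  qed
  then show "\<exists>\<sigma>>0. \<exists>C. \<forall>n. norm (KZ T n *v c) \<le> C * rv_norm T n powr (- \<sigma>)" using \<sigma>(1) by blast
next
  assume "\<exists>\<sigma>>0. \<exists>C. \<forall>n. norm (KZ T n *v c) \<le> C * rv_norm T n powr (- \<sigma>)"
  then obtain \<sigma> C where \<sigma>: "\<sigma> > 0" "\<And>n. norm (KZ T n *v c) \<le> C * rv_norm T n powr (- \<sigma>)" by blast
  have "(\<lambda>n. infnorm (KZ T n *v c)) \<in> O(\<lambda>n. rv_norm T n powr (- \<sigma>))"
  proof (rule bigoI[of _ C], rule always_eventually, rule allI)
    fix n
    show "norm (infnorm (KZ T n *v c)) \<le> C * norm (rv_norm T n powr (- \<sigma>))"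
      using \<sigma>(2)[of n] infnorm_le_norm[of "KZ T n *v c"] infnorm_pos_le[of "KZ T n *v c"] by simp
  qed
  then show "c \<in> Gamma_s T" using \<sigma>(1) by (auto simp: Gamma_s_def B_0_eq_KZ[OF T] rv_norm_def)
qed

lemma powr_neg_antimono: "1 \<le> x \<Longrightarrow> a \<le> b \<Longrightarrow> x powr (- b) \<le> x powr (- a)" for x :: real
  by (rule powr_mono) auto

lemma subspace_Gamma_s:
  assumes T: "iem (T :: 'a::finite iem)" "no_connection T"
  shows "subspace (Gamma_s T)"
proof (rule subspaceI)
  show "0 \<in> Gamma_s T" unfolding Gamma_s_iff[OF T] by (intro exI[of _ 1] conjI exI[of _ 0]) auto
next
  fix x y assume "x \<in> Gamma_s T" "y \<in> Gamma_s T"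
  then obtain \<sigma>1 C1 \<sigma>2 C2 where
    1: "\<sigma>1 > 0" "\<And>n. norm (KZ T n *v x) \<le> C1 * rv_norm T n powr (- \<sigma>1)" and
    2: "\<sigma>2 > 0" "\<And>n. norm (KZ T n *v y) \<le> C2 * rv_norm T n powr (- \<sigma>2)"
    unfolding Gamma_s_iff[OF T] by blast
  have "norm (KZ T n *v (x + y)) \<le> (\<bar>C1\<bar> + \<bar>C2\<bar>) * rv_norm T n powr (- min \<sigma>1 \<sigma>2)" for n
  proof -
    have N: "1 \<le> rv_norm T n" by (rule rv_norm_ge_1[OF T])
    have "C1 * rv_norm T n powr (- \<sigma>1) \<le> \<bar>C1\<bar> * rv_norm T n powr (- min \<sigma>1 \<sigma>2)"
      by (intro mult_mono powr_neg_antimono N) auto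
    moreover have "C2 * rv_norm T n powr (- \<sigma>2) \<le> \<bar>C2\<bar> * rv_norm T n powr (- min \<sigma>1 \<sigma>2)"
      by (intro mult_mono powr_neg_antimono N) auto
    ultimately show ?thesis
      using 1(2)[of n] 2(2)[of n] norm_triangle_ineq[of "KZ T n *v x" "KZ T n *v y"]
      by (simp add: matrix_vector_right_distrib distrib_right)
  qed
  moreover have "0 < min \<sigma>1 \<sigma>2" using 1 2 by simp
  ultimately show "x + y \<in> Gamma_s T" unfolding Gamma_s_iff[OF T] by blast
next
  fix c x assume "x \<in> Gamma_s T"
  then obtain \<sigma> C where 1: "\<sigma> > 0" "\<And>n. norm (KZ T n *v x) \<le> C * rv_norm T n powr (- \<sigma>)"
    unfolding Gamma_s_iff[OF T] by blast
  have "norm (KZ T n *v (c *\<^sub>R x)) \<le> (\<bar>c\<bar> * C) * rv_norm T n powr (- \<sigma>)" for n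
    using mult_left_mono[OF 1(2)[of n], of "\<bar>c\<bar>"] by (simp add: matrix_vector_mult_scaleR mult.assoc)
  then show "c *\<^sub>R x \<in> Gamma_s T" unfolding Gamma_s_iff[OF T] using 1(1) by blast
qed

text \<open>In the definition the exponent depends on the vector. A finite orthonormal basis allows
  taking the smallest exponent and adding the constants.\<close>

lemma Gamma_s_uniform_decay:
  assumes T: "iem (T :: 'a::finite iem)" "no_connection T"
  shows "\<exists>\<sigma>>0. \<exists>C>0. \<forall>c\<in>Gamma_s T. \<forall>n. norm (KZ T n *v c) \<le> C * rv_norm T n powr (- \<sigma>) * norm c"
proof -
  obtain X where X: "X \<subseteq> Gamma_s T" "pairwise orthogonal X" "\<And>x. x \<in> X \<Longrightarrow> norm x = 1"
    "independent X" "span X = Gamma_s T"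
    using orthonormal_basis_subspace[OF subspace_Gamma_s[OF T]] by metis
  have fin: "finite X" using X(4) by (rule independent_imp_finite)
  have "\<forall>b\<in>X. \<exists>\<sigma> C. \<sigma> > 0 \<and> (\<forall>n. norm (KZ T n *v b) \<le> C * rv_norm T n powr (- \<sigma>))"
    using X(1) unfolding subset_iff Gamma_s_iff[OF T] by blast
  then obtain \<sigma> C where \<sigma>: "\<And>b. b \<in> X \<Longrightarrow> \<sigma> b > 0"
    "\<And>b n. b \<in> X \<Longrightarrow> norm (KZ T n *v b) \<le> C b * rv_norm T n powr (- \<sigma> b)" by metis
  \<comment> \<open>Inserting 1 keeps the minimum defined when the stable space is trivial.\<close>
  define s where "s = Min (insert 1 (\<sigma> ` X))"
  define K where "K = 1 + (\<Sum>b\<in>X. \<bar>C b\<bar>)"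
  have s: "s > 0" unfolding s_def using fin \<sigma>(1) by (subst Min_gr_iff) auto
  have s_le: "s \<le> \<sigma> b" if "b \<in> X" for b unfolding s_def using fin that by (intro Min_le) auto
  have "norm (KZ T n *v c) \<le> K * rv_norm T n powr (- s) * norm c" if c: "c \<in> Gamma_s T" for c n
  proof -
    have "c = (\<Sum>b\<in>X. (c \<bullet> b) *\<^sub>R b)"
      using orthonormal_basis_expand[OF X(2,3) _ fin] c X(5) by metis
    then have "KZ T n *v c = KZ T n *v (\<Sum>b\<in>X. (c \<bullet> b) *\<^sub>R b)" by (rule arg_cong)
    also have "\<dots> = (\<Sum>b\<in>X. (c \<bullet> b) *\<^sub>R (KZ T n *v b))"
      by (simp add: linear_sum[OF matrix_vector_mul_linear] matrix_vector_mult_scaleR)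
    finally have "norm (KZ T n *v c) \<le> (\<Sum>b\<in>X. \<bar>c \<bullet> b\<bar> * norm (KZ T n *v b))"
      by (metis (no_types, lifting) norm_scaleR norm_sum sum.cong order_trans order_refl)
    also have "\<dots> \<le> (\<Sum>b\<in>X. norm c * (\<bar>C b\<bar> * rv_norm T n powr (- s)))"
    proof (rule sum_mono)
      fix b assume b: "b \<in> X"
      have "\<bar>c \<bullet> b\<bar> \<le> norm c" using Cauchy_Schwarz_ineq2[of c b] X(3)[OF b] by simp
      moreover have "norm (KZ T n *v b) \<le> \<bar>C b\<bar> * rv_norm T n powr (- s)"
        by (rule order_trans[OF \<sigma>(2)[OF b]])
          (intro mult_mono powr_neg_antimono rv_norm_ge_1[OF T] s_le b, auto)
      ultimately show "\<bar>c \<bullet> b\<bar> * norm (KZ T n *v b) \<le> norm c * (\<bar>C b\<bar> * rv_norm T n powr (- s))"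
        by (intro mult_mono) auto
    qed
    also have "\<dots> = (\<Sum>b\<in>X. \<bar>C b\<bar>) * rv_norm T n powr (- s) * norm c"
      by (simp add: sum_distrib_right sum_distrib_left mult_ac)
    also have "\<dots> \<le> K * rv_norm T n powr (- s) * norm c"
      unfolding K_def by (intro mult_right_mono) auto
    finally show ?thesis .
  qed
  moreover have "0 < K" unfolding K_def by (simp add: add_pos_nonneg sum_nonneg)
  ultimately show ?thesis using s by blast
qed

lemma rv_norm_RV_le:
  assumes T: "iem (T :: 'a::finite iem)" "no_connection T"
  shows "rv_norm (RV T m) k \<le> rv_norm T (m + k)"
proof -
  have R: "iem (RV T m)" "no_connection (RV T m)" by (rule RV_iem[OF T], rule RV_no_connection[OF T])
  obtain \<alpha> where \<alpha>: "rv_norm (RV T m) k = real (hgt (RV T m) k \<alpha>)" using rv_norm_attained[OF R] by blast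
  have "real (hgt (RV T m) k \<alpha>) = (\<Sum>\<beta>\<in>UNIV. KZ (RV T m) k $ \<alpha> $ \<beta> * 1)"
    using KZ_hgt[OF R, of k \<alpha>] by (simp add: matrix_vector_mult_def)
  also have "\<dots> \<le> (\<Sum>\<beta>\<in>UNIV. KZ (RV T m) k $ \<alpha> $ \<beta> * real (hgt T m \<beta>))"
    using hgt_pos[of T m] KZ_nonneg[OF R] by (intro sum_mono mult_left_mono) auto
  also have "\<dots> = real (hgt T (m + k) \<alpha>)"
    using hgt_split[OF T, of m "m + k" \<alpha>] B_eq_KZ[OF T, of m "m + k"] by simp
  finally show ?thesis using \<alpha> hgt_le_rv_norm[OF T, of "m + k" \<alpha>] by linarith
qed

text \<open>Decay is measured here by the norms of the renormalized map, which do not exceed those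
  of \<open>T\<close> at the corresponding time by \<open>rv_norm_RV_le\<close>.\<close>

lemma Gamma_s_push:
  assumes T: "iem (T :: 'a::finite iem)" "no_connection T" and c: "c \<in> Gamma_s T"
  shows "KZ T m *v c \<in> Gamma_s (RV T m)"
proof -
  have R: "iem (RV T m)" "no_connection (RV T m)" by (rule RV_iem[OF T], rule RV_no_connection[OF T])
  obtain \<sigma> C where 1: "\<sigma> > 0" "\<And>n. norm (KZ T n *v c) \<le> C * rv_norm T n powr (- \<sigma>)"
    using c unfolding Gamma_s_iff[OF T] by blast
  have "norm (KZ (RV T m) k *v (KZ T m *v c)) \<le> \<bar>C\<bar> * rv_norm (RV T m) k powr (- \<sigma>)" for k
  proof -
    have "norm (KZ (RV T m) k *v (KZ T m *v c)) = norm (KZ T (m + k) *v c)"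
      by (simp add: KZ_add matrix_vector_mul_assoc)
    also have "\<dots> \<le> C * rv_norm T (m + k) powr (- \<sigma>)" by (rule 1(2))
    also have "\<dots> \<le> \<bar>C\<bar> * rv_norm (RV T m) k powr (- \<sigma>)"
      using rv_norm_RV_le[OF T, of m k] rv_norm_ge_1[OF R, of k] 1(1)
      by (intro mult_mono powr_mono2') auto
    finally show ?thesis .
  qed
  then show ?thesis unfolding Gamma_s_iff[OF R] using 1(1) by blast
qed

lemma Bs_norm_bound:
  assumes T: "iem (T :: 'a::finite iem)" "no_connection T" and s: "s \<in> Gamma_s (RV T m)"
  shows "infnorm (KZ (RV T m) k *v s) \<le> Bs_norm T m (m + k) * infnorm s"
proof (cases "s = 0")
  case True
  then show ?thesis by (simp add: infnorm_0)
next
  case False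
  let ?A = "{c \<in> Gamma_s (RV T m). infnorm c \<le> 1}" and ?Q = "KZ (RV T m) k"
  have Q: "B T m (m + k) = ?Q" using B_eq_KZ[OF T, of m "m + k"] by simp
  have pos: "0 < infnorm s" using False by (simp add: infnorm_pos_lt)
  let ?s = "(1 / infnorm s) *\<^sub>R s"
  have "?s \<in> Gamma_s (RV T m)"
    using s subspace_Gamma_s[OF RV_iem[OF T] RV_no_connection[OF T]] by (simp add: subspace_scale)
  then have "?s \<in> ?A" using pos by (simp add: infnorm_mul)
  moreover have "bdd_above ((\<lambda>c. infnorm (?Q *v c)) ` ?A)"
  proof (rule bdd_aboveI2)
    fix c assume "c \<in> ?A"
    then have "mat_norm ?Q * infnorm c \<le> mat_norm ?Q * 1" by (intro mult_left_mono mat_norm_nonneg) auto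
    then show "infnorm (?Q *v c) \<le> mat_norm ?Q" using infnorm_mat_vec_le[of ?Q c] by linarith
  qed
  ultimately have "infnorm (?Q *v ?s) \<le> Bs_norm T m (m + k)"
    unfolding Bs_norm_def Q by (rule cSUP_upper)
  moreover have "infnorm (?Q *v ?s) = infnorm (?Q *v s) / infnorm s"
    using pos by (simp add: matrix_vector_mult_scaleR infnorm_mul del: scaleR_one)
  ultimately show ?thesis using pos by (simp add: pos_divide_le_eq)
qed

lemma rv_norm_tendsto:
  assumes T: "iem (T :: 'a::finite iem)" "no_connection T"
  shows "filterlim (rv_norm T) at_top sequentially"
proof (rule filterlim_at_top_mono)
  show "filterlim (\<lambda>n. real n / real CARD('a)) at_top sequentially"
    by (rule filterlim_tendsto_pos_mult_at_top[where f = "\<lambda>_. 1 / real CARD('a)" and c = "1 / real CARD('a)" and g = real, simplified])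
      (auto simp: filterlim_real_sequentially)
  show "\<forall>\<^sub>F n in sequentially. real n / real CARD('a) \<le> rv_norm T n"
    using steps_le_rv_norm[OF T] by (intro always_eventually allI) (simp add: pos_divide_le_eq mult.commute)
qed

lemma rv_norm_powr_tendsto_0:
  assumes T: "iem (T :: 'a::finite iem)" "no_connection T" and "\<rho> > 0"
  shows "(\<lambda>n. rv_norm T n powr (- \<rho>)) \<longlonglongrightarrow> 0"
  by (rule tendsto_neg_powr[OF _ rv_norm_tendsto[OF T]]) (use assms(3) in auto)

text \<open>The symplectic form is preserved by the cocycle, while both of its arguments tend to 0;
  the preimages q under \<open>Omega\<close> have norms controlled uniformly in n.\<close>

lemma Gamma_s_isotropic:
  assumes T: "iem (T :: 'a::finite iem)" "no_connection T"
    and sub: "Gamma_s T \<subseteq> range ((*v) (Omega T))"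
    and x: "Omega T *v x \<in> Gamma_s T" and s: "s \<in> Gamma_s T"
  shows "x \<bullet> s = 0"
proof -
  obtain \<sigma> C where \<sigma>: "\<sigma> > 0" "C > 0"
    "\<And>c n. c \<in> Gamma_s T \<Longrightarrow> norm (KZ T n *v c) \<le> C * rv_norm T n powr (- \<sigma>) * norm c"
    using Gamma_s_uniform_decay[OF T] by blast
  obtain K where K: "K > 0" "\<And>(T :: 'a iem) c. c \<in> range ((*v) (Omega T)) \<Longrightarrow>
      \<exists>q. Omega T *v q = c \<and> norm q \<le> K * norm c"
    using Omega_uniform_preimage by blast
  let ?x = "Omega T *v x"
  have "\<bar>x \<bullet> s\<bar> \<le> K * (C * norm ?x) * (C * norm s) * rv_norm T n powr (- (2 * \<sigma>))" for n
  proof -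
    obtain q where q: "Omega (RV T n) *v q = KZ T n *v ?x" "norm q \<le> K * norm (KZ T n *v ?x)"
      using K(2)[OF KZ_range_Omega[OF T, of ?x n]] by auto
    have "x \<bullet> s = q \<bullet> (KZ T n *v s)" by (rule symplectic_transport[OF T _ q(1)]) (use s sub in auto)
    then have "\<bar>x \<bullet> s\<bar> \<le> norm q * norm (KZ T n *v s)" by (simp add: Cauchy_Schwarz_ineq2)
    also have "\<dots> \<le> (K * (C * rv_norm T n powr (- \<sigma>) * norm ?x)) * (C * rv_norm T n powr (- \<sigma>) * norm s)"
      using \<sigma>(3)[OF x, of n] \<sigma>(3)[OF s, of n] q(2) K(1) \<sigma>(2)
      by (intro mult_mono) (auto intro: order_trans mult_left_mono)
    also have "\<dots> = K * (C * norm ?x) * (C * norm s) * (rv_norm T n powr (- \<sigma>) * rv_norm T n powr (- \<sigma>))"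
      by (simp add: mult_ac)
    also have "rv_norm T n powr (- \<sigma>) * rv_norm T n powr (- \<sigma>) = rv_norm T n powr (- (2 * \<sigma>))"
      by (simp flip: powr_add)
    finally show ?thesis .
  qed
  moreover have "(\<lambda>n. K * (C * norm ?x) * (C * norm s) * rv_norm T n powr (- (2 * \<sigma>))) \<longlonglongrightarrow>
      K * (C * norm ?x) * (C * norm s) * 0"
    by (intro tendsto_intros rv_norm_powr_tendsto_0[OF T]) (use \<sigma>(1) in simp)
  ultimately have "\<bar>x \<bullet> s\<bar> \<le> K * (C * norm ?x) * (C * norm s) * 0"
    by (intro LIMSEQ_le_const) auto
  then show ?thesis by simp
qed

section \<open>Distances to a linear subspace\<close>

lemma infdist_add_subspace:
  fixes S :: "'b::euclidean_space set"
  assumes S: "subspace S"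
  shows "infdist (x + y) S \<le> infdist x S + infdist y S"
proof -
  have cl: "closed S" "S \<noteq> {}" using closed_subspace[OF S] subspace_0[OF S] by auto
  obtain s t where st: "s \<in> S" "infdist x S = dist x s" "t \<in> S" "infdist y S = dist y t"
    using infdist_attains_inf[OF cl] by metis
  have "infdist (x + y) S \<le> dist (x + y) (s + t)" by (rule infdist_le) (use st subspace_add[OF S] in auto)
  also have "\<dots> \<le> dist x s + dist y t" by (rule dist_triangle_add)
  finally show ?thesis using st by simp
qed

lemma infdist_sum_subspace:
  fixes S :: "'b::euclidean_space set"
  assumes S: "subspace S"
  shows "finite I \<Longrightarrow> infdist (\<Sum>i\<in>I. f i) S \<le> (\<Sum>i\<in>I. infdist (f i) S)"
proof (induction I rule: finite_induct)
  case empty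
  then show ?case using subspace_0[OF S] by simp
next
  case (insert i I)
  then show ?case using infdist_add_subspace[OF S, of "f i" "\<Sum>i\<in>I. f i"] by simp
qed

lemma infdist_le_norm: "subspace S \<Longrightarrow> infdist x S \<le> norm x"
  using infdist_le[OF subspace_0, of S x] by (simp add: dist_norm)

lemma infdist_minus_subspace:
  fixes S :: "'b::euclidean_space set"
  assumes S: "subspace S"
  shows "infdist (- x) S \<le> infdist x S"
proof -
  have cl: "closed S" "S \<noteq> {}" using closed_subspace[OF S] subspace_0[OF S] by auto
  obtain s where s: "s \<in> S" "infdist x S = dist x s" using infdist_attains_inf[OF cl] by metis
  have "infdist (- x) S \<le> dist (- x) (- s)" by (rule infdist_le) (use s subspace_neg[OF S] in auto)
  then show ?thesis using s(2) by (simp add: dist_minus)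
qed

text \<open>By compactness the unit sphere of W stays at positive distance from S. The inverse of
  this distance bounds the projection to W along S.\<close>

lemma supplement_projection_bounded:
  fixes W S :: "'b::euclidean_space set"
  assumes W: "subspace W" and S: "subspace S" and WS: "W \<inter> S = {0}"
  shows "\<exists>K>0. \<forall>w\<in>W. \<forall>s\<in>S. norm w \<le> K * norm (w + s)"
proof (cases "W \<inter> sphere 0 1 = {}")
  case True
  have "w = 0" if "w \<in> W" for w
  proof (rule ccontr)
    assume "w \<noteq> 0"
    then have "(1 / norm w) *\<^sub>R w \<in> W \<inter> sphere 0 1" using subspace_scale[OF W that] by simp
    then show False using True by blast
  qed
  then have *: "norm w = 0" if "w \<in> W" for w using that by (metis norm_zero)
  show ?thesis by (intro exI[of _ 1] conjI ballI, simp) (subst *, auto)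
next
  case False
  have cl: "closed S" "S \<noteq> {}" using closed_subspace[OF S] subspace_0[OF S] by auto
  have "compact (W \<inter> sphere 0 1)"
    using closed_subspace[OF W] by (intro closed_Int_compact) auto
  then obtain w0 where w0: "w0 \<in> W" "norm w0 = 1" "\<And>w. w \<in> W \<Longrightarrow> norm w = 1 \<Longrightarrow> infdist w0 S \<le> infdist w S"
  proof -
    have "continuous_on (W \<inter> sphere 0 1) (\<lambda>w. infdist w S)"
      by (rule continuous_on_infdist[OF continuous_on_id])
    then have "\<exists>x\<in>W \<inter> sphere 0 1. \<forall>y\<in>W \<inter> sphere 0 1. infdist x S \<le> infdist y S"
      by (rule continuous_attains_inf[OF \<open>compact (W \<inter> sphere 0 1)\<close> False])
    then show thesis using that by auto
  qed
  let ?e = "infdist w0 S"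
  have "w0 \<notin> S"
  proof
    assume "w0 \<in> S"
    then have "w0 = 0" using w0(1) WS by blast
    then show False using w0(2) by simp
  qed
  then have e: "0 < ?e" using infdist_pos_not_in_closed[OF cl] by blast
  have "norm w \<le> 1 / ?e * norm (w + s)" if ws: "w \<in> W" "s \<in> S" for w s
  proof (cases "w = 0")
    case False
    let ?c = "1 / norm w"
    have "?e \<le> infdist (?c *\<^sub>R w) S" using False by (intro w0(3) subspace_scale[OF W ws(1)]) simp
    also have "\<dots> \<le> dist (?c *\<^sub>R w) (- (?c *\<^sub>R s))"
      by (intro infdist_le subspace_neg[OF S] subspace_scale[OF S] ws)
    also have "\<dots> = norm (w + s) / norm w" by (simp add: dist_norm scaleR_add_right[symmetric] del: scaleR_add_right)
    finally show ?thesis using e False by (simp add: field_simps)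
  qed (use infdist_nonneg[of w0 S] in simp)
  then show ?thesis using e by (intro exI[of _ "1 / ?e"]) auto
qed

section \<open>Approximation by the unstable space\<close>


lemma half_less_one: "1 / 2 < (1::real)"
  by simp

lemma powr_interpolate:
  fixes x :: real
  assumes "0 \<le> x" "x \<le> a" "x \<le> b" "0 < \<theta>" "\<theta> < 1"
  shows "x \<le> a powr (1 - \<theta>) * b powr \<theta>"
proof (cases "x = 0")
  case False
  then have "x = x powr (1 - \<theta>) * x powr \<theta>" using assms(1) by (simp flip: powr_add)
  also have "\<dots> \<le> a powr (1 - \<theta>) * b powr \<theta>" using assms by (intro mult_mono powr_mono2) auto
  finally show ?thesis .
qed simp

text \<open>The stable hypothesis is stated on the images of \<open>Gamma_s T\<close> under the
  cocycle; by \<open>Gamma_s_push\<close> they lie in the stable spaces of the renormalized maps, so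
  a bound on \<open>Bs_norm\<close> yields it. Euclidean norms give access to orthogonality.\<close>

locale stable_cocycle =
  fixes T :: "'a::finite iem" and \<Gamma>u :: "(real^'a) set"
  assumes T: "iem T" "no_connection T"
    and steps: "\<And>\<tau>. \<tau> > 0 \<Longrightarrow> \<exists>C\<ge>1. \<forall>n. real n \<le> C * rv_norm T n powr \<tau>"
    and stable: "\<And>\<tau>. \<tau> > 0 \<Longrightarrow> \<exists>C>0. \<forall>m k. \<forall>s\<in>(*v) (KZ T m) ` Gamma_s T.
      norm (KZ (RV T m) k *v s) \<le> C * rv_norm T (m + k) powr \<tau> * norm s"
    and dim: "rank (Omega T) \<le> 2 * dim (Gamma_s T) + 1"
    and supp: "supplement \<Gamma>u (Gamma_s T) (range ((*v) (Omega T)))"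
begin

abbreviation (input) "N \<equiv> rv_norm T"
abbreviation (input) "S n \<equiv> (*v) (KZ T n) ` Gamma_s T"
abbreviation (input) "Rg n \<equiv> range ((*v) (Omega (RV T n)))"

lemma S_0: "S 0 = Gamma_s T" and Im_0: "Rg 0 = range ((*v) (Omega T))"
  by (auto simp: RV_0)

lemma u_subspace: "subspace \<Gamma>u" and u_Int: "\<Gamma>u \<inter> Gamma_s T = {0}"
  and u_sum: "{x + y | x y. x \<in> \<Gamma>u \<and> y \<in> Gamma_s T} = Rg 0"
  using supp by (auto simp: supplement_def RV_0)

lemma S_subspace: "subspace (S n)"
  by (rule subspace_KZ_image[OF subspace_Gamma_s[OF T]])

lemma s_subset: "Gamma_s T \<subseteq> Rg 0"
proof
  fix y assume "y \<in> Gamma_s T"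
  then have "0 + y \<in> {x + y | x y. x \<in> \<Gamma>u \<and> y \<in> Gamma_s T}" using subspace_0[OF u_subspace] by blast
  then show "y \<in> Rg 0" unfolding u_sum by simp
qed

lemma u_subset: "\<Gamma>u \<subseteq> Rg 0"
proof
  fix x assume "x \<in> \<Gamma>u"
  then have "x + 0 \<in> {x + y | x y. x \<in> \<Gamma>u \<and> y \<in> Gamma_s T}"
    using subspace_0[OF subspace_Gamma_s[OF T]] by blast
  then show "x \<in> Rg 0" unfolding u_sum by simp
qed

lemma S_subset: "S n \<subseteq> Rg n"
  using KZ_range_Omega[OF T] s_subset by (auto simp: RV_0)

lemma N_ge_1: "1 \<le> N n" and N_mono: "m \<le> n \<Longrightarrow> N m \<le> N n" and N_0: "N 0 = 1"
  using rv_norm_ge_1[OF T] rv_norm_mono[OF T] rv_norm_0[OF T] by auto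

lemma duality:
  obtains K where "K > 0" "\<And>m k b c. 0 \<le> b \<Longrightarrow> c \<in> Rg m \<Longrightarrow>
    (\<And>s. s \<in> S m \<Longrightarrow> norm (KZ (RV T m) k *v s) \<le> b * norm s) \<Longrightarrow>
    infdist c (S m) \<le> K * b * infdist (KZ (RV T m) k *v c) (S (m + k))"
proof -
  have sub: "Gamma_s T \<subseteq> range ((*v) (Omega T))" using s_subset by (simp add: RV_0)
  obtain K where K: "K > 0" "\<forall>m k b c. 0 \<le> b \<longrightarrow> c \<in> Rg m \<longrightarrow>
      (\<forall>s\<in>S m. norm (KZ (RV T m) k *v s) \<le> b * norm s) \<longrightarrow>
      infdist c (S m) \<le> K * b * infdist (KZ (RV T m) k *v c) (S (m + k))"
    using infdist_duality[OF T subspace_Gamma_s[OF T] sub Gamma_s_isotropic[OF T sub] dim] by blast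
  show thesis
  proof (rule that[OF K(1)])
    fix m k b c assume "0 \<le> b" "c \<in> Rg m" "\<And>s. s \<in> S m \<Longrightarrow> norm (KZ (RV T m) k *v s) \<le> b * norm s"
    then show "infdist c (S m) \<le> K * b * infdist (KZ (RV T m) k *v c) (S (m + k))"
      by (intro K(2)[rule_format]) auto
  qed
qed

text \<open>Two bounds for the same ratio are combined: subpolynomial growth from m to m + k, and
  decay from time 0 after pulling the vector back, which costs N m.\<close>

lemma stable_interpolated:
  assumes \<theta>: "0 < \<theta>" "\<theta> < 1"
  shows "\<exists>C>0. \<exists>\<rho>>0. \<forall>m k. \<forall>s\<in>S m.
    norm (KZ (RV T m) k *v s) \<le> C * N (m + k) powr (- \<rho>) * N m powr \<theta> * norm s"
proof -
  obtain \<sigma> C0 where \<sigma>: "\<sigma> > 0" "C0 > 0"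
    "\<And>c n. c \<in> Gamma_s T \<Longrightarrow> norm (KZ T n *v c) \<le> C0 * N n powr (- \<sigma>) * norm c"
    using Gamma_s_uniform_decay[OF T] by blast
  obtain K where K: "K > 0" "\<And>(T :: 'a iem) c. c \<in> range ((*v) (Omega T)) \<Longrightarrow>
      \<exists>q. Omega T *v q = c \<and> norm q \<le> K * norm c"
    using Omega_uniform_preimage by blast
  let ?D = "real CARD('a) ^ 2"
  define C1 where "C1 = ?D * ?D * K"
  have C1: "C1 > 0" using K(1) by (simp add: C1_def)
  \<comment> \<open>With this choice the interpolated exponent \<tau>(1 - \<theta>) -
    \<sigma>\<theta> is at most -\<tau>, so \<tau> itself serves as \<rho>.\<close>
  define \<tau> where "\<tau> = \<sigma> * \<theta> / 2"
  have \<tau>: "\<tau> > 0" using \<sigma>(1) \<theta> by (simp add: \<tau>_def)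
  obtain C2 where C2: "C2 > 0" "\<And>m k s. s \<in> S m \<Longrightarrow> norm (KZ (RV T m) k *v s) \<le> C2 * N (m + k) powr \<tau> * norm s"
    using stable[OF \<tau>] by blast
  define C where "C = C2 powr (1 - \<theta>) * (C0 * C1) powr \<theta>"
  have "norm (KZ (RV T m) k *v s) \<le> C * N (m + k) powr (- \<tau>) * N m powr \<theta> * norm s" if s: "s \<in> S m" for m k s
  proof (cases "s = 0")
    case False
    let ?x = "norm (KZ (RV T m) k *v s) / norm s"
    obtain s0 where s0: "s0 \<in> Gamma_s T" "s = KZ T m *v s0" using s by auto
    have N: "0 < N (m + k)" "0 < N m" using N_ge_1[of "m + k"] N_ge_1[of m] by auto
    obtain q where q: "Omega (RV T m) *v q = s" "norm q \<le> K * norm s" using K(2) s S_subset by blast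
    \<comment> \<open>The inverse of the cocycle on the image of \<open>Omega\<close> is written
      with the transpose, whose norm is comparable to N m.\<close>
    have "KZ T m *v (s0 - Omega T *v (transpose (KZ T m) *v q)) = 0"
      using q(1) s0(2) Omega_RV_vec[OF T, of m q] by (simp add: matrix_vector_mult_diff_distrib)
    then have "s0 = Omega T *v (transpose (KZ T m) *v q)" using KZ_zero[OF T] by fastforce
    then have "norm s0 \<le> ?D * norm (transpose (KZ T m) *v q)" by (metis norm_Omega_vec)
    also have "\<dots> \<le> ?D * (?D * N m * norm q)"
      unfolding rv_norm_def by (intro mult_left_mono norm_transpose_vec_le) auto
    also have "\<dots> \<le> ?D * (?D * N m * (K * norm s))"
      using q(2) N by (intro mult_left_mono) auto
    finally have ns0: "norm s0 \<le> C1 * N m * norm s" by (simp add: C1_def mult_ac)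
    have "norm (KZ (RV T m) k *v s) = norm (KZ T (m + k) *v s0)"
      by (simp add: s0(2) KZ_add matrix_vector_mul_assoc)
    also have "\<dots> \<le> C0 * N (m + k) powr (- \<sigma>) * norm s0" by (rule \<sigma>(3)[OF s0(1)])
    also have "\<dots> \<le> C0 * N (m + k) powr (- \<sigma>) * (C1 * N m * norm s)"
      using \<sigma>(2) by (intro mult_left_mono ns0) auto
    finally have 1: "?x \<le> C0 * C1 * N (m + k) powr (- \<sigma>) * N m"
      using False by (simp add: pos_divide_le_eq mult_ac)
    have 2: "?x \<le> C2 * N (m + k) powr \<tau>" using C2(2)[OF s, of k] False by (simp add: pos_divide_le_eq)
    have "?x \<le> (C2 * N (m + k) powr \<tau>) powr (1 - \<theta>) * (C0 * C1 * N (m + k) powr (- \<sigma>) * N m) powr \<theta>"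
      by (rule powr_interpolate[OF _ 2 1 \<theta>]) simp
    also have "\<dots> = C * N (m + k) powr (\<tau> * (1 - \<theta>) - \<sigma> * \<theta>) * N m powr \<theta>"
    proof -
      have "(C2 * N (m + k) powr \<tau>) powr (1 - \<theta>) = C2 powr (1 - \<theta>) * N (m + k) powr (\<tau> * (1 - \<theta>))"
        using C2(1) by (simp add: powr_mult powr_powr)
      moreover have "(C0 * C1 * N (m + k) powr (- \<sigma>) * N m) powr \<theta> =
          (C0 * C1) powr \<theta> * N (m + k) powr (- \<sigma> * \<theta>) * N m powr \<theta>"
        using C1 \<sigma>(2) N by (simp only: powr_mult powr_powr)
      moreover have "N (m + k) powr (\<tau> * (1 - \<theta>) - \<sigma> * \<theta>) =
          N (m + k) powr (\<tau> * (1 - \<theta>)) * N (m + k) powr (- \<sigma> * \<theta>)"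
        by (simp flip: powr_add)
      ultimately show ?thesis by (simp only: C_def mult_ac)
    qed
    also have "\<dots> \<le> C * N (m + k) powr (- \<tau>) * N m powr \<theta>"
    proof -
      have "\<tau> * (1 - \<theta>) - \<sigma> * \<theta> \<le> - \<tau>"
        using \<tau> \<theta> \<sigma>(1) by (simp add: \<tau>_def algebra_simps)
      then show ?thesis using N_ge_1[of "m + k"] by (intro mult_right_mono mult_left_mono powr_mono) (auto simp: C_def)
    qed
    finally show ?thesis using False by (simp add: pos_divide_le_eq)
  qed simp
  moreover have "C > 0" using C1 C2(1) \<sigma>(2) by (simp add: C_def)
  ultimately show ?thesis using \<tau> by blast
qed

text \<open>The step count with exponent \<rho>/2, squared, compares the terms with the inverse
  squares.\<close>

lemma summable_N_powr:
  assumes "\<rho> > 0" shows "summable (\<lambda>n. N n powr (- \<rho>))"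
proof -
  obtain C where C: "C \<ge> 1" "\<And>n. real n \<le> C * N n powr (\<rho> / 2)" using steps[of "\<rho> / 2"] assms by auto
  have bound: "norm (N n powr (- \<rho>)) \<le> C ^ 2 * inverse (real n ^ 2)" if n: "n \<ge> 1" for n
  proof -
    have N: "0 < N n" using N_ge_1[of n] by simp
    have "real n ^ 2 \<le> (C * N n powr (\<rho> / 2)) ^ 2" by (rule power_mono[OF C(2)]) simp
    also have "\<dots> = C ^ 2 * N n powr \<rho>"
      by (simp add: power_mult_distrib power2_eq_square flip: powr_add)
    finally have "real n ^ 2 * N n powr (- \<rho>) \<le> C ^ 2 * (N n powr \<rho> * N n powr (- \<rho>))"
      by (simp add: mult_right_mono mult.assoc[symmetric])
    then have "real n ^ 2 * N n powr (- \<rho>) \<le> C ^ 2" using N by (simp flip: powr_add)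
    then show ?thesis using n by (simp add: field_simps)
  qed
  have "summable (\<lambda>n. C ^ 2 * inverse (real n ^ 2))"
    by (intro summable_mult inverse_power_summable) simp
  then show ?thesis by (rule summable_comparison_test'[OF _ bound])
qed

lemma KZ_Suc_vec: "KZ T (Suc n) *v x = elem (RV T n) *v (KZ T n *v x)"
  by (simp add: matrix_vector_mul_assoc)

text \<open>Pseudo-orbits of the cocycle with error M at each step. The vectors approximating the
  special Birkhoff sums of \<phi> form one, with M proportional to the C^1 norm of \<phi>.\<close>

definition admissible :: "(nat \<Rightarrow> real^'a) \<Rightarrow> real \<Rightarrow> bool" where
  "admissible \<psi> M \<longleftrightarrow> 0 \<le> M \<and> (\<forall>n. \<psi> n \<in> Rg n) \<and> norm (\<psi> 0) \<le> M \<and>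
     (\<forall>n. norm (\<psi> (Suc n) - elem (RV T n) *v \<psi> n) \<le> M)"

text \<open>The vectors x n are the pullbacks of \<psi> n to time 0. Convergence to c is asked only
  modulo the stable space, since the stable components of the pullbacks need not converge.\<close>

definition shadows :: "(nat \<Rightarrow> real^'a) \<Rightarrow> real^'a \<Rightarrow> bool" where
  "shadows \<psi> c \<longleftrightarrow> (\<exists>x. (\<forall>n. x n \<in> Rg 0 \<and> KZ T n *v x n = \<psi> n) \<and>
     (\<lambda>n. infdist (x n - c) (Gamma_s T)) \<longlonglongrightarrow> 0)"

text \<open>By duality the increments d n of the pullbacks are summably close to the stable space.
  Removing from each its nearest stable vector e n gives a convergent series; its limit y stays in
  the image of \<open>Omega\<close>, and c is the component of y in \<Gamma>u.\<close>

lemma shadow_exists: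
  "\<exists>K>0. \<forall>\<psi> M. admissible \<psi> M \<longrightarrow> (\<exists>c\<in>\<Gamma>u. norm c \<le> K * M \<and> shadows \<psi> c)"
proof -
  have Ss: "subspace (Gamma_s T)" by (rule subspace_Gamma_s[OF T])
  have cl: "closed (Gamma_s T)" "Gamma_s T \<noteq> {}" using closed_subspace[OF Ss] subspace_0[OF Ss] by auto
  obtain Kd where Kd: "Kd > 0" "\<And>m k b c. 0 \<le> b \<Longrightarrow> c \<in> Rg m \<Longrightarrow>
    (\<And>s. s \<in> S m \<Longrightarrow> norm (KZ (RV T m) k *v s) \<le> b * norm s) \<Longrightarrow>
    infdist c (S m) \<le> Kd * b * infdist (KZ (RV T m) k *v c) (S (m + k))" using duality by blast
  \<comment> \<open>Everything starts at time 0, where N equals 1 and the loss disappears; any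
    weight in (0, 1) would do.\<close>
  obtain C \<rho> where C: "C > 0" "\<rho> > 0" "\<And>m k s. s \<in> S m \<Longrightarrow>
    norm (KZ (RV T m) k *v s) \<le> C * N (m + k) powr (- \<rho>) * N m powr (1/2) * norm s"
    using stable_interpolated[OF half_gt_zero[OF zero_less_one] half_less_one] by blast
  obtain Ku where Ku: "Ku > 0" "\<And>w s. w \<in> \<Gamma>u \<Longrightarrow> s \<in> Gamma_s T \<Longrightarrow> norm w \<le> Ku * norm (w + s)"
    using supplement_projection_bounded[OF u_subspace Ss u_Int] by blast
  define g where "g = (\<lambda>n. Kd * C * N (Suc n) powr (- \<rho>))"
  have g0: "0 \<le> g n" for n using Kd(1) C(1) by (simp add: g_def)
  have sg: "summable g" unfolding g_def
    using summable_N_powr[OF C(2)] by (intro summable_mult) (simp add: summable_Suc_iff[of "\<lambda>n. N n powr (- \<rho>)"])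
  have sg0: "0 \<le> suminf g" using g0 sg by (simp add: suminf_nonneg)
  have "\<exists>c\<in>\<Gamma>u. norm c \<le> (Ku * (1 + suminf g)) * M \<and> shadows \<psi> c" if adm: "admissible \<psi> M" for \<psi> M
  proof -
    have M: "0 \<le> M" "\<And>n. \<psi> n \<in> Rg n" "norm (\<psi> 0) \<le> M" "\<And>n. norm (\<psi> (Suc n) - elem (RV T n) *v \<psi> n) \<le> M"
      using adm by (auto simp: admissible_def)
    have "\<exists>y. y \<in> Rg 0 \<and> KZ T n *v y = \<psi> n" for n
      using KZ_range_Omega_preimage[OF T M(2)[of n]] by (auto simp: RV_0)
    then obtain x where x: "\<And>n. x n \<in> Rg 0" "\<And>n. KZ T n *v x n = \<psi> n" by metis
    have x0: "x 0 = \<psi> 0" using x(2)[of 0] by simp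
    define d where "d n = x (Suc n) - x n" for n
    have d_Im: "d n \<in> Rg 0" for n unfolding d_def by (intro subspace_diff subspace_range_Omega x)
    have "infdist (d n) (Gamma_s T) \<le> g n * M" for n
    proof -
      have Kd_n: "KZ T (Suc n) *v d n = \<psi> (Suc n) - elem (RV T n) *v \<psi> n"
        unfolding d_def matrix_vector_mult_diff_distrib x(2) KZ_Suc_vec ..
      have "infdist (d n) (S 0) \<le> Kd * (C * N (Suc n) powr (- \<rho>)) * infdist (KZ (RV T 0) (Suc n) *v d n) (S (0 + Suc n))"
      proof (rule Kd(2)[OF _ d_Im])
        fix s assume s: "s \<in> S 0"
        show "norm (KZ (RV T 0) (Suc n) *v s) \<le> C * N (Suc n) powr (- \<rho>) * norm s"
          using C(3)[OF s, of "Suc n"] by (simp add: N_0 del: KZ.simps(2))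
      qed (use C(1) in simp)
      also have "\<dots> \<le> Kd * (C * N (Suc n) powr (- \<rho>)) * M"
      proof (rule mult_left_mono)
        have "infdist (KZ T (Suc n) *v d n) (S (Suc n)) \<le> norm (KZ T (Suc n) *v d n)"
          by (rule infdist_le_norm[OF S_subspace])
        also have "\<dots> \<le> M" unfolding Kd_n by (rule M(4))
        finally show "infdist (KZ (RV T 0) (Suc n) *v d n) (S (0 + Suc n)) \<le> M" by (simp only: RV_0 add_0)
      qed (use Kd(1) C(1) in simp)
      finally show ?thesis unfolding S_0 g_def by (simp add: mult_ac)
    qed
    note d_bound = this
    have "\<exists>e. e \<in> Gamma_s T \<and> infdist (d n) (Gamma_s T) = dist (d n) e" for n
      using infdist_attains_inf[OF cl, of "d n"] by metis
    then obtain e where e: "\<And>n. e n \<in> Gamma_s T" "\<And>n. infdist (d n) (Gamma_s T) = dist (d n) (e n)" by metis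
    have ne: "norm (d n - e n) \<le> g n * M" for n using d_bound[of n] e(2)[of n] by (simp add: dist_norm)
    have sn: "summable (\<lambda>n. norm (d n - e n))"
      by (rule summable_comparison_test'[OF summable_mult2[OF sg, of M], of 0]) (use ne in auto)
    define z where "z n = \<psi> 0 + (\<Sum>i<n. d i - e i)" for n
    define y where "y = \<psi> 0 + (\<Sum>i. d i - e i)"
    have lim: "z \<longlonglongrightarrow> y" unfolding z_def y_def
      by (intro tendsto_add tendsto_const summable_LIMSEQ summable_norm_cancel[OF sn])
    have zx: "x n - z n \<in> Gamma_s T" for n
    proof -
      have "(\<Sum>i<n. d i) = x n - x 0" unfolding d_def by (rule sum_lessThan_telescope)
      then have "x n - z n = (\<Sum>i<n. e i)" by (simp add: z_def sum_subtractf x0)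
      moreover have "(\<Sum>i<n. e i) \<in> Gamma_s T" by (rule subspace_sum[OF Ss]) (rule e(1))
      ultimately show ?thesis by simp
    qed
    have "z n \<in> Rg 0" for n
    proof -
      have "x n - (x n - z n) \<in> Rg 0"
        by (rule subspace_diff[OF subspace_range_Omega x(1) subsetD[OF s_subset zx]])
      then show ?thesis by simp
    qed
    then have y_Im: "y \<in> Rg 0" using closed_sequentially[OF closed_subspace[OF subspace_range_Omega]] lim by blast
    have "norm y \<le> (1 + suminf g) * M"
    proof -
      have "norm (\<Sum>i. d i - e i) \<le> (\<Sum>i. norm (d i - e i))" by (rule summable_norm[OF sn])
      also have "\<dots> \<le> (\<Sum>i. g i * M)" by (rule suminf_le[OF ne sn summable_mult2[OF sg]])
      also have "\<dots> = suminf g * M" by (rule suminf_mult2[OF sg, symmetric])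
      finally have "norm y \<le> norm (\<psi> 0) + suminf g * M" unfolding y_def using norm_triangle_ineq order_trans add_left_mono by blast
      then show ?thesis using M(3) by (simp add: algebra_simps)
    qed
    note ny = this
    obtain c s where cs: "c \<in> \<Gamma>u" "s \<in> Gamma_s T" "y = c + s" using y_Im u_sum by blast
    have nc: "norm c \<le> (Ku * (1 + suminf g)) * M"
      using Ku(2)[OF cs(1,2)] mult_left_mono[OF ny less_imp_le[OF Ku(1)]] by (simp add: cs(3) mult.assoc)
    have near: "infdist (x n - c) (Gamma_s T) \<le> norm (z n - y)" for n
    proof -
      have "(x n - z n) + s \<in> Gamma_s T" by (rule subspace_add[OF Ss zx cs(2)])
      then have "infdist (x n - c) (Gamma_s T) \<le> dist (x n - c) ((x n - z n) + s)" by (rule infdist_le)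
      also have "\<dots> = norm (z n - y)" by (simp add: dist_norm cs(3) algebra_simps)
      finally show ?thesis .
    qed
    have "(\<lambda>n. norm (z n - y)) \<longlonglongrightarrow> 0" using lim by (simp add: LIM_zero tendsto_norm_zero)
    moreover have "\<forall>\<^sub>F n in sequentially. norm (infdist (x n - c) (Gamma_s T)) \<le> norm (z n - y)"
      using near by (intro always_eventually allI) (simp add: infdist_nonneg)
    ultimately have "(\<lambda>n. infdist (x n - c) (Gamma_s T)) \<longlonglongrightarrow> 0"
      by (rule Lim_null_comparison[rotated])
    then have "shadows \<psi> c" unfolding shadows_def by (intro exI[of _ x]) (simp only: x simp_thms)
    then show ?thesis using cs(1) nc by blast
  qed
  moreover have "0 < Ku * (1 + suminf g)" using Ku(1) sg0 by simp
  ultimately show ?thesis by blast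
qed

lemma norm_elem_vec: "norm (elem (RV T n) *v x) \<le> real CARD('a) ^ 2 * norm x"
proof -
  have "mat_norm (elem (RV T n)) \<le> real CARD('a)"
  proof (rule mat_norm_leI)
    fix \<alpha> :: 'a
    have "\<And>\<beta>. \<bar>elem (RV T n) $ \<alpha> $ \<beta>\<bar> \<le> 1" by (simp add: elem_def)
    then show "(\<Sum>\<beta>\<in>UNIV. \<bar>elem (RV T n) $ \<alpha> $ \<beta>\<bar>) \<le> real CARD('a)"
      using sum_bounded_above[of UNIV "\<lambda>\<beta>. \<bar>elem (RV T n) $ \<alpha> $ \<beta>\<bar>" 1] by simp
  qed
  then have *: "real CARD('a) * mat_norm (elem (RV T n)) * norm x \<le> real CARD('a) * real CARD('a) * norm x"
    by (intro mult_right_mono mult_left_mono) auto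
  show ?thesis unfolding power2_eq_square by (rule order_trans[OF norm_mat_vec_le *])
qed

text \<open>The difference x n - c is, modulo the stable space, minus the sum of the later
  increments. Each is estimated at time n by duality between n and the time at which its error is at
  most M; the interpolated bound sums the tail and leaves the factor N n powr \<theta>.\<close>

lemma shadow_quotient_bound:
  assumes \<theta>: "0 < \<theta>" "\<theta> < 1"
  shows "\<exists>C>0. \<forall>\<psi> M c n. admissible \<psi> M \<longrightarrow> shadows \<psi> c \<longrightarrow>
    infdist (\<psi> n - KZ T n *v c) (S n) \<le> C * N n powr \<theta> * M"
proof -
  obtain Kd where Kd: "Kd > 0" "\<And>m k b c. 0 \<le> b \<Longrightarrow> c \<in> Rg m \<Longrightarrow>
    (\<And>s. s \<in> S m \<Longrightarrow> norm (KZ (RV T m) k *v s) \<le> b * norm s) \<Longrightarrow>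
    infdist c (S m) \<le> Kd * b * infdist (KZ (RV T m) k *v c) (S (m + k))" using duality by blast
  obtain C \<rho> where C: "C > 0" "\<rho> > 0" "\<And>m k s. s \<in> S m \<Longrightarrow>
    norm (KZ (RV T m) k *v s) \<le> C * N (m + k) powr (- \<rho>) * N m powr \<theta> * norm s"
    using stable_interpolated[OF \<theta>] by blast
  define \<Sigma> where "\<Sigma> = (\<Sum>n. N n powr (- \<rho>))"
  have sN: "summable (\<lambda>n. N n powr (- \<rho>))" by (rule summable_N_powr[OF C(2)])
  have "infdist (\<psi> n - KZ T n *v c) (S n) \<le> (Kd * C * (1 + \<Sigma>)) * N n powr \<theta> * M"
    if adm: "admissible \<psi> M" and sh: "shadows \<psi> c" for \<psi> M c n
  proof -
    have M: "0 \<le> M" "\<And>n. \<psi> n \<in> Rg n" "\<And>n. norm (\<psi> (Suc n) - elem (RV T n) *v \<psi> n) \<le> M"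
      using adm by (auto simp: admissible_def)
    obtain x where x: "\<And>n. x n \<in> Rg 0" "\<And>n. KZ T n *v x n = \<psi> n"
      and lim: "(\<lambda>n. infdist (x n - c) (Gamma_s T)) \<longlonglongrightarrow> 0" using sh unfolding shadows_def by blast
    define d where "d n = x (Suc n) - x n" for n
    have d_Im: "KZ T n *v d i \<in> Rg n" for i
      using KZ_range_Omega[OF T, of "d i" n] subspace_diff[OF subspace_range_Omega x(1) x(1)]
      by (simp add: d_def RV_0)
    have d_bound: "infdist (KZ T n *v d (n + i)) (S n) \<le> Kd * C * N n powr \<theta> * M * N (n + Suc i) powr (- \<rho>)" for i
    proof -
      have e: "KZ (RV T n) (Suc i) *v (KZ T n *v d (n + i)) = \<psi> (Suc (n + i)) - elem (RV T (n + i)) *v \<psi> (n + i)"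
      proof -
        have "KZ (RV T n) (Suc i) *v (KZ T n *v d (n + i)) = KZ T (Suc (n + i)) *v d (n + i)"
          using KZ_add[of T n "Suc i"] by (simp only: add_Suc_right matrix_vector_mul_assoc)
        also have "\<dots> = \<psi> (Suc (n + i)) - elem (RV T (n + i)) *v \<psi> (n + i)"
          unfolding d_def matrix_vector_mult_diff_distrib x(2) KZ_Suc_vec ..
        finally show ?thesis .
      qed
      let ?b = "C * N (n + Suc i) powr (- \<rho>) * N n powr \<theta>"
      have "infdist (KZ T n *v d (n + i)) (S n) \<le>
          Kd * ?b * infdist (KZ (RV T n) (Suc i) *v (KZ T n *v d (n + i))) (S (n + Suc i))"
        by (rule Kd(2)[OF _ d_Im C(3)]) (use C(1) in simp)
      also have "\<dots> \<le> Kd * ?b * M"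
        using order_trans[OF infdist_le_norm[OF S_subspace, of _ "n + Suc i"] M(3)[of "n + i"]] Kd(1) C(1)
        unfolding e by (intro mult_left_mono) auto
      finally show ?thesis by (simp add: mult_ac)
    qed
    \<comment> \<open>Here j is free: for fixed n the first term tends to 0 as j grows, despite the
      factor N n, and the second does not depend on j.\<close>
    have "infdist (\<psi> n - KZ T n *v c) (S n) \<le>
        real CARD('a) * N n * infdist (x (n + j) - c) (Gamma_s T) + Kd * C * N n powr \<theta> * M * \<Sigma>" for j
    proof -
      have tele: "(\<Sum>i<j. d (n + i)) = x (n + j) - x n"
        unfolding d_def using sum_lessThan_telescope[of "\<lambda>i. x (n + i)" j] by simp
      have "\<psi> n - KZ T n *v c = KZ T n *v (x n - c)" by (simp add: matrix_vector_mult_diff_distrib x(2))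
      also have "x n - c = (x (n + j) - c) - (\<Sum>i<j. d (n + i))" unfolding tele by simp
      also have "KZ T n *v \<dots> = KZ T n *v (x (n + j) - c) + - (\<Sum>i<j. KZ T n *v d (n + i))"
        by (simp add: matrix_vector_mult_diff_distrib linear_sum[OF matrix_vector_mul_linear])
      finally have eq: "\<psi> n - KZ T n *v c = KZ T n *v (x (n + j) - c) + - (\<Sum>i<j. KZ T n *v d (n + i))" .
      have "infdist (\<psi> n - KZ T n *v c) (S n) \<le> infdist (KZ T n *v (x (n + j) - c)) (S n)
          + infdist (- (\<Sum>i<j. KZ T n *v d (n + i))) (S n)"
        unfolding eq by (rule infdist_add_subspace[OF S_subspace])
      moreover have "infdist (- (\<Sum>i<j. KZ T n *v d (n + i))) (S n) \<le> Kd * C * N n powr \<theta> * M * \<Sigma>"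
      proof -
        have "infdist (- (\<Sum>i<j. KZ T n *v d (n + i))) (S n) \<le> (\<Sum>i<j. infdist (KZ T n *v d (n + i)) (S n))"
          by (rule order_trans[OF infdist_minus_subspace[OF S_subspace] infdist_sum_subspace[OF S_subspace]]) simp
        also have "\<dots> \<le> (\<Sum>i<j. Kd * C * N n powr \<theta> * M * N (n + Suc i) powr (- \<rho>))"
          by (rule sum_mono) (rule d_bound)
        also have "\<dots> = Kd * C * N n powr \<theta> * M * (\<Sum>i<j. N (n + Suc i) powr (- \<rho>))"
          by (simp add: sum_distrib_left)
        also have "\<dots> \<le> Kd * C * N n powr \<theta> * M * \<Sigma>"
        proof (rule mult_left_mono)
          have "(\<Sum>i<j. N (n + Suc i) powr (- \<rho>)) = (\<Sum>i\<in>(\<lambda>i. n + Suc i) ` {..<j}. N i powr (- \<rho>))"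
            by (subst sum.reindex) (auto simp: inj_on_def)
          also have "\<dots> \<le> \<Sigma>" unfolding \<Sigma>_def by (rule sum_le_suminf[OF sN]) auto
          finally show "(\<Sum>i<j. N (n + Suc i) powr (- \<rho>)) \<le> \<Sigma>" .
        qed (use Kd(1) C(1) M(1) in simp)
        finally show ?thesis .
      qed
      moreover have "infdist (KZ T n *v (x (n + j) - c)) (S n) \<le> real CARD('a) * N n * infdist (x (n + j) - c) (Gamma_s T)"
      proof -
        have Ss: "subspace (Gamma_s T)" by (rule subspace_Gamma_s[OF T])
        have cl: "closed (Gamma_s T)" "Gamma_s T \<noteq> {}" using closed_subspace[OF Ss] subspace_0[OF Ss] by auto
        obtain s where s: "s \<in> Gamma_s T" "infdist (x (n + j) - c) (Gamma_s T) = dist (x (n + j) - c) s"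
          using infdist_attains_inf[OF cl] by metis
        have "infdist (KZ T n *v (x (n + j) - c)) (S n) \<le> dist (KZ T n *v (x (n + j) - c)) (KZ T n *v s)"
          by (rule infdist_le) (use s(1) in simp)
        also have "\<dots> = norm (KZ T n *v (x (n + j) - c - s))"
          by (simp add: dist_norm matrix_vector_mult_diff_distrib)
        also have "\<dots> \<le> real CARD('a) * N n * norm (x (n + j) - c - s)"
          unfolding rv_norm_def by (rule norm_mat_vec_le)
        finally show ?thesis using s(2) by (simp add: dist_norm)
      qed
      ultimately show ?thesis by linarith
    qed
    moreover have "(\<lambda>j. real CARD('a) * N n * infdist (x (n + j) - c) (Gamma_s T) + Kd * C * N n powr \<theta> * M * \<Sigma>)
      \<longlonglongrightarrow> real CARD('a) * N n * 0 + Kd * C * N n powr \<theta> * M * \<Sigma>"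
    proof (intro tendsto_intros)
      show "(\<lambda>j. infdist (x (n + j) - c) (Gamma_s T)) \<longlonglongrightarrow> 0"
        using LIMSEQ_ignore_initial_segment[OF lim, of n] by (simp add: add.commute)
    qed
    ultimately have "infdist (\<psi> n - KZ T n *v c) (S n) \<le> real CARD('a) * N n * 0 + Kd * C * N n powr \<theta> * M * \<Sigma>"
      by (intro LIMSEQ_le_const) auto
    also have "\<dots> \<le> (Kd * C * (1 + \<Sigma>)) * N n powr \<theta> * M"
    proof -
      have "0 \<le> Kd * C * N n powr \<theta> * M" using Kd(1) C(1) M(1) by simp
      then show ?thesis by (simp add: algebra_simps)
    qed
    finally show ?thesis .
  qed
  moreover have "0 < Kd * C * (1 + \<Sigma>)"
    using Kd(1) C(1) sN by (simp add: \<Sigma>_def suminf_nonneg add_pos_nonneg)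
  ultimately show ?thesis by blast
qed

text \<open>What remains is the stable component s n. It follows the cocycle up to errors e n that
  are themselves stable vectors, so variation of constants writes it as a sum of stable vectors
  transported forward, each of which is controlled by \<open>stable_interpolated\<close>.\<close>

lemma shadow_bound:
  assumes \<tau>: "\<tau> > 0"
  shows "\<exists>C>0. \<forall>\<psi> M c n. admissible \<psi> M \<longrightarrow> shadows \<psi> c \<longrightarrow> norm c \<le> K * M \<longrightarrow>
    norm (\<psi> n - KZ T n *v c) \<le> C * N n powr \<tau> * M"
proof -
  \<comment> \<open>Three factors N n powr \<theta> occur: the size of the errors, the loss in the
    interpolated bound, and the number of terms. The minimum keeps \<theta> below 1.\<close>
  define \<theta> where "\<theta> = min (\<tau> / 3) (1 / 2)"
  have \<theta>: "0 < \<theta>" "\<theta> < 1" "3 * \<theta> \<le> \<tau>" using \<tau> by (auto simp: \<theta>_def)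
  obtain C1 where C1: "C1 > 0" "\<And>\<psi> M c n. admissible \<psi> M \<Longrightarrow> shadows \<psi> c \<Longrightarrow>
    infdist (\<psi> n - KZ T n *v c) (S n) \<le> C1 * N n powr \<theta> * M" using shadow_quotient_bound[OF \<theta>(1,2)] by blast
  obtain Cb \<rho> where Cb: "Cb > 0" "\<rho> > 0" "\<And>m k s. s \<in> S m \<Longrightarrow>
    norm (KZ (RV T m) k *v s) \<le> Cb * N (m + k) powr (- \<rho>) * N m powr \<theta> * norm s"
    using stable_interpolated[OF \<theta>(1,2)] by blast
  obtain Cf where Cf: "Cf \<ge> 1" "\<And>n. real n \<le> Cf * N n powr \<theta>" using steps[OF \<theta>(1)] by blast
  let ?D = "real CARD('a) ^ 2"
  define C2 where "C2 = 1 + C1 + ?D * C1"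
  have C2: "C2 > 0" using C1(1) by (simp add: C2_def add_pos_nonneg)
  define C where "C = C1 + Cb * (1 + \<bar>K\<bar> + C1) + Cf * Cb * C2"
  have "norm (\<psi> n - KZ T n *v c) \<le> C * N n powr \<tau> * M"
    if adm: "admissible \<psi> M" and sh: "shadows \<psi> c" and nc: "norm c \<le> K * M" for \<psi> M c n
  proof -
    have M: "0 \<le> M" "\<And>n. \<psi> n \<in> Rg n" "norm (\<psi> 0) \<le> M" "\<And>n. norm (\<psi> (Suc n) - elem (RV T n) *v \<psi> n) \<le> M"
      using adm by (auto simp: admissible_def)
    define y where "y n = \<psi> n - KZ T n *v c" for n
    have "\<exists>s. s \<in> S n \<and> infdist (y n) (S n) = dist (y n) s" for n
    proof -
      have "closed (S n)" "S n \<noteq> {}" using closed_subspace[OF S_subspace] subspace_0[OF S_subspace, of n] by auto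
      then show ?thesis using infdist_attains_inf[of "S n" "y n"] by metis
    qed
    then obtain s where s: "\<And>n. s n \<in> S n" "\<And>n. infdist (y n) (S n) = dist (y n) (s n)" by metis
    define p where "p n = y n - s n" for n
    have np: "norm (p n) \<le> C1 * N n powr \<theta> * M" for n
      using C1(2)[OF adm sh, of n] s(2)[of n] by (simp add: p_def y_def dist_norm)
    define e where "e n = s (Suc n) - elem (RV T n) *v s n" for n
    have e_S: "e n \<in> S (Suc n)" for n
    proof -
      have "elem (RV T n) *v s n \<in> S (Suc n)" using s(1)[of n] by (auto simp: KZ_Suc_vec simp del: KZ.simps(2))
      then show ?thesis unfolding e_def by (intro subspace_diff[OF S_subspace] s(1))
    qed
    have ne: "norm (e n) \<le> C2 * N (Suc n) powr \<theta> * M" for n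
    proof -
      have en: "e n = (\<psi> (Suc n) - elem (RV T n) *v \<psi> n) - p (Suc n) + elem (RV T n) *v p n"
        unfolding e_def p_def y_def KZ_Suc_vec matrix_vector_mult_diff_distrib by (simp add: algebra_simps)
      have "norm (e n) \<le> norm (\<psi> (Suc n) - elem (RV T n) *v \<psi> n) + norm (p (Suc n)) + norm (elem (RV T n) *v p n)"
        unfolding en using norm_triangle_ineq[of "(\<psi> (Suc n) - elem (RV T n) *v \<psi> n) - p (Suc n)" "elem (RV T n) *v p n"]
          norm_triangle_ineq4[of "\<psi> (Suc n) - elem (RV T n) *v \<psi> n" "p (Suc n)"] by linarith
      moreover have "norm (elem (RV T n) *v p n) \<le> ?D * (C1 * N (Suc n) powr \<theta> * M)"
      proof -
        have "C1 * N n powr \<theta> * M \<le> C1 * N (Suc n) powr \<theta> * M"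
          using C1(1) M(1) \<theta>(1) N_ge_1[of n] N_mono[of n "Suc n"] by (intro mult_right_mono mult_left_mono powr_mono2) auto
        then have "?D * norm (p n) \<le> ?D * (C1 * N (Suc n) powr \<theta> * M)"
          using np[of n] by (intro mult_left_mono) auto
        then show ?thesis using norm_elem_vec[of n "p n"] by linarith
      qed
      moreover have "M \<le> N (Suc n) powr \<theta> * M"
        using M(1) ge_one_powr_ge_zero[OF N_ge_1[of "Suc n"], of \<theta>] \<theta>(1) mult_right_mono[of 1 "N (Suc n) powr \<theta>" M] by simp
      ultimately have "norm (e n) \<le> N (Suc n) powr \<theta> * M + C1 * N (Suc n) powr \<theta> * M + ?D * (C1 * N (Suc n) powr \<theta> * M)"
        using M(4)[of n] np[of "Suc n"] by linarith
      then show ?thesis by (simp add: C2_def algebra_simps)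
    qed
    have s_eq: "s n = KZ T n *v s 0 + (\<Sum>m<n. KZ (RV T (Suc m)) (n - Suc m) *v e m)" for n
    proof (induction n)
      case (Suc n)
      have "elem (RV T n) *v (KZ (RV T (Suc m)) (n - Suc m) *v e m) = KZ (RV T (Suc m)) (Suc n - Suc m) *v e m"
        if "m < n" for m
      proof -
        have "Suc n - Suc m = Suc (n - Suc m)" "Suc m + (n - Suc m) = n" using that by auto
        then show ?thesis by (simp add: RV_RV matrix_vector_mul_assoc)
      qed
      then have "elem (RV T n) *v (\<Sum>m<n. KZ (RV T (Suc m)) (n - Suc m) *v e m) =
          (\<Sum>m<n. KZ (RV T (Suc m)) (Suc n - Suc m) *v e m)"
        by (simp add: linear_sum[OF matrix_vector_mul_linear])
      moreover have "s (Suc n) = elem (RV T n) *v s n + e n" by (simp add: e_def)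
      ultimately show ?case
        by (simp only: Suc.IH matrix_vector_right_distrib KZ_Suc_vec sum.lessThan_Suc)
          (simp add: add.assoc)
    qed simp
    have N1: "1 \<le> N n powr \<theta>" using ge_one_powr_ge_zero[OF N_ge_1[of n], of \<theta>] \<theta>(1) by simp
    have Nrho: "N n powr (- \<rho>) \<le> 1" using powr_mono[of "- \<rho>" 0 "N n"] N_ge_1[of n] Cb(2) by simp
    have ns0: "norm (s 0) \<le> (1 + \<bar>K\<bar> + C1) * M"
    proof -
      have "s 0 = \<psi> 0 - c - p 0" by (simp add: p_def y_def)
      then have "norm (s 0) \<le> norm (\<psi> 0) + norm c + norm (p 0)"
        using norm_triangle_ineq4[of "\<psi> 0 - c" "p 0"] norm_triangle_ineq4[of "\<psi> 0" c] by simp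
      also have "\<dots> \<le> M + \<bar>K\<bar> * M + C1 * M"
        using M(1,3) nc np[of 0] mult_right_mono[OF abs_ge_self[of K] M(1)] by (simp add: N_0)
      finally show ?thesis by (simp add: algebra_simps)
    qed
    have t1: "norm (KZ T n *v s 0) \<le> Cb * (1 + \<bar>K\<bar> + C1) * M"
    proof -
      have "norm (KZ (RV T 0) n *v s 0) \<le> Cb * N (0 + n) powr (- \<rho>) * N 0 powr \<theta> * norm (s 0)" by (rule Cb(3)[OF s(1)])
      also have "\<dots> \<le> Cb * 1 * 1 * ((1 + \<bar>K\<bar> + C1) * M)"
        using Cb(1) Nrho by (intro mult_mono ns0) (auto simp: N_0)
      finally show ?thesis by (simp add: RV_0)
    qed
    have t2: "norm (\<Sum>m<n. KZ (RV T (Suc m)) (n - Suc m) *v e m) \<le> Cf * Cb * C2 * N n powr (3 * \<theta>) * M"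
    proof -
      have "norm (KZ (RV T (Suc m)) (n - Suc m) *v e m) \<le> Cb * C2 * N n powr (2 * \<theta>) * M" if m: "m < n" for m
      proof -
        have Nm: "N (Suc m) powr \<theta> \<le> N n powr \<theta>"
          using m \<theta>(1) N_ge_1[of "Suc m"] N_mono[of "Suc m" n] by (intro powr_mono2) auto
        have "Suc m + (n - Suc m) = n" using m by simp
        then have "norm (KZ (RV T (Suc m)) (n - Suc m) *v e m) \<le> Cb * N n powr (- \<rho>) * N (Suc m) powr \<theta> * norm (e m)"
          using Cb(3)[OF e_S[of m], of "n - Suc m"] by simp
        also have "\<dots> \<le> Cb * 1 * N n powr \<theta> * (C2 * N n powr \<theta> * M)"
        proof (intro mult_mono)
          have "C2 * N (Suc m) powr \<theta> * M \<le> C2 * N n powr \<theta> * M"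
            using C2 M(1) Nm by (intro mult_right_mono mult_left_mono) auto
          then show "norm (e m) \<le> C2 * N n powr \<theta> * M" using ne[of m] by linarith
        qed (use Cb(1) Nrho Nm in auto)
        also have "\<dots> = Cb * C2 * (N n powr \<theta> * N n powr \<theta>) * M" by simp
        also have "N n powr \<theta> * N n powr \<theta> = N n powr (2 * \<theta>)" by (simp flip: powr_add)
        finally show ?thesis .
      qed
      then have "norm (\<Sum>m<n. KZ (RV T (Suc m)) (n - Suc m) *v e m) \<le> (\<Sum>m<n. Cb * C2 * N n powr (2 * \<theta>) * M)"
        by (intro order_trans[OF norm_sum] sum_mono) auto
      also have "\<dots> = real n * (Cb * C2 * N n powr (2 * \<theta>) * M)" by simp
      also have "\<dots> \<le> (Cf * N n powr \<theta>) * (Cb * C2 * N n powr (2 * \<theta>) * M)"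
        using Cb(1) C2 M(1) by (intro mult_right_mono Cf(2)) auto
      also have "\<dots> = Cf * Cb * C2 * (N n powr \<theta> * N n powr (2 * \<theta>)) * M" by (simp add: mult_ac)
      also have "N n powr \<theta> * N n powr (2 * \<theta>) = N n powr (3 * \<theta>)" by (simp flip: powr_add)
      finally show ?thesis .
    qed
    let ?P = "N n powr \<tau>"
    have P: "N n powr \<theta> \<le> ?P" "N n powr (3 * \<theta>) \<le> ?P" "1 \<le> ?P"
      using N_ge_1[of n] \<theta> \<tau> by (auto intro!: powr_mono ge_one_powr_ge_zero)
    have "norm (y n) \<le> norm (p n) + norm (KZ T n *v s 0) + norm (\<Sum>m<n. KZ (RV T (Suc m)) (n - Suc m) *v e m)"
    proof -
      have yn: "y n = p n + (KZ T n *v s 0 + (\<Sum>m<n. KZ (RV T (Suc m)) (n - Suc m) *v e m))"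
        using s_eq[of n] by (simp add: p_def)
      show ?thesis unfolding yn using norm_triangle_ineq[of "p n" "KZ T n *v s 0 + (\<Sum>m<n. KZ (RV T (Suc m)) (n - Suc m) *v e m)"]
        norm_triangle_ineq[of "KZ T n *v s 0" "\<Sum>m<n. KZ (RV T (Suc m)) (n - Suc m) *v e m"] by linarith
    qed
    also have "\<dots> \<le> C1 * ?P * M + Cb * (1 + \<bar>K\<bar> + C1) * ?P * M + Cf * Cb * C2 * ?P * M"
    proof (intro add_mono)
      show "norm (p n) \<le> C1 * ?P * M"
        by (rule order_trans[OF np]) (use C1(1) M(1) P in \<open>intro mult_right_mono mult_left_mono, auto\<close>)
      have "Cb * (1 + \<bar>K\<bar> + C1) * 1 * M \<le> Cb * (1 + \<bar>K\<bar> + C1) * ?P * M"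
        using Cb(1) C1(1) M(1) P(3) by (intro mult_right_mono mult_left_mono) auto
      then show "norm (KZ T n *v s 0) \<le> Cb * (1 + \<bar>K\<bar> + C1) * ?P * M" using t1 by simp
      show "norm (\<Sum>m<n. KZ (RV T (Suc m)) (n - Suc m) *v e m) \<le> Cf * Cb * C2 * ?P * M"
        by (rule order_trans[OF t2]) (use Cf(1) Cb(1) C2 M(1) P in \<open>intro mult_right_mono mult_left_mono, auto\<close>)
    qed
    also have "\<dots> = C * ?P * M" by (simp add: C_def algebra_simps)
    finally show ?thesis by (simp add: y_def)
  qed
  moreover have "C > 0" using C1(1) Cb(1) C2 Cf(1) by (simp add: C_def add_pos_nonneg)
  ultimately show ?thesis by blast
qed

text \<open>Duality from 0 to n bounds the distance of c to the stable space by a decaying power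
  times a smaller growing one. Hence c is stable, and it lies in a supplement. This is the
  uniqueness of the correction.\<close>

lemma subpolynomial_unique:
  assumes c: "c \<in> \<Gamma>u" and bound: "\<And>\<tau>. \<tau> > 0 \<Longrightarrow> \<exists>C. \<forall>n. norm (KZ T n *v c) \<le> C * N n powr \<tau>"
  shows "c = 0"
proof -
  obtain Kd where Kd: "Kd > 0" "\<And>m k b c. 0 \<le> b \<Longrightarrow> c \<in> Rg m \<Longrightarrow>
    (\<And>s. s \<in> S m \<Longrightarrow> norm (KZ (RV T m) k *v s) \<le> b * norm s) \<Longrightarrow>
    infdist c (S m) \<le> Kd * b * infdist (KZ (RV T m) k *v c) (S (m + k))" using duality by blast
  obtain C \<rho> where C: "C > 0" "\<rho> > 0" "\<And>m k s. s \<in> S m \<Longrightarrow>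
    norm (KZ (RV T m) k *v s) \<le> C * N (m + k) powr (- \<rho>) * N m powr (1/2) * norm s"
    using stable_interpolated[OF half_gt_zero[OF zero_less_one] half_less_one] by blast
  obtain C' where C': "\<And>n. norm (KZ T n *v c) \<le> C' * N n powr (\<rho> / 2)" using bound[of "\<rho> / 2"] C(2) by auto
  have "infdist c (Gamma_s T) \<le> Kd * C * C' * N n powr (- (\<rho> / 2))" for n
  proof -
    have "infdist c (S 0) \<le> Kd * (C * N n powr (- \<rho>)) * infdist (KZ (RV T 0) n *v c) (S (0 + n))"
    proof (rule Kd(2))
      fix s assume s: "s \<in> S 0"
      show "norm (KZ (RV T 0) n *v s) \<le> C * N n powr (- \<rho>) * norm s" using C(3)[OF s, of n] by (simp add: N_0)
    qed (use C(1) c u_subset in auto)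
    also have "\<dots> \<le> Kd * (C * N n powr (- \<rho>)) * (C' * N n powr (\<rho> / 2))"
      using order_trans[OF infdist_le_norm[OF S_subspace] C'[of n]] Kd(1) C(1)
      by (intro mult_left_mono) (auto simp: RV_0)
    also have "\<dots> = Kd * C * C' * (N n powr (- \<rho>) * N n powr (\<rho> / 2))" by (simp add: mult_ac)
    also have "N n powr (- \<rho>) * N n powr (\<rho> / 2) = N n powr (- (\<rho> / 2))" by (simp flip: powr_add)
    finally show ?thesis by (simp add: S_0)
  qed
  moreover have "(\<lambda>n. Kd * C * C' * N n powr (- (\<rho> / 2))) \<longlonglongrightarrow> Kd * C * C' * 0"
    by (intro tendsto_intros rv_norm_powr_tendsto_0[OF T]) (use C(2) in simp)
  ultimately have "infdist c (Gamma_s T) \<le> Kd * C * C' * 0" by (intro LIMSEQ_le_const) auto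
  then have "infdist c (Gamma_s T) = 0" using infdist_nonneg[of c "Gamma_s T"] by simp
  moreover have Ss: "subspace (Gamma_s T)" by (rule subspace_Gamma_s[OF T])
  ultimately have "c \<in> Gamma_s T"
    using in_closed_iff_infdist_zero[OF closed_subspace[OF Ss]] subspace_0[OF Ss] by blast
  then show ?thesis using c u_Int by blast
qed

end

section \<open>From special to general Birkhoff sums\<close>


text \<open>The factor 2 comes from the loser, whose new value is a sum of two old ones.\<close>

lemma gstep_diff_bound:
  assumes T: "iem T" and g: "generic_ends T"
    and \<phi>: "\<And>\<alpha> x. x \<in> It_closed T \<alpha> \<Longrightarrow> \<bar>\<phi> \<alpha> x - c $ \<alpha>\<bar> \<le> E" and E: "0 \<le> E"
    and x: "x \<in> It_closed (step T) \<alpha>"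
  shows "\<bar>gstep T \<phi> \<alpha> x - (elem T *v c) $ \<alpha>\<bar> \<le> 2 * E"
proof (cases "\<alpha> = loser T")
  case True
  have "x \<in> It_closed T (last_b T)" "x + disp T (last_b T) \<in> It_closed T (last_t T)"
    using It_step_loser(2)[OF T g] x True by auto
  then have "\<bar>\<phi> (last_b T) x - c $ last_b T\<bar> \<le> E" "\<bar>\<phi> (last_t T) (x + disp T (last_b T)) - c $ last_t T\<bar> \<le> E"
    by (auto intro: \<phi>)
  then show ?thesis using True sum_lasts[OF T, of "($) c"] by (simp add: gstep_loser elem_vec[OF T])
next
  case False
  then have "\<bar>\<phi> \<alpha> x - c $ \<alpha>\<bar> \<le> E" using It_step_subset(2)[OF T g False] x by (intro \<phi>) auto
  then show ?thesis using False E by (simp add: gstep_other elem_vec[OF T])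
qed

lemma C1_special_birkhoff:
  fixes T :: "'a::finite iem"
  assumes T: "iem T" "no_connection T" and \<phi>: "\<phi> \<in> C_space 1 T"
  shows "special_birkhoff T 0 n (minus_Gamma \<phi> c) \<in> C_space 0 (RV T n)"
    and "x \<in> It_closed (RV T n) \<alpha> \<Longrightarrow>
      special_birkhoff T 0 n (minus_Gamma \<phi> c) \<alpha> x = SB T n \<phi> \<alpha> x - (KZ T n *v c) $ \<alpha>"
proof -
  have lip: "\<bar>minus_Gamma \<phi> c \<alpha> x - minus_Gamma \<phi> c \<alpha> y\<bar> \<le> C_norm 1 T \<phi> * \<bar>x - y\<bar>"
    if "x \<in> It_closed T \<alpha>" "y \<in> It_closed T \<alpha>" for \<alpha> x y
    using C1_lipschitz[OF \<phi> that] by (simp add: minus_Gamma_def of_Gamma_def)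
  have cont: "continuous_on (It_closed (RV T n) \<alpha>) (SB T n (minus_Gamma \<phi> c) \<alpha>)" for \<alpha>
    by (rule SB_continuous[OF T lip])
  have eq: "special_birkhoff T 0 n (minus_Gamma \<phi> c) \<alpha> x = SB T n (minus_Gamma \<phi> c) \<alpha> x"
    if "x \<in> It_closed (RV T n) \<alpha>" for \<alpha> x
    by (rule special_birkhoff_eq[OF T cont that])
  have "continuous_on (It_closed (RV T n) \<alpha>) (special_birkhoff T 0 n (minus_Gamma \<phi> c) \<alpha>)" for \<alpha>
    by (rule continuous_on_eq[OF cont]) (rule eq[symmetric])
  then show "special_birkhoff T 0 n (minus_Gamma \<phi> c) \<in> C_space 0 (RV T n)"
    by (simp add: C_space_def Cr_on_def nth_deriv_within_def)
  show "x \<in> It_closed (RV T n) \<alpha> \<Longrightarrow>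
      special_birkhoff T 0 n (minus_Gamma \<phi> c) \<alpha> x = SB T n \<phi> \<alpha> x - (KZ T n *v c) $ \<alpha>"
    using eq SB_minus_Gamma[OF T] by simp
qed

context stable_cocycle
begin

lemma admissible_approximation:
  "\<exists>E\<ge>0. \<forall>\<phi>\<in>C1_0 T. \<exists>\<psi>. admissible \<psi> (E * C_norm 1 T \<phi>) \<and>
    (\<forall>n \<alpha>. \<forall>x\<in>It_closed (RV T n) \<alpha>. \<bar>SB T n \<phi> \<alpha> x - \<psi> n $ \<alpha>\<bar> \<le> E * C_norm 1 T \<phi>)"
proof -
  let ?D = "real CARD('a)"
  define E0 where "E0 = (1 + ?D) * sum (len T) UNIV"
  have E0: "0 \<le> E0" using iem_len[OF T(1)] by (simp add: E0_def sum_nonneg less_imp_le)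
  have D: "1 \<le> ?D" using iem_card[OF T(1)] by simp
  \<comment> \<open>Dominates three errors: E0 for the approximation, 1 + E0 for the initial vector,
    and 3 * E0 for one step, twice E0 through \<open>gstep\<close> plus once afterwards. The factor
    d passes from components to the Euclidean norm.\<close>
  define E where "E = ?D * (1 + 3 * E0)"
  have E0E: "E0 \<le> E" "?D * (1 + E0) \<le> E" "?D * (3 * E0) \<le> E"
  proof -
    have "1 * (1 + 3 * E0) \<le> E" unfolding E_def by (rule mult_right_mono[OF D]) (use E0 in simp)
    moreover have "E0 \<le> 1 * (1 + 3 * E0)" using E0 by simp
    ultimately show "E0 \<le> E" by (rule order_trans[rotated])
    show "?D * (1 + E0) \<le> E" "?D * (3 * E0) \<le> E" unfolding E_def using E0 by (auto intro!: mult_left_mono)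
  qed
  have "\<exists>\<psi>. admissible \<psi> (E * C_norm 1 T \<phi>) \<and>
    (\<forall>n \<alpha>. \<forall>x\<in>It_closed (RV T n) \<alpha>. \<bar>SB T n \<phi> \<alpha> x - \<psi> n $ \<alpha>\<bar> \<le> E * C_norm 1 T \<phi>)"
    if \<phi>: "\<phi> \<in> C1_0 T" for \<phi>
  proof -
    let ?K = "C_norm 1 T \<phi>"
    have \<phi>1: "\<phi> \<in> C_space 1 T" using \<phi> by (simp add: C1_0_def)
    have K: "0 \<le> ?K" by (rule C_norm_nonneg[OF T(1) \<phi>1])
    have "\<forall>n. \<exists>c. c \<in> Rg n \<and> (\<forall>\<alpha>. \<forall>x\<in>It_closed (RV T n) \<alpha>. \<bar>SB T n \<phi> \<alpha> x - c $ \<alpha>\<bar> \<le> E0 * ?K)"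
      using special_birkhoff_near_range_Omega[OF T \<phi>] unfolding E0_def Bex_def by (rule allI)
    from choice[OF this] obtain \<psi> where \<psi>': "\<forall>n. \<psi> n \<in> Rg n \<and> (\<forall>\<alpha>. \<forall>x\<in>It_closed (RV T n) \<alpha>. \<bar>SB T n \<phi> \<alpha> x - \<psi> n $ \<alpha>\<bar> \<le> E0 * ?K)"
      ..
    then have \<psi>: "\<And>n. \<psi> n \<in> Rg n"
      "\<And>n \<alpha> x. x \<in> It_closed (RV T n) \<alpha> \<Longrightarrow> \<bar>SB T n \<phi> \<alpha> x - \<psi> n $ \<alpha>\<bar> \<le> E0 * ?K" by blast+
    have E0K: "0 \<le> E0 * ?K" using E0 K by simp
    have "norm (\<psi> 0) \<le> ?D * ((1 + E0) * ?K)"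
    proof (rule norm_vec_le)
      fix \<alpha>
      have x: "lt T \<alpha> \<in> It_closed T \<alpha>" by (rule It_closed_nonempty[OF T(1)])
      then have "\<bar>\<phi> \<alpha> (lt T \<alpha>) - \<psi> 0 $ \<alpha>\<bar> \<le> E0 * ?K" using \<psi>(2)[of "lt T \<alpha>" 0 \<alpha>] by (simp add: RV_0)
      then show "\<bar>\<psi> 0 $ \<alpha>\<bar> \<le> (1 + E0) * ?K" using C1_abs_le[OF \<phi>1 x] by (simp add: algebra_simps)
    qed
    also have "\<dots> \<le> E * ?K" using mult_right_mono[OF E0E(2) K] by (simp only: mult.assoc)
    finally have 1: "norm (\<psi> 0) \<le> E * ?K" .
    have 2: "norm (\<psi> (Suc n) - elem (RV T n) *v \<psi> n) \<le> E * ?K" for n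
    proof -
      let ?R = "RV T n"
      have R: "iem ?R" "generic_ends ?R" "RV T (Suc n) = step ?R"
        using RV_iem[OF T] RV_generic[OF T] RV_Suc[OF T] by auto
      have "norm (\<psi> (Suc n) - elem ?R *v \<psi> n) \<le> ?D * (3 * E0 * ?K)"
      proof (rule norm_vec_le)
        fix \<alpha>
        let ?x = "lt (step ?R) \<alpha>"
        have x: "?x \<in> It_closed (step ?R) \<alpha>" by (rule It_closed_nonempty[OF iem_step[OF R(1,2)]])
        have "\<bar>gstep ?R (SB T n \<phi>) \<alpha> ?x - (elem ?R *v \<psi> n) $ \<alpha>\<bar> \<le> 2 * (E0 * ?K)"
          by (rule gstep_diff_bound[OF R(1,2) \<psi>(2) E0K x])
        moreover have "\<bar>gstep ?R (SB T n \<phi>) \<alpha> ?x - \<psi> (Suc n) $ \<alpha>\<bar> \<le> E0 * ?K"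
          using \<psi>(2)[of ?x "Suc n" \<alpha>] x by (simp add: R(3))
        ultimately show "\<bar>(\<psi> (Suc n) - elem ?R *v \<psi> n) $ \<alpha>\<bar> \<le> 3 * E0 * ?K" by simp
      qed
      also have "\<dots> \<le> E * ?K" using mult_right_mono[OF E0E(3) K] by (simp only: mult.assoc)
      finally show ?thesis .
    qed
    have EK: "0 \<le> E * ?K" using E0 E0E(1) K by simp
    have "admissible \<psi> (E * ?K)" unfolding admissible_def using 1 2 \<psi>(1) EK by blast
    moreover have "\<bar>SB T n \<phi> \<alpha> x - \<psi> n $ \<alpha>\<bar> \<le> E * ?K" if "x \<in> It_closed (RV T n) \<alpha>" for n \<alpha> x
      using \<psi>(2)[OF that] mult_right_mono[OF E0E(1) K] by linarith
    ultimately show ?thesis by blast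
  qed
  moreover have "0 \<le> E" using E0 by (simp add: E_def)
  ultimately show ?thesis by blast
qed

text \<open>The order of choices matters: c is fixed before \<tau>, so that it can equal
  \<open>L1\<close>, and K is fixed before \<phi>, so that the final constant is uniform.\<close>

lemma L1_exists_bound:
  "\<exists>K. \<forall>\<phi>\<in>C1_0 T. \<exists>c\<in>\<Gamma>u. \<forall>\<tau>>0. \<forall>n \<alpha>. \<forall>x\<in>It_closed (RV T n) \<alpha>.
    \<bar>SB T n \<phi> \<alpha> x - (KZ T n *v c) $ \<alpha>\<bar> \<le> K \<tau> * C_norm 1 T \<phi> * N n powr \<tau>"
proof -
  obtain E where E: "E \<ge> 0" "\<And>\<phi>. \<phi> \<in> C1_0 T \<Longrightarrow> \<exists>\<psi>. admissible \<psi> (E * C_norm 1 T \<phi>) \<and>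
    (\<forall>n \<alpha>. \<forall>x\<in>It_closed (RV T n) \<alpha>. \<bar>SB T n \<phi> \<alpha> x - \<psi> n $ \<alpha>\<bar> \<le> E * C_norm 1 T \<phi>)"
    using admissible_approximation by blast
  obtain Ku where Ku: "Ku > 0" "\<And>\<psi> M. admissible \<psi> M \<Longrightarrow> \<exists>c\<in>\<Gamma>u. norm c \<le> Ku * M \<and> shadows \<psi> c"
    using shadow_exists by blast
  have "\<forall>\<tau>. \<exists>C. \<tau> > 0 \<longrightarrow> C > 0 \<and> (\<forall>\<psi> M c n. admissible \<psi> M \<longrightarrow> shadows \<psi> c \<longrightarrow> norm c \<le> Ku * M \<longrightarrow>
    norm (\<psi> n - KZ T n *v c) \<le> C * N n powr \<tau> * M)"
    using shadow_bound[of _ Ku] by blast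
  from choice[OF this] obtain C where C': "\<forall>\<tau>. \<tau> > 0 \<longrightarrow> C \<tau> > 0 \<and> (\<forall>\<psi> M c n. admissible \<psi> M \<longrightarrow>
    shadows \<psi> c \<longrightarrow> norm c \<le> Ku * M \<longrightarrow> norm (\<psi> n - KZ T n *v c) \<le> C \<tau> * N n powr \<tau> * M)" ..
  have C: "norm (\<psi> n - KZ T n *v c) \<le> C \<tau> * N n powr \<tau> * M"
    if "\<tau> > 0" "admissible \<psi> M" "shadows \<psi> c" "norm c \<le> Ku * M" for \<tau> \<psi> M c n
    using C' that by blast
  have "\<exists>c\<in>\<Gamma>u. \<forall>\<tau>>0. \<forall>n \<alpha>. \<forall>x\<in>It_closed (RV T n) \<alpha>.
    \<bar>SB T n \<phi> \<alpha> x - (KZ T n *v c) $ \<alpha>\<bar> \<le> (E + C \<tau> * E) * C_norm 1 T \<phi> * N n powr \<tau>"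
    if \<phi>: "\<phi> \<in> C1_0 T" for \<phi>
  proof -
    let ?K = "C_norm 1 T \<phi>"
    have K: "0 \<le> ?K" using \<phi> by (intro C_norm_nonneg[OF T(1)]) (simp add: C1_0_def)
    obtain \<psi> where \<psi>: "admissible \<psi> (E * ?K)"
      "\<And>n \<alpha> x. x \<in> It_closed (RV T n) \<alpha> \<Longrightarrow> \<bar>SB T n \<phi> \<alpha> x - \<psi> n $ \<alpha>\<bar> \<le> E * ?K" using E(2)[OF \<phi>] by blast
    obtain c where c: "c \<in> \<Gamma>u" "norm c \<le> Ku * (E * ?K)" "shadows \<psi> c" using Ku(2)[OF \<psi>(1)] by blast
    have "\<bar>SB T n \<phi> \<alpha> x - (KZ T n *v c) $ \<alpha>\<bar> \<le> (E + C \<tau> * E) * ?K * N n powr \<tau>"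
      if \<tau>: "\<tau> > 0" and x: "x \<in> It_closed (RV T n) \<alpha>" for \<tau> n \<alpha> x
    proof -
      have "\<bar>\<psi> n $ \<alpha> - (KZ T n *v c) $ \<alpha>\<bar> \<le> C \<tau> * N n powr \<tau> * (E * ?K)"
        using component_le_norm_cart[of "\<psi> n - KZ T n *v c" \<alpha>] C[OF \<tau> \<psi>(1) c(3,2), of n] by simp
      moreover have "\<bar>SB T n \<phi> \<alpha> x - \<psi> n $ \<alpha>\<bar> \<le> E * ?K * N n powr \<tau>"
      proof -
        have "E * ?K * 1 \<le> E * ?K * N n powr \<tau>"
          using E(1) K \<tau> ge_one_powr_ge_zero[OF N_ge_1[of n], of \<tau>] by (intro mult_left_mono) auto
        then show ?thesis using \<psi>(2)[OF x] by linarith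
      qed
      ultimately have "\<bar>SB T n \<phi> \<alpha> x - (KZ T n *v c) $ \<alpha>\<bar> \<le> E * ?K * N n powr \<tau> + C \<tau> * N n powr \<tau> * (E * ?K)"
        by linarith
      then show ?thesis by (simp add: algebra_simps)
    qed
    then show ?thesis using c(1) by blast
  qed
  then show ?thesis by (intro exI[of _ "\<lambda>\<tau>. E + C \<tau> * E"]) blast
qed

lemma L1_eq:
  assumes \<phi>: "\<phi> \<in> C1_0 T" and c: "c \<in> \<Gamma>u"
    and bound: "\<And>\<tau> n \<alpha> x. \<tau> > 0 \<Longrightarrow> x \<in> It_closed (RV T n) \<alpha> \<Longrightarrow>
      \<bar>SB T n \<phi> \<alpha> x - (KZ T n *v c) $ \<alpha>\<bar> \<le> K \<tau> * N n powr \<tau>"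
  shows "L1 T \<Gamma>u \<phi> = c"
  unfolding L1_def
proof (rule the_equality)
  have \<phi>1: "\<phi> \<in> C_space 1 T" using \<phi> by (simp add: C1_0_def)
  note sb = C1_special_birkhoff[OF T \<phi>1]
  let ?f = "\<lambda>c n. C_norm 0 (RV T n) (special_birkhoff T 0 n (minus_Gamma \<phi> c))"
  show "c \<in> \<Gamma>u \<and> (\<forall>\<tau>>0. ?f c \<in> O(\<lambda>n. mat_norm (B T 0 n) powr \<tau>))"
  proof (intro conjI c allI impI)
    fix \<tau> :: real assume \<tau>: "\<tau> > 0"
    show "?f c \<in> O(\<lambda>n. mat_norm (B T 0 n) powr \<tau>)"
    proof (rule bigoI[of _ "K \<tau>"], rule always_eventually, rule allI)
      fix n
      have "?f c n \<le> K \<tau> * N n powr \<tau>"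
        by (rule C_norm_0_le[OF RV_iem[OF T]]) (simp add: sb(2) bound[OF \<tau>])
      moreover have "0 \<le> ?f c n" by (rule C_norm_nonneg[OF RV_iem[OF T] sb(1)])
      ultimately show "norm (?f c n) \<le> K \<tau> * norm (mat_norm (B T 0 n) powr \<tau>)"
        by (simp add: B_0_eq_KZ[OF T] rv_norm_def)
    qed
  qed
  fix c' assume c': "c' \<in> \<Gamma>u \<and> (\<forall>\<tau>>0. ?f c' \<in> O(\<lambda>n. mat_norm (B T 0 n) powr \<tau>))"
  have "c' - c = 0"
  proof (rule subpolynomial_unique)
    show "c' - c \<in> \<Gamma>u" using c c' by (intro subspace_diff[OF u_subspace]) auto
    fix \<tau> :: real assume \<tau>: "\<tau> > 0"
    have "?f c' \<in> O(\<lambda>n. N n powr \<tau>)" using c' \<tau> by (simp add: B_0_eq_KZ[OF T] rv_norm_def)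
    moreover have "0 < N n powr \<tau>" for n using N_ge_1[of n] by simp
    ultimately have "\<exists>C>0. \<forall>n. \<bar>?f c' n\<bar> \<le> C * N n powr \<tau>" by (rule bigo_sequence_bound)
    then obtain C where C: "\<And>n. \<bar>?f c' n\<bar> \<le> C * N n powr \<tau>" by blast
    have "norm (KZ T n *v (c' - c)) \<le> (real CARD('a) * (C + K \<tau>)) * N n powr \<tau>" for n
    proof -
      have "norm (KZ T n *v (c' - c)) \<le> real CARD('a) * ((C + K \<tau>) * N n powr \<tau>)"
      proof (rule norm_vec_le)
        fix \<alpha>
        let ?x = "lt (RV T n) \<alpha>"
        have x: "?x \<in> It_closed (RV T n) \<alpha>" by (rule It_closed_nonempty[OF RV_iem[OF T]])
        have "\<bar>nth_deriv_within (It_closed (RV T n) \<alpha>) 0 (special_birkhoff T 0 n (minus_Gamma \<phi> c') \<alpha>) ?x\<bar> \<le> ?f c' n"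
          by (rule nth_deriv_le_C_norm[OF sb(1) _ x]) simp
        then have "\<bar>SB T n \<phi> \<alpha> ?x - (KZ T n *v c') $ \<alpha>\<bar> \<le> C * N n powr \<tau>"
          using C[of n] sb(2)[OF x, of c'] by (simp add: nth_deriv_within_def)
        then show "\<bar>(KZ T n *v (c' - c)) $ \<alpha>\<bar> \<le> (C + K \<tau>) * N n powr \<tau>"
          using bound[OF \<tau> x] by (simp add: matrix_vector_mult_diff_distrib distrib_right)
      qed
      then show ?thesis by (simp add: mult.assoc)
    qed
    then show "\<exists>C. \<forall>n. norm (KZ T n *v (c' - c)) \<le> C * N n powr \<tau>" by blast
  qed
  then show "c' = c" by simp
qed

section \<open>Summation over the steps of the algorithm\<close>

lemma hgt_unbounded:
  assumes grow: "\<And>n \<alpha>. N n \<le> C * real (hgt T n \<alpha>) ^ 4" and C: "1 \<le> C"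
  shows "\<exists>n. \<forall>\<alpha>. L < hgt T n \<alpha>"
proof -
  have "\<forall>\<^sub>F n in sequentially. C * real L ^ 4 < N n"
    using rv_norm_tendsto[OF T] by (simp add: filterlim_at_top_dense)
  then obtain n where n: "C * real L ^ 4 < N n" by (auto simp: eventually_sequentially)
  have "L < hgt T n \<alpha>" for \<alpha>
  proof (rule ccontr)
    assume "\<not> L < hgt T n \<alpha>"
    then have "C * real (hgt T n \<alpha>) ^ 4 \<le> C * real L ^ 4" using C by (intro mult_left_mono power_mono) auto
    then show False using grow[of n \<alpha>] n by linarith
  qed
  then show ?thesis by blast
qed

text \<open>Ensures that the supremum defining \<open>birkhoff_norm\<close> is taken over a nonempty
  set.\<close>

lemma orbit_defined_exists:
  assumes "L \<le> hgt T n \<alpha>" shows "\<exists>x. orbit_defined T L x"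
  using tower[OF T It_nonempty[OF RV_iem[OF T], of n \<alpha>]] assms
  unfolding orbit_defined_def by (meson less_le_trans)

text \<open>Stop at the first n at which all towers are higher than L. Just before, some tower is
  not, so N is at most C times the fourth power of L there. The bound has at most about N powr
  \<tau> terms, each of that size, which gives the exponent 8\<tau>.\<close>

lemma birkhoff_norm_bound:
  assumes grow: "\<And>n \<alpha>. N n \<le> C * real (hgt T n \<alpha>) ^ 4" and C: "1 \<le> C"
    and steps_\<tau>: "\<And>n. real n \<le> Cf * N n powr \<tau>" "1 \<le> Cf" and \<tau>: "\<tau> > 0"
    and f: "\<And>n \<alpha> x. x \<in> It_closed (RV T n) \<alpha> \<Longrightarrow> \<bar>SB T n f \<alpha> x\<bar> \<le> M * N n powr \<tau>" and M: "0 \<le> M"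
    and L: "1 \<le> L"
  shows "birkhoff_norm T L f \<le> 4 * Cf * C powr (2 * \<tau>) * M * real L powr (8 * \<tau>)"
proof -
  obtain n0 where "\<forall>\<alpha>. L < hgt T n0 \<alpha>" using hgt_unbounded[OF grow C] by blast
  then obtain n where n: "\<forall>\<alpha>. L < hgt T n \<alpha>" "\<And>k. k < n \<Longrightarrow> \<not> (\<forall>\<alpha>. L < hgt T k \<alpha>)"
    using exists_least_iff[of "\<lambda>n. \<forall>\<alpha>. L < hgt T n \<alpha>"] by blast
  have "n \<noteq> 0" using n(1) L by (cases n) auto
  then obtain n' where n': "n = Suc n'" by (cases n) auto
  obtain \<alpha> where \<alpha>: "hgt T n' \<alpha> \<le> L" using n(2)[of n'] n' by (auto simp: not_less)
  have N: "N n' \<le> C * real L ^ 4"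
  proof -
    have "C * real (hgt T n' \<alpha>) ^ 4 \<le> C * real L ^ 4" using \<alpha> C by (intro mult_left_mono power_mono) auto
    then show ?thesis using grow[of n' \<alpha>] by linarith
  qed
  have N1: "1 \<le> N n' powr \<tau>" using ge_one_powr_ge_zero[OF N_ge_1[of n'], of \<tau>] \<tau> by simp
  have "\<bar>birkhoff_sum T L f x\<bar> \<le> 4 * Cf * C powr (2 * \<tau>) * M * real L powr (8 * \<tau>)" if x: "orbit_defined T L x" for x
  proof -
    have "\<bar>SB T i f \<alpha> z\<bar> \<le> M * N i powr \<tau>" if "z \<in> It (RV T i) \<alpha>" for i \<alpha> z
      using f subsetD[OF It_subset_closed that] by blast
    then have "\<bar>birkhoff_sum T L f x\<bar> \<le> 2 * (\<Sum>i<n. M * N i powr \<tau>)"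
      by (rule birkhoff_bound[OF T _ x n(1)[rule_format]])
    also have "\<dots> \<le> 2 * (\<Sum>i<n. M * N n' powr \<tau>)"
    proof -
      have *: "M * N i powr \<tau> \<le> M * N n' powr \<tau>" if "i < n" for i
        using that M \<tau> N_ge_1[of i] N_mono[of i n'] by (intro mult_left_mono powr_mono2) (auto simp: n')
      have "(\<Sum>i<n. M * N i powr \<tau>) \<le> (\<Sum>i<n. M * N n' powr \<tau>)" by (rule sum_mono) (simp add: *)
      then show ?thesis by simp
    qed
    also have "\<dots> = 2 * ((real n' + 1) * (M * N n' powr \<tau>))" by (simp add: n' add.commute)
    also have "\<dots> \<le> 2 * ((2 * Cf * N n' powr \<tau>) * (M * N n' powr \<tau>))"
    proof -
      have "1 \<le> Cf * N n' powr \<tau>" by (rule one_le_mult_real[OF steps_\<tau>(2) N1])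
      then have "real n' + 1 \<le> 2 * Cf * N n' powr \<tau>" using steps_\<tau>(1)[of n'] by linarith
      then show ?thesis using M by (intro mult_left_mono mult_right_mono) auto
    qed
    also have "\<dots> = 4 * Cf * M * (N n' powr \<tau> * N n' powr \<tau>)" by simp
    also have "N n' powr \<tau> * N n' powr \<tau> = N n' powr (2 * \<tau>)" by (simp flip: powr_add)
    also have "4 * Cf * M * N n' powr (2 * \<tau>) \<le> 4 * Cf * M * (C * real L ^ 4) powr (2 * \<tau>)"
      using N N_ge_1[of n'] \<tau> M steps_\<tau>(2) by (intro mult_left_mono powr_mono2) auto
    also have "(C * real L ^ 4) powr (2 * \<tau>) = C powr (2 * \<tau>) * real L powr (8 * \<tau>)"
    proof -
      have "real L ^ 4 = real L powr 4" using L by (simp add: powr_numeral)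
      then show ?thesis unfolding \<open>real L ^ 4 = real L powr 4\<close>
        using C by (simp add: powr_mult powr_powr del: powr_numeral)
    qed
    finally show ?thesis by (simp add: mult_ac)
  qed
  moreover obtain x where "orbit_defined T L x" using orbit_defined_exists[of L n \<alpha>] n(1) less_imp_le by blast
  ultimately show ?thesis unfolding birkhoff_norm_def by (intro cSUP_least) auto
qed

lemma birkhoff_norm_subpolynomial:
  assumes grow: "\<And>n \<alpha>. N n \<le> C * real (hgt T n \<alpha>) ^ 4" and C: "1 \<le> C" and \<tau>: "\<tau> > 0"
  shows "\<exists>C. \<forall>\<phi>\<in>C1_0 T. \<forall>L\<ge>1.
    birkhoff_norm T L (minus_Gamma \<phi> (L1 T \<Gamma>u \<phi>)) \<le> C * C_norm 1 T \<phi> * real L powr \<tau>"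
proof -
  have \<tau>8: "\<tau> / 8 > 0" using \<tau> by simp
  obtain K where K: "\<And>\<phi>. \<phi> \<in> C1_0 T \<Longrightarrow> \<exists>c\<in>\<Gamma>u. \<forall>\<tau>>0. \<forall>n \<alpha>. \<forall>x\<in>It_closed (RV T n) \<alpha>.
    \<bar>SB T n \<phi> \<alpha> x - (KZ T n *v c) $ \<alpha>\<bar> \<le> K \<tau> * C_norm 1 T \<phi> * N n powr \<tau>" using L1_exists_bound by blast
  obtain Cf where Cf: "Cf \<ge> 1" "\<And>n. real n \<le> Cf * N n powr (\<tau> / 8)" using steps[OF \<tau>8] by blast
  have "birkhoff_norm T L (minus_Gamma \<phi> (L1 T \<Gamma>u \<phi>)) \<le>
      (4 * Cf * C powr (2 * (\<tau> / 8)) * \<bar>K (\<tau> / 8)\<bar>) * C_norm 1 T \<phi> * real L powr \<tau>"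
    if \<phi>: "\<phi> \<in> C1_0 T" and L: "1 \<le> L" for \<phi> L
  proof -
    have Kn: "0 \<le> C_norm 1 T \<phi>" using \<phi> by (intro C_norm_nonneg[OF T(1)]) (simp add: C1_0_def)
    obtain c where c: "c \<in> \<Gamma>u" "\<And>\<tau> n \<alpha> x. \<tau> > 0 \<Longrightarrow> x \<in> It_closed (RV T n) \<alpha> \<Longrightarrow>
      \<bar>SB T n \<phi> \<alpha> x - (KZ T n *v c) $ \<alpha>\<bar> \<le> K \<tau> * C_norm 1 T \<phi> * N n powr \<tau>" using K[OF \<phi>] by blast
    have L1: "L1 T \<Gamma>u \<phi> = c" by (rule L1_eq[OF \<phi> c])
    have "birkhoff_norm T L (minus_Gamma \<phi> c) \<le>
        4 * Cf * C powr (2 * (\<tau> / 8)) * (\<bar>K (\<tau> / 8)\<bar> * C_norm 1 T \<phi>) * real L powr (8 * (\<tau> / 8))"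
    proof (rule birkhoff_norm_bound[OF grow C Cf(2,1) \<tau>8 _ _ L])
      fix n \<alpha> x assume x: "x \<in> It_closed (RV T n) \<alpha>"
      have "K (\<tau> / 8) * C_norm 1 T \<phi> * N n powr (\<tau> / 8) \<le> \<bar>K (\<tau> / 8)\<bar> * C_norm 1 T \<phi> * N n powr (\<tau> / 8)"
        using Kn by (intro mult_right_mono) auto
      then show "\<bar>SB T n (minus_Gamma \<phi> c) \<alpha> x\<bar> \<le> \<bar>K (\<tau> / 8)\<bar> * C_norm 1 T \<phi> * N n powr (\<tau> / 8)"
        using c(2)[OF \<tau>8 x] by (simp add: SB_minus_Gamma[OF T])
    qed (use Kn in simp)
    then show ?thesis by (simp add: L1 mult_ac)
  qed
  then show ?thesis by blast
qed

end

theorem mainTheorem3: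
  fixes T :: "'a::finite iem" and \<Gamma>u :: "(real^'a) set"
  assumes "iem T" and "no_connection T"
    and "\<And>\<tau>. \<tau> > 0 \<Longrightarrow>
      (\<lambda>k. mat_norm (B T (accel T k) (accel T (Suc k))))
        \<in> O(\<lambda>k. mat_norm (B T 0 (accel T k)) powr \<tau>)"
    and "\<And>\<tau>. \<tau> > 0 \<Longrightarrow>
      \<exists>C. \<forall>m n. m \<le> n \<longrightarrow> Bs_norm T m n \<le> C * mat_norm (B T 0 n) powr \<tau>"
    and "\<And>\<tau>. \<tau> > 0 \<Longrightarrow>
      \<exists>C. \<forall>m n. m \<le> n \<longrightarrow> B_flat_inv_norm T m n \<le> C * mat_norm (B T 0 n) powr \<tau>"
    and "dim (Gamma_s T) = genus T"
    and "supplement \<Gamma>u (Gamma_s T) (Gamma_bd T)"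
  shows "\<forall>\<tau>>0. \<exists>C. \<forall>\<phi> \<in> C1_0 T. \<forall>N\<ge>1.
    birkhoff_norm T N (minus_Gamma \<phi> (L1 T \<Gamma>u \<phi>)) \<le> C * C_norm 1 T \<phi> * real N powr \<tau>"
proof -
  note T = assms(1,2)
  interpret stable_cocycle T \<Gamma>u
  proof
    show "iem T" "no_connection T" by (rule T)+
    fix \<tau> :: real assume \<tau>: "\<tau> > 0"
    show "\<exists>C\<ge>1. \<forall>n. real n \<le> C * rv_norm T n powr \<tau>" by (rule steps_subpolynomial[OF T assms(3) \<tau>])
    obtain C where C: "\<And>m n. m \<le> n \<Longrightarrow> Bs_norm T m n \<le> C * rv_norm T n powr \<tau>"
      using assms(4)[OF \<tau>] by (auto simp: rv_norm_def B_0_eq_KZ[OF T])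
    \<comment> \<open>The factor d passes from the supremum norm to the Euclidean norm, and
      replacing C by its absolute value plus 1 makes the constant positive.\<close>
    have "norm (KZ (RV T m) k *v s) \<le> real CARD('a) * (\<bar>C\<bar> + 1) * rv_norm T (m + k) powr \<tau> * norm s"
      if "s \<in> (*v) (KZ T m) ` Gamma_s T" for m k s
    proof -
      have s: "s \<in> Gamma_s (RV T m)" using that Gamma_s_push[OF T] by blast
      have "Bs_norm T m (m + k) \<le> (\<bar>C\<bar> + 1) * rv_norm T (m + k) powr \<tau>"
      proof -
        have "C * rv_norm T (m + k) powr \<tau> \<le> (\<bar>C\<bar> + 1) * rv_norm T (m + k) powr \<tau>" by (intro mult_right_mono) auto
        then show ?thesis using C[of m "m + k"] by simp
      qed
      then have "Bs_norm T m (m + k) * infnorm s \<le> (\<bar>C\<bar> + 1) * rv_norm T (m + k) powr \<tau> * infnorm s"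
        by (intro mult_right_mono infnorm_pos_le)
      also have "\<dots> \<le> (\<bar>C\<bar> + 1) * rv_norm T (m + k) powr \<tau> * norm s"
        by (intro mult_left_mono infnorm_le_norm) auto
      finally have "infnorm (KZ (RV T m) k *v s) \<le> (\<bar>C\<bar> + 1) * rv_norm T (m + k) powr \<tau> * norm s"
        using Bs_norm_bound[OF T s, of k] by linarith
      then have "real CARD('a) * infnorm (KZ (RV T m) k *v s) \<le>
          real CARD('a) * ((\<bar>C\<bar> + 1) * rv_norm T (m + k) powr \<tau> * norm s)" by (intro mult_left_mono) auto
      from order_trans[OF norm_le_card_infnorm this] show ?thesis by (simp only: mult.assoc)
    qed
    moreover have "0 < real CARD('a) * (\<bar>C\<bar> + 1)" by (simp add: add_nonneg_pos)
    ultimately show "\<exists>C>0. \<forall>m k. \<forall>s\<in>(*v) (KZ T m) ` Gamma_s T.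
        norm (KZ (RV T m) k *v s) \<le> C * rv_norm T (m + k) powr \<tau> * norm s" by blast
  next
    show "rank (Omega T) \<le> 2 * dim (Gamma_s T) + 1" unfolding assms(6) genus_def by linarith
    show "supplement \<Gamma>u (Gamma_s T) (range ((*v) (Omega T)))"
      using assms(7) Gamma_bd_eq_range_Omega[OF T(1)] by simp
  qed
  obtain C where "C \<ge> 1" "\<And>n \<alpha>. rv_norm T n \<le> C * real (hgt T n \<alpha>) ^ 4"
    using rv_norm_le_hgt_power[OF T assms(3)] by blast
  then show ?thesis using birkhoff_norm_subpolynomial by blast
qed

end
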